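(* Let $\Omega\subseteq\mathbb{R}^d$ be open, $p\in[1,\infty)$, $m\in\mathbb{N}$, $v\in\mathcal{C}^{m,*}(\Omega)$, $s:\pi_m\to[0,\infty)$ an admissible map, and $n\ge1$. Assume that for every $\alpha\in\pi_m^0$ there is $C>0$ with $|\partial^\alpha v(x)|\le C$ for all $x\in M_n\setminus M_{2n}$. Then for every $f\in W^{m,p}_{s,v}(\Omega)$ we have $\chi_nf\in W^{m,p}(\Omega)$, with $$D^\alpha(\chi_nf)=\sum_{0\le\beta\le\alpha}\binom{\alpha}{\beta}D^\beta_vf\,\partial^{\alpha-\beta}\chi_n\quad\text{for all }\alpha\in\pi_m^0,$$ and the map $W^{m,p}_{s,v}(\Omega)\to W^{m,p}(\Omega)$, $f\mapsto\chi_nf$, is continuous.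
   Context: Throughout, $\Omega\subseteq\mathbb{R}^d$ is open, $\mathbb{N}=\{0,1,2,\dots\}$, $p\in[1,\infty)$, $K\Subset\Omega$ means $K$ compact in $\Omega$, $\pi_m=\{\alpha\in\mathbb{N}^d:|\alpha|\le m\}$, $\pi_m^0=\pi_m\setminus\{0\}$, $\beta\le\alpha$ componentwise. A weight is a locally integrable function positive a.e.; $E_p(\Omega)$ is the set of measurable $w$ with $|w|^p$ a weight. For measurable $u$, $L^p_u(\Omega)=\{f:fu\in L^p(\Omega)\}$ with norm $\|fu\|_{L^p}$; $L^p_{u,\mathrm{loc}}$: $fu\in L^p(K)$ for all $K\Subset\Omega$. $\mathcal{C}^{k,*}(\Omega)$: $v\in\mathcal{C}^k(\Omega)$ with $v\ne0$ a.e. Condition (H): for every $K\Subset\Omega$ there is $C>0$ with $|v|\le C|w|$ a.e. in $K$. Weak derivative $D^\alpha_v$ ($|\alpha|\ge1$, $w\in E_p(\Omega)$, $v\in\mathcal{C}^{|\alpha|,*}(\Omega)$ with (H) w.r.t. $w$): for $f\in L^1_{w,\mathrm{loc}}(\Omega)$, $D^\alpha_vf$ is the unique $g\in L^1_{v^{|\alpha|+1},\mathrm{loc}}(\Omega)$, if it exists, with $\int_\Omega f\,\partial^\alpha(v^{|\alpha|+1}\phi)\,dx=(-1)^{|\alpha|}\int_\Omega v^{|\alpha|+1}\phi\,g\,dx$ for all $\phi\in C_c^\infty(\Omega)$; $D^0_vf:=f$. $W^{m,p}_{V,v}(\Omega)$ for $V=\{w_\alpha\}_{\alpha\in\pi_m}\subset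 E_p(\Omega)$, $v\in\mathcal{C}^{m,*}(\Omega)$ with (H) w.r.t. $w_0$: all $f\in L^p_{w_0}(\Omega)$ with $D^\alpha_vf\in L^p_{w_\alpha}(\Omega)$ for $\alpha\in\pi_m^0$, norm $(\sum_{\alpha\in\pi_m}\|w_\alpha D^\alpha_vf\|_{L^p}^p)^{1/p}$. Admissible map: $s:\pi_m\to[0,\infty)$ with $s(\alpha)\le|\alpha|$ and $s(\alpha-\beta)+s(\beta)\le s(\alpha)$ for $\alpha\in\pi_m,\beta\le\alpha$. $W^{m,p}_{s,v}(\Omega):=W^{m,p}_{V,v}(\Omega)$ with $w_\alpha=|v|^{s(\alpha)+1}$. Cut-offs: fix $\eta\in\mathcal{C}^\infty(\mathbb{R})$ with $0\le\eta\le1$, $\eta\equiv1$ on $\mathbb{R}\setminus[-1,1]$, $\eta\equiv0$ on $[-\tfrac12,\tfrac12]$. For $n\ge1$ set $\chi_n:=\eta(n\,v(\cdot))$ and $M_n:=\{x\in\Omega:|v(x)|\le1/n\}$. Thus $\chi_n\equiv1$ on $\Omega\setminus M_n$ and $\chi_n\equiv0$ on $M_{2n}$. *)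

theory Defs
  imports "HOL-Analysis.Analysis"
begin

type_synonym 'd mindex = "'d \<Rightarrow> nat"

definition msize :: "('d::finite) mindex \<Rightarrow> nat" where
  "msize \<alpha> = (\<Sum>i\<in>UNIV. \<alpha> i)"

definition mbinom :: "('d::finite) mindex \<Rightarrow> 'd mindex \<Rightarrow> nat" where
  "mbinom \<alpha> \<beta> = (\<Prod>i\<in>UNIV. \<alpha> i choose \<beta> i)"

definition partial1 :: "'d::finite \<Rightarrow> (real^'d \<Rightarrow> real) \<Rightarrow> real^'d \<Rightarrow> real" where
  "partial1 i g x = deriv (\<lambda>t. g (x + t *\<^sub>R axis i 1)) 0"

primrec cpd_aux :: "nat \<Rightarrow> ('d::finite) mindex \<Rightarrow> (real^'d \<Rightarrow> real) \<Rightarrow> real^'d \<Rightarrow> real" where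
  "cpd_aux 0 \<alpha> g = g"
| "cpd_aux (Suc k) \<alpha> g =
     (if \<alpha> = (\<lambda>_. 0) then g
      else (let i = (SOME i. \<alpha> i \<noteq> 0) in partial1 i (cpd_aux k (\<alpha>(i := \<alpha> i - 1)) g)))"

definition cpartial :: "('d::finite) mindex \<Rightarrow> (real^'d \<Rightarrow> real) \<Rightarrow> real^'d \<Rightarrow> real" where
  "cpartial \<alpha> g = cpd_aux (msize \<alpha>) \<alpha> g"

definition Ck_on :: "nat \<Rightarrow> (real^'d::finite) set \<Rightarrow> (real^'d \<Rightarrow> real) \<Rightarrow> bool" where
  "Ck_on k \<Omega> g \<longleftrightarrow>
     (\<forall>\<alpha>::'d mindex. msize \<alpha> \<le> k \<longrightarrow> continuous_on \<Omega> (cpartial \<alpha> g)) \<and>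
     (\<forall>\<alpha>::'d mindex. msize \<alpha> < k \<longrightarrow>
        (\<forall>i. \<forall>x\<in>\<Omega>. (\<lambda>t. cpartial \<alpha> g (x + t *\<^sub>R axis i 1)) differentiable (at 0)) \<and>
        (\<forall>i. continuous_on \<Omega> (partial1 i (cpartial \<alpha> g))))"

definition Ck_star_on :: "nat \<Rightarrow> (real^'d::finite) set \<Rightarrow> (real^'d \<Rightarrow> real) \<Rightarrow> bool" where
  "Ck_star_on k \<Omega> v \<longleftrightarrow> Ck_on k \<Omega> v \<and> (AE x in lebesgue_on \<Omega>. v x \<noteq> 0)"

definition test_fun :: "(real^'d::finite) set \<Rightarrow> (real^'d \<Rightarrow> real) \<Rightarrow> bool" where
  "test_fun \<Omega> \<phi> \<longleftrightarrow> (\<forall>k. Ck_on k UNIV \<phi>) \<and>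
     compact (closure {x. \<phi> x \<noteq> 0}) \<and> closure {x. \<phi> x \<noteq> 0} \<subseteq> \<Omega>"

definition Lpw :: "(real^'d::finite) set \<Rightarrow> real \<Rightarrow> (real^'d \<Rightarrow> real) \<Rightarrow> (real^'d \<Rightarrow> real) \<Rightarrow> bool" where
  "Lpw \<Omega> p u f \<longleftrightarrow> (\<lambda>x. f x * u x) \<in> borel_measurable (lebesgue_on \<Omega>) \<and>
     integrable (lebesgue_on \<Omega>) (\<lambda>x. \<bar>f x * u x\<bar> powr p)"

definition L1loc_w :: "(real^'d::finite) set \<Rightarrow> (real^'d \<Rightarrow> real) \<Rightarrow> (real^'d \<Rightarrow> real) \<Rightarrow> bool" where
  "L1loc_w \<Omega> u g \<longleftrightarrow> (\<forall>K. compact K \<and> K \<subseteq> \<Omega> \<longrightarrow> integrable (lebesgue_on K) (\<lambda>x. g x * u x))"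

definition is_wderiv_v :: "(real^'d::finite) set \<Rightarrow> (real^'d \<Rightarrow> real) \<Rightarrow> 'd mindex
    \<Rightarrow> (real^'d \<Rightarrow> real) \<Rightarrow> (real^'d \<Rightarrow> real) \<Rightarrow> bool" where
  "is_wderiv_v \<Omega> v \<alpha> f g \<longleftrightarrow>
     L1loc_w \<Omega> (\<lambda>x. v x ^ (msize \<alpha> + 1)) g \<and>
     (\<forall>\<phi>. test_fun \<Omega> \<phi> \<longrightarrow>
        (\<integral>x. f x * cpartial \<alpha> (\<lambda>y. v y ^ (msize \<alpha> + 1) * \<phi> y) x \<partial>lebesgue_on \<Omega>)
        = (-1) ^ msize \<alpha> * (\<integral>x. v x ^ (msize \<alpha> + 1) * \<phi> x * g x \<partial>lebesgue_on \<Omega>))"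

definition Dv :: "(real^'d::finite) set \<Rightarrow> (real^'d \<Rightarrow> real) \<Rightarrow> 'd mindex
    \<Rightarrow> (real^'d \<Rightarrow> real) \<Rightarrow> real^'d \<Rightarrow> real" where
  "Dv \<Omega> v \<alpha> f = (if \<alpha> = (\<lambda>_. 0) then f else (SOME g. is_wderiv_v \<Omega> v \<alpha> f g))"

abbreviation is_wderiv :: "(real^'d::finite) set \<Rightarrow> 'd mindex
    \<Rightarrow> (real^'d \<Rightarrow> real) \<Rightarrow> (real^'d \<Rightarrow> real) \<Rightarrow> bool" where
  "is_wderiv \<Omega> \<alpha> f g \<equiv> is_wderiv_v \<Omega> (\<lambda>_. 1) \<alpha> f g"

definition Wsob :: "(real^'d::finite) set \<Rightarrow> real \<Rightarrow> nat \<Rightarrow> (real^'d \<Rightarrow> real)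
    \<Rightarrow> ('d mindex \<Rightarrow> real^'d \<Rightarrow> real) \<Rightarrow> (real^'d \<Rightarrow> real) \<Rightarrow> bool" where
  "Wsob \<Omega> p m v w f \<longleftrightarrow> Lpw \<Omega> p (w (\<lambda>_. 0)) f \<and>
     (\<forall>\<alpha>. 0 < msize \<alpha> \<and> msize \<alpha> \<le> m \<longrightarrow>
        (\<exists>g. is_wderiv_v \<Omega> v \<alpha> f g) \<and> Lpw \<Omega> p (w \<alpha>) (Dv \<Omega> v \<alpha> f))"

definition Wsob_norm :: "(real^'d::finite) set \<Rightarrow> real \<Rightarrow> nat \<Rightarrow> (real^'d \<Rightarrow> real)
    \<Rightarrow> ('d mindex \<Rightarrow> real^'d \<Rightarrow> real) \<Rightarrow> (real^'d \<Rightarrow> real) \<Rightarrow> real" where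
  "Wsob_norm \<Omega> p m v w f =
     (\<Sum>\<alpha>\<in>{\<alpha>. msize \<alpha> \<le> m}. \<integral>x. \<bar>w \<alpha> x * Dv \<Omega> v \<alpha> f x\<bar> powr p \<partial>lebesgue_on \<Omega>) powr (1 / p)"

definition s_weights :: "('d mindex \<Rightarrow> real) \<Rightarrow> (real^'d::finite \<Rightarrow> real) \<Rightarrow> 'd mindex \<Rightarrow> real^'d \<Rightarrow> real" where
  "s_weights s v \<alpha> x = \<bar>v x\<bar> powr (s \<alpha> + 1)"

abbreviation Wsv :: "(real^'d::finite) set \<Rightarrow> real \<Rightarrow> nat \<Rightarrow> ('d mindex \<Rightarrow> real)
    \<Rightarrow> (real^'d \<Rightarrow> real) \<Rightarrow> (real^'d \<Rightarrow> real) \<Rightarrow> bool" where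
  "Wsv \<Omega> p m s v f \<equiv> Wsob \<Omega> p m v (s_weights s v) f"

abbreviation Wsv_norm :: "(real^'d::finite) set \<Rightarrow> real \<Rightarrow> nat \<Rightarrow> ('d mindex \<Rightarrow> real)
    \<Rightarrow> (real^'d \<Rightarrow> real) \<Rightarrow> (real^'d \<Rightarrow> real) \<Rightarrow> real" where
  "Wsv_norm \<Omega> p m s v f \<equiv> Wsob_norm \<Omega> p m v (s_weights s v) f"

abbreviation W :: "(real^'d::finite) set \<Rightarrow> real \<Rightarrow> nat \<Rightarrow> (real^'d \<Rightarrow> real) \<Rightarrow> bool" where
  "W \<Omega> p m f \<equiv> Wsob \<Omega> p m (\<lambda>_. 1) (\<lambda>_ _. 1) f"

abbreviation W_norm :: "(real^'d::finite) set \<Rightarrow> real \<Rightarrow> nat \<Rightarrow> (real^'d \<Rightarrow> real) \<Rightarrow> real" where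
  "W_norm \<Omega> p m f \<equiv> Wsob_norm \<Omega> p m (\<lambda>_. 1) (\<lambda>_ _. 1) f"

definition admissible :: "nat \<Rightarrow> (('d::finite) mindex \<Rightarrow> real) \<Rightarrow> bool" where
  "admissible m s \<longleftrightarrow>
     (\<forall>\<alpha>. msize \<alpha> \<le> m \<longrightarrow> 0 \<le> s \<alpha> \<and> s \<alpha> \<le> real (msize \<alpha>) \<and>
        (\<forall>\<beta>. \<beta> \<le> \<alpha> \<longrightarrow> s (\<alpha> - \<beta>) + s \<beta> \<le> s \<alpha>))"

definition cutoff_eta :: "(real \<Rightarrow> real) \<Rightarrow> bool" where
  "cutoff_eta \<eta> \<longleftrightarrow> (\<forall>k x. ((deriv ^^ k) \<eta>) differentiable (at x)) \<and>
     (\<forall>x. 0 \<le> \<eta> x \<and> \<eta> x \<le> 1) \<and>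
     (\<forall>x. x \<notin> {-1..1} \<longrightarrow> \<eta> x = 1) \<and>
     (\<forall>x. x \<in> {-1/2..1/2} \<longrightarrow> \<eta> x = 0)"

definition chi :: "(real \<Rightarrow> real) \<Rightarrow> (real^'d::finite \<Rightarrow> real) \<Rightarrow> nat \<Rightarrow> real^'d \<Rightarrow> real" where
  "chi \<eta> v n x = \<eta> (real n * v x)"

definition Mset :: "(real^'d::finite) set \<Rightarrow> (real^'d \<Rightarrow> real) \<Rightarrow> nat \<Rightarrow> (real^'d) set" where
  "Mset \<Omega> v n = {x\<in>\<Omega>. \<bar>v x\<bar> \<le> 1 / real n}"

end

theory Submission
  imports Defs
begin

text \<open>The derivatives of the cut-off \<open>\<chi>\<close> vanish where \<open>\<bar>v\<bar> < 1 / (2 n)\<close>. Hence, for a test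
  function \<open>\<phi>\<close> and \<open>\<beta> \<le> \<alpha>\<close>, the quotient of \<open>\<phi> D\<^sup>\<alpha>\<^sup>-\<^sup>\<beta> \<chi>\<close> by the power \<open>|\<beta>| + 1\<close> of \<open>v\<close> is
  \<open>|\<beta>|\<close> times continuously differentiable with compact support, and by mollification it may be
  inserted in the identity that defines the weak derivative of order \<open>\<beta>\<close> with respect to \<open>v\<close>.
  Summing over \<open>\<beta>\<close>, the transposed Leibniz identity
  \<open>\<Sum>\<^sub>\<beta> binom \<alpha> \<beta> (-1)\<^sup>|\<^sup>\<alpha>\<^sup>-\<^sup>\<beta>\<^sup>| D\<^sup>\<beta> (\<phi> D\<^sup>\<alpha>\<^sup>-\<^sup>\<beta> \<chi>) = \<chi> D\<^sup>\<alpha> \<phi>\<close> gives the derivatives of \<open>\<chi> f\<close>.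
  Since the derivatives of \<open>\<chi>\<close> are bounded and live where the weights are bounded below, the
  formula also gives the norm estimate. The representative chosen by \<open>Dv\<close> is identified with
  the explicit one by the fundamental lemma of the calculus of variations.\<close>

section \<open>Partial derivatives and their commutation\<close>

text \<open>Three obstacles shape the proof. First, \<open>f\<close> itself need not be locally
  integrable; only \<open>f * v\<close> is, because \<open>s 0 = 0\<close> makes the weight of order
  zero equal to \<open>\<bar>v\<bar>\<close>. The exponent \<open>msize \<beta> + 1\<close> pays for
  this: after \<open>msize \<beta>\<close> derivatives of
  \<open>v ^ (msize \<beta> + 1) * \<phi>\<close> one factor \<open>v\<close> is still left, so the
  integral against \<open>f\<close> exists and is controlled by finitely many derivatives of
  \<open>\<phi>\<close>. Second, \<open>v\<close> is only of class C^m, so the quotients that are to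
  be tested need not be smooth; \<chi> has already lost the order of \<alpha> - \<beta>, and what
  remains is just enough for the order of \<beta>. The kernel of the mollification that bridges this
  gap is made from \<open>\<eta>\<close>. Third, \<open>cpartial\<close> and \<open>Dv\<close> rest
  on arbitrary choices, of an order of differentiation and of a representative; Schwarz's theorem
  and uniqueness almost everywhere remove them. The derivatives of \<open>v\<close> are assumed
  bounded only where 1/(2n) < |v| \<le> 1/n; this suffices because \<open>deriv \<eta>\<close>
  vanishes unless 1/2 < |t| \<le> 1.\<close>

definition has_partial :: "'d::finite \<Rightarrow> (real^'d \<Rightarrow> real) \<Rightarrow> real^'d \<Rightarrow> real \<Rightarrow> bool" where
  "has_partial i g x D \<longleftrightarrow> ((\<lambda>t. g (x + t *\<^sub>R axis i 1)) has_real_derivative D) (at 0)"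

lemma has_partial_ex:
  "(\<exists>D. has_partial i g x D) \<longleftrightarrow> (\<lambda>t. g (x + t *\<^sub>R axis i 1)) differentiable (at 0)"
  by (simp add: has_partial_def real_differentiable_def)

text \<open>\<open>partial1\<close> is total, with an arbitrary value where no derivative exists, so
  existence is carried by the relation \<open>has_partial\<close>; this lemma joins the two.\<close>

lemma has_partial_partial1: "\<exists>D. has_partial i g x D \<Longrightarrow> has_partial i g x (partial1 i g x)"
  unfolding has_partial_ex unfolding has_partial_def partial1_def
  by (simp add: DERIV_deriv_iff_real_differentiable)

lemma partial1_eqI: "has_partial i g x D \<Longrightarrow> partial1 i g x = D"
  unfolding has_partial_def partial1_def by (rule DERIV_imp_deriv)

lemma eventually_axis_line:
  fixes x :: "real^'d::finite"
  assumes "open S" "x \<in> S"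
  shows "\<forall>\<^sub>F t in nhds 0. x + t *\<^sub>R axis i 1 \<in> S"
proof -
  have "((\<lambda>t. x + t *\<^sub>R axis i 1) \<longlongrightarrow> x) (nhds 0)"
    by (auto intro!: tendsto_eq_intros filterlim_ident)
  then show ?thesis using assms by (rule topological_tendstoD)
qed

lemma has_partial_cong:
  fixes g h :: "real^'d::finite \<Rightarrow> real"
  assumes "open S" "x \<in> S" "\<And>y. y \<in> S \<Longrightarrow> g y = h y"
  shows "has_partial i g x D \<longleftrightarrow> has_partial i h x D"
  unfolding has_partial_def
  by (rule DERIV_cong_ev)
     (auto intro: eventually_mono[OF eventually_axis_line[OF assms(1,2), of i]] assms(3))

text \<open>Both functions have the same set of candidate derivatives at \<open>x\<close>, so the
  choice inside \<open>deriv\<close> gives the same value even where no derivative exists.\<close>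

lemma partial1_cong:
  fixes g h :: "real^'d::finite \<Rightarrow> real"
  assumes "open S" "x \<in> S" "\<And>y. y \<in> S \<Longrightarrow> g y = h y"
  shows "partial1 i g x = partial1 i h x"
proof -
  have "has_partial i g x D \<longleftrightarrow> has_partial i h x D" for D
    by (rule has_partial_cong[OF assms])
  then show ?thesis by (simp add: partial1_def deriv_def has_partial_def)
qed

lemma DERIV_along_axis:
  fixes g :: "real^'d::finite \<Rightarrow> real"
  assumes "\<exists>D. has_partial i g (y + t0 *\<^sub>R axis i 1) D"
  shows "((\<lambda>t. g (y + t *\<^sub>R axis i 1)) has_real_derivative partial1 i g (y + t0 *\<^sub>R axis i 1)) (at t0)"
proof -
  have "((\<lambda>t. g (y + (t + t0) *\<^sub>R axis i 1)) has_real_derivative partial1 i g (y + t0 *\<^sub>R axis i 1)) (at 0)"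
    using has_partial_partial1[OF assms] by (simp add: has_partial_def algebra_simps)
  then show ?thesis
    using DERIV_shift[of "\<lambda>t. g (y + t *\<^sub>R axis i 1)" _ 0 t0] by simp
qed

text \<open>Two mean value theorems: one in direction \<open>i\<close> for the increment
  \<open>u\<close> of \<open>g\<close> in direction \<open>j\<close>, then one in direction
  \<open>j\<close> for the resulting difference of partials. The left side is symmetric in
  \<open>i\<close> and \<open>j\<close> and the right side is not, which is what forces mixed
  partials to agree. Radius \<open>2 * h\<close> bounds all points involved, also when
  \<open>i = j\<close>.\<close>

lemma second_difference:
  fixes g :: "real^'d::finite \<Rightarrow> real"
  assumes S: "cball x (2*h) \<subseteq> S" and h: "0 < h"
    and di: "\<And>y. y \<in> S \<Longrightarrow> \<exists>D. has_partial i g y D"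
    and dji: "\<And>y. y \<in> S \<Longrightarrow> \<exists>D. has_partial j (partial1 i g) y D"
  shows "\<exists>y\<in>cball x (2*h). g (x + h *\<^sub>R axis i 1 + h *\<^sub>R axis j 1) - g (x + h *\<^sub>R axis i 1)
           - g (x + h *\<^sub>R axis j 1) + g x = h * h * partial1 j (partial1 i g) y"
proof -
  have in_S: "x + s *\<^sub>R axis i 1 + t *\<^sub>R axis j 1 \<in> cball x (2*h)"
    if "0 \<le> s" "s \<le> h" "0 \<le> t" "t \<le> h" for s t
  proof -
    have "norm (s *\<^sub>R axis i (1::real) + t *\<^sub>R axis j 1 :: real^'d) \<le> s + t"
      using norm_triangle_ineq[of "s *\<^sub>R axis i (1::real) :: real^'d" "t *\<^sub>R axis j 1"] that
      by (simp add: norm_axis_1)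
    then have "norm (x + s *\<^sub>R axis i 1 + t *\<^sub>R axis j 1 - x) \<le> 2 * h"
      using that by (simp add: add.assoc)
    then show ?thesis unfolding mem_cball dist_commute[of x] by (simp only: dist_norm)
  qed
  define u where "u s = g (x + s *\<^sub>R axis i 1 + h *\<^sub>R axis j 1) - g (x + s *\<^sub>R axis i 1)" for s
  define u' where "u' s = partial1 i g (x + s *\<^sub>R axis i 1 + h *\<^sub>R axis j 1)
      - partial1 i g (x + s *\<^sub>R axis i 1)" for s
  have du: "DERIV u s :> u' s" if "0 \<le> s" "s \<le> h" for s
  proof -
    have 1: "((\<lambda>s. g ((x + h *\<^sub>R axis j 1) + s *\<^sub>R axis i 1)) has_real_derivative
        partial1 i g ((x + h *\<^sub>R axis j 1) + s *\<^sub>R axis i 1)) (at s)"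
      by (rule DERIV_along_axis, rule di) (use subsetD[OF S in_S[OF that, of h]] h in \<open>simp add: add_ac\<close>)
    have 2: "((\<lambda>s. g (x + s *\<^sub>R axis i 1)) has_real_derivative
        partial1 i g (x + s *\<^sub>R axis i 1)) (at s)"
      by (rule DERIV_along_axis, rule di) (use subsetD[OF S in_S[OF that, of 0]] h in \<open>simp add: add_ac\<close>)
    have swap: "x + h *\<^sub>R axis j 1 + r *\<^sub>R axis i 1 = x + r *\<^sub>R axis i 1 + h *\<^sub>R axis j 1" for r
      by simp
    show ?thesis using DERIV_diff[OF 1 2] unfolding u_def u'_def swap .
  qed
  obtain \<xi> where \<xi>: "0 < \<xi>" "\<xi> < h" "u h - u 0 = h * u' \<xi>"
    using MVT2[OF h du] by auto
  have "DERIV (\<lambda>t. partial1 i g (x + \<xi> *\<^sub>R axis i 1 + t *\<^sub>R axis j 1)) t :>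
      partial1 j (partial1 i g) (x + \<xi> *\<^sub>R axis i 1 + t *\<^sub>R axis j 1)" if "0 \<le> t" "t \<le> h" for t
    by (rule DERIV_along_axis, rule dji) (use subsetD[OF S in_S[of \<xi> t]] \<xi> that in simp)
  from MVT2[OF h this] obtain \<tau> where \<tau>: "0 < \<tau>" "\<tau> < h"
    "u' \<xi> = h * partial1 j (partial1 i g) (x + \<xi> *\<^sub>R axis i 1 + \<tau> *\<^sub>R axis j 1)"
    unfolding u'_def by auto
  show ?thesis
    by (rule bexI[of _ "x + \<xi> *\<^sub>R axis i 1 + \<tau> *\<^sub>R axis j 1"])
       (use \<xi> \<tau> in_S[of \<xi> \<tau>] in \<open>simp_all add: u_def\<close>)
qed

lemma partial1_commute:
  fixes g :: "real^'d::finite \<Rightarrow> real"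
  assumes S: "open S" "x \<in> S"
    and d: "\<And>y l. y \<in> S \<Longrightarrow> \<exists>D. has_partial l g y D"
    and dji: "\<And>y. y \<in> S \<Longrightarrow> \<exists>D. has_partial j (partial1 i g) y D"
    and dij: "\<And>y. y \<in> S \<Longrightarrow> \<exists>D. has_partial i (partial1 j g) y D"
    and cji: "continuous_on S (partial1 j (partial1 i g))"
    and cij: "continuous_on S (partial1 i (partial1 j g))"
  shows "partial1 i (partial1 j g) x = partial1 j (partial1 i g) x"
proof (rule ccontr)
  let ?a = "partial1 j (partial1 i g)" and ?b = "partial1 i (partial1 j g)"
  assume "?b x \<noteq> ?a x"
  define e where "e = \<bar>?b x - ?a x\<bar> / 2"
  have e: "e > 0" using \<open>?b x \<noteq> ?a x\<close> by (simp add: e_def)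
  have ca: "isCont ?a x" and cb: "isCont ?b x"
    using continuous_on_eq_continuous_at[OF S(1)] cji cij S(2) by blast+
  obtain d1 where d1: "d1 > 0" "\<And>y. dist y x < d1 \<Longrightarrow> dist (?a y) (?a x) < e"
    using ca[unfolded continuous_at_eps_delta] e by blast
  obtain d2 where d2: "d2 > 0" "\<And>y. dist y x < d2 \<Longrightarrow> dist (?b y) (?b x) < e"
    using cb[unfolded continuous_at_eps_delta] e by blast
  obtain r where r: "r > 0" "cball x r \<subseteq> S" using S open_contains_cball by blast
  \<comment> \<open>Division by 3 puts the radius \<open>2 * h\<close> strictly below
    \<open>r\<close>, \<open>d1\<close> and \<open>d2\<close>.\<close>
  define h where "h = min r (min d1 d2) / 3"
  have h: "h > 0" "2*h < r" "2*h < d1" "2*h < d2" using r d1 d2 by (auto simp: h_def min_def)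
  have sub: "cball x (2*h) \<subseteq> S" using r h by auto
  obtain y where y: "y \<in> cball x (2*h)" "g (x + h *\<^sub>R axis i 1 + h *\<^sub>R axis j 1)
     - g (x + h *\<^sub>R axis i 1) - g (x + h *\<^sub>R axis j 1) + g x = h * h * ?a y"
    using second_difference[OF sub h(1), where g=g and i=i and j=j] d dji by blast
  obtain z where z: "z \<in> cball x (2*h)" "g (x + h *\<^sub>R axis j 1 + h *\<^sub>R axis i 1)
     - g (x + h *\<^sub>R axis j 1) - g (x + h *\<^sub>R axis i 1) + g x = h * h * ?b z"
    using second_difference[OF sub h(1), where g=g and i=j and j=i] d dij by blast
  have swap: "x + h *\<^sub>R axis j 1 + h *\<^sub>R axis i 1 = x + h *\<^sub>R axis i 1 + h *\<^sub>R axis j 1"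
    by simp
  \<comment> \<open>By symmetry of the second difference the two mixed partials share a value at
    points \<open>y\<close> and \<open>z\<close> near \<open>x\<close>. Each is within
    \<open>e\<close> of its value at \<open>x\<close>, while these two values are
    \<open>2 * e\<close> apart.\<close>
  have "h * h * ?a y = h * h * ?b z"
    unfolding y(2)[symmetric] z(2)[symmetric] swap by simp
  then have "?a y = ?b z" using h(1) by simp
  moreover have "dist (?a y) (?a x) < e"
    by (rule d1(2)) (use y(1) h in \<open>simp add: dist_commute\<close>)
  moreover have "dist (?b z) (?b x) < e"
    by (rule d2(2)) (use z(1) h in \<open>simp add: dist_commute\<close>)
  moreover have "dist (?b x) (?a x) \<le> dist (?b z) (?b x) + dist (?b z) (?a x)"
    by (rule dist_triangle3)
  moreover have "dist (?b x) (?a x) = 2 * e" by (simp add: e_def dist_real_def)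
  ultimately show False by simp
qed

text \<open>Class C^k encoded through first partials only, so that closure under sums, products,
  inverses and composition is an induction on \<open>k\<close>. \<open>Ck_on\<close> speaks of
  derivatives in the order fixed by \<open>cpartial\<close>; on open sets the two agree by
  \<open>Ck_on_iff_cdiff\<close>, which rests on commuting partials.\<close>

primrec cdiff :: "nat \<Rightarrow> (real^'d::finite) set \<Rightarrow> (real^'d \<Rightarrow> real) \<Rightarrow> bool" where
  "cdiff 0 S g \<longleftrightarrow> continuous_on S g"
| "cdiff (Suc k) S g \<longleftrightarrow> continuous_on S g \<and>
     (\<forall>i. (\<forall>x\<in>S. \<exists>D. has_partial i g x D) \<and> cdiff k S (partial1 i g))"

lemma cdiff_cont: "cdiff k S g \<Longrightarrow> continuous_on S g"
  by (cases k) auto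

lemma cdiff_lower: "cdiff (Suc k) S g \<Longrightarrow> cdiff k S g"
  by (induction k arbitrary: g) auto

lemma cdiff_mono: "cdiff k S g \<Longrightarrow> l \<le> k \<Longrightarrow> cdiff l S g"
  by (induction k) (auto simp: le_Suc_eq dest: cdiff_lower simp del: cdiff.simps(2))

lemma cdiff_subset: "cdiff k S g \<Longrightarrow> T \<subseteq> S \<Longrightarrow> cdiff k T g"
  by (induction k arbitrary: g) (auto intro: continuous_on_subset)

lemma cdiff_cong:
  fixes g h :: "real^'d::finite \<Rightarrow> real"
  assumes "open S" "\<And>y. y \<in> S \<Longrightarrow> g y = h y"
  shows "cdiff k S g \<longleftrightarrow> cdiff k S h"
  using assms(2)
proof (induction k arbitrary: g h)
  case 0 then show ?case by (simp cong: continuous_on_cong)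
next
  case (Suc k)
  have "cdiff k S (partial1 i g) \<longleftrightarrow> cdiff k S (partial1 i h)" for i
    by (rule Suc.IH) (rule partial1_cong[OF assms(1)], auto simp: Suc.prems)
  moreover have "has_partial i g x D \<longleftrightarrow> has_partial i h x D" if "x \<in> S" for x i D
    by (rule has_partial_cong[OF assms(1) that]) (auto simp: Suc.prems)
  moreover have "continuous_on S g \<longleftrightarrow> continuous_on S h"
    by (rule continuous_on_cong) (auto simp: Suc.prems)
  ultimately show ?case by simp
qed

text \<open>The gluing tool for \<open>quotient_cdiff\<close>, where differentiability has a
  different reason on each of several open sets.\<close>

lemma cdiff_Un:
  assumes "open S" "open T"
  shows "cdiff k S g \<Longrightarrow> cdiff k T g \<Longrightarrow> cdiff k (S \<union> T) g"
  by (induction k arbitrary: g) (auto intro: continuous_on_open_Un assms)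

lemma cdiff_Suc_partial: "cdiff (Suc k) S g \<Longrightarrow> cdiff k S (partial1 i g)"
  by simp

lemma cdiff_has_partial: "cdiff (Suc k) S g \<Longrightarrow> x \<in> S \<Longrightarrow> has_partial i g x (partial1 i g x)"
  by (intro has_partial_partial1) simp

lemma cdiff_SucI:
  assumes "open S" "continuous_on S g"
    "\<And>i x. x \<in> S \<Longrightarrow> has_partial i g x (G i x)"
    "\<And>i. cdiff k S (G i)"
  shows "cdiff (Suc k) S g"
proof -
  have "cdiff k S (partial1 i g) \<longleftrightarrow> cdiff k S (G i)" for i
    by (rule cdiff_cong[OF assms(1)]) (rule partial1_eqI[OF assms(3)])
  then show ?thesis using assms(2,3,4) by auto
qed

lemma has_partial_const: "has_partial i (\<lambda>_. c) x 0"
  by (simp add: has_partial_def)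

lemma has_partial_add:
  "has_partial i g x D \<Longrightarrow> has_partial i h x E \<Longrightarrow> has_partial i (\<lambda>x. g x + h x) x (D + E)"
  unfolding has_partial_def by (rule DERIV_add)

lemma has_partial_mult:
  "has_partial i g x D \<Longrightarrow> has_partial i h x E \<Longrightarrow> has_partial i (\<lambda>x. g x * h x) x (D * h x + g x * E)"
  unfolding has_partial_def by (drule (1) DERIV_mult) (simp add: mult.commute)

lemma has_partial_inverse:
  "has_partial i g x D \<Longrightarrow> g x \<noteq> 0 \<Longrightarrow>
   has_partial i (\<lambda>x. inverse (g x)) x ((-1) * (inverse (g x) * D * inverse (g x)))"
  unfolding has_partial_def by (drule DERIV_inverse') simp_all

lemma has_partial_compose:
  fixes F :: "real \<Rightarrow> real"
  assumes "\<And>x. F differentiable (at x)" "has_partial i g x D"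
  shows "has_partial i (\<lambda>x. F (g x)) x (deriv F (g x) * D)"
proof -
  have "(F has_real_derivative deriv F (g x)) (at (g x))"
    using assms(1) by (simp add: DERIV_deriv_iff_real_differentiable)
  then have "(F has_real_derivative deriv F (g x)) (at (g (x + 0 *\<^sub>R axis i 1)))" by simp
  from DERIV_chain2[OF this assms(2)[unfolded has_partial_def]] show ?thesis
    unfolding has_partial_def .
qed

lemma cdiff_const:
  fixes S :: "(real^'d::finite) set"
  shows "cdiff k S (\<lambda>_. c)"
proof (induction k arbitrary: c)
  case (Suc k)
  have "partial1 i (\<lambda>_. c) = (\<lambda>_. 0)" for i :: 'd
    using partial1_eqI[OF has_partial_const[of i c]] by blast
  then show ?case using Suc has_partial_const by (auto intro!: exI)
qed simp

lemma cdiff_add: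
  assumes "open S" shows "cdiff k S g \<Longrightarrow> cdiff k S h \<Longrightarrow> cdiff k S (\<lambda>x. g x + h x)"
proof (induction k arbitrary: g h)
  case 0 then show ?case by (auto intro: continuous_intros)
next
  case (Suc k)
  note g = Suc.prems(1) and h = Suc.prems(2)
  show ?case
  proof (rule cdiff_SucI[OF assms])
    show "continuous_on S (\<lambda>x. g x + h x)"
      by (rule continuous_on_add[OF cdiff_cont[OF g] cdiff_cont[OF h]])
    show "has_partial i (\<lambda>x. g x + h x) x (partial1 i g x + partial1 i h x)" if "x \<in> S" for i x
      by (rule has_partial_add[OF cdiff_has_partial[OF g that] cdiff_has_partial[OF h that]])
    show "cdiff k S (\<lambda>x. partial1 i g x + partial1 i h x)" for i
      by (rule Suc.IH[OF cdiff_Suc_partial[OF g] cdiff_Suc_partial[OF h]])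
  qed
qed

lemma cdiff_mult:
  assumes "open S" shows "cdiff k S g \<Longrightarrow> cdiff k S h \<Longrightarrow> cdiff k S (\<lambda>x. g x * h x)"
proof (induction k arbitrary: g h)
  case 0 then show ?case by (auto intro: continuous_intros)
next
  case (Suc k)
  note g = Suc.prems(1) and h = Suc.prems(2)
  show ?case
  proof (rule cdiff_SucI[OF assms])
    show "continuous_on S (\<lambda>x. g x * h x)"
      by (rule continuous_on_mult[OF cdiff_cont[OF g] cdiff_cont[OF h]])
    show "has_partial i (\<lambda>x. g x * h x) x (partial1 i g x * h x + g x * partial1 i h x)"
      if "x \<in> S" for i x
      by (rule has_partial_mult[OF cdiff_has_partial[OF g that] cdiff_has_partial[OF h that]])
    show "cdiff k S (\<lambda>x. partial1 i g x * h x + g x * partial1 i h x)" for i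
      by (rule cdiff_add[OF assms Suc.IH[OF cdiff_Suc_partial[OF g] cdiff_lower[OF h]]
            Suc.IH[OF cdiff_lower[OF g] cdiff_Suc_partial[OF h]]])
  qed
qed

lemma partial1_add:
  assumes "cdiff (Suc k) S g" "cdiff (Suc k) S h" "x \<in> S"
  shows "partial1 i (\<lambda>x. g x + h x) x = partial1 i g x + partial1 i h x"
  by (intro partial1_eqI has_partial_add cdiff_has_partial[of k S] assms)

lemma partial1_mult:
  assumes "cdiff (Suc k) S g" "cdiff (Suc k) S h" "x \<in> S"
  shows "partial1 i (\<lambda>x. g x * h x) x = partial1 i g x * h x + g x * partial1 i h x"
  by (intro partial1_eqI has_partial_mult cdiff_has_partial[of k S] assms)

lemma cdiff_cmult: "open S \<Longrightarrow> cdiff k S g \<Longrightarrow> cdiff k S (\<lambda>x. c * g x)"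
  by (intro cdiff_mult cdiff_const)

lemma cdiff_diff: "open S \<Longrightarrow> cdiff k S g \<Longrightarrow> cdiff k S h \<Longrightarrow> cdiff k S (\<lambda>x. g x - h x)"
  using cdiff_add[of S k g "\<lambda>x. (-1) * h x"] cdiff_cmult[of S k h "-1"] by simp

lemma cdiff_sum:
  assumes "open S" "\<And>a. a \<in> A \<Longrightarrow> cdiff k S (g a)"
  shows "cdiff k S (\<lambda>x. \<Sum>a\<in>A. g a x)"
  using assms(2) by (induction A rule: infinite_finite_induct) (auto intro: cdiff_const cdiff_add assms(1))

lemma cdiff_power: "open S \<Longrightarrow> cdiff k S g \<Longrightarrow> cdiff k S (\<lambda>x. g x ^ r)"
  by (induction r) (auto intro: cdiff_const cdiff_mult)

lemma cdiff_inverse: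
  assumes "open S" "\<And>x. x \<in> S \<Longrightarrow> g x \<noteq> 0"
  shows "cdiff k S g \<Longrightarrow> cdiff k S (\<lambda>x. inverse (g x))"
proof (induction k)
  case 0 then show ?case using assms by (auto intro!: continuous_intros)
next
  case (Suc k)
  note g = Suc.prems
  show ?case
  proof (rule cdiff_SucI[OF assms(1)])
    show "continuous_on S (\<lambda>x. inverse (g x))"
      using continuous_on_inverse[OF cdiff_cont[OF g]] assms(2) by blast
    show "has_partial i (\<lambda>x. inverse (g x)) x ((-1) * (inverse (g x) * partial1 i g x * inverse (g x)))"
      if "x \<in> S" for i x
      by (rule has_partial_inverse[OF cdiff_has_partial[OF g that] assms(2)[OF that]])
    have "cdiff k S (\<lambda>x. inverse (g x))" by (rule Suc.IH[OF cdiff_lower[OF g]])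
    then show "cdiff k S (\<lambda>x. (-1) * (inverse (g x) * partial1 i g x * inverse (g x)))" for i
      using cdiff_Suc_partial[OF g] by (intro cdiff_mult[OF assms(1)] cdiff_const)
  qed
qed

text \<open>The induction generalises over \<open>F\<close> because the chain rule replaces
  \<open>F\<close> by \<open>deriv F\<close>.\<close>

lemma cdiff_compose:
  fixes F :: "real \<Rightarrow> real"
  assumes "open S"
  shows "(\<And>l x. (deriv ^^ l) F differentiable (at x)) \<Longrightarrow> cdiff k S g \<Longrightarrow> cdiff k S (\<lambda>x. F (g x))"
proof (induction k arbitrary: F)
  case 0
  have "F differentiable (at x)" for x using 0(1)[of 0] by simp
  then have "continuous_on UNIV F"
    by (simp add: continuous_on_eq_continuous_at differentiable_imp_continuous_within)
  then show ?case using 0(2) by (auto intro: continuous_on_compose2)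
next
  case (Suc k)
  note g = Suc.prems(2)
  have dF: "F differentiable (at x)" for x using Suc.prems(1)[of 0] by simp
  then have cF: "continuous_on UNIV F"
    by (simp add: continuous_on_eq_continuous_at differentiable_imp_continuous_within)
  have "(deriv ^^ l) (deriv F) differentiable (at x)" for l x
    using Suc.prems(1)[of "Suc l" x] by (simp add: funpow_Suc_right del: funpow.simps)
  then have dk: "cdiff k S (\<lambda>x. deriv F (g x))"
    using Suc.IH[of "deriv F"] cdiff_lower[OF g] by blast
  show ?case
  proof (rule cdiff_SucI[OF assms])
    show "continuous_on S (\<lambda>x. F (g x))"
      using continuous_on_compose2[OF cF cdiff_cont[OF g]] by simp
    show "has_partial i (\<lambda>x. F (g x)) x (deriv F (g x) * partial1 i g x)" if "x \<in> S" for i x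
      by (rule has_partial_compose[OF dF cdiff_has_partial[OF g that]])
    show "cdiff k S (\<lambda>x. deriv F (g x) * partial1 i g x)" for i
      by (rule cdiff_mult[OF assms dk cdiff_Suc_partial[OF g]])
  qed
qed

section \<open>Iterated partial derivatives and a Leibniz identity\<close>

abbreviation mshift :: "'d::finite \<Rightarrow> 'd mindex \<Rightarrow> 'd mindex" where
  "mshift i \<alpha> \<equiv> \<alpha>(i := Suc (\<alpha> i))"

lemma msize_mshift [simp]: "msize (mshift i \<alpha>) = Suc (msize \<alpha>)"
proof -
  have "msize (mshift i \<alpha>) = Suc (\<alpha> i) + (\<Sum>j\<in>UNIV - {i}. \<alpha> j)"
    unfolding msize_def by (subst sum.remove[of _ i]) auto
  also have "\<dots> = Suc (msize \<alpha>)"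
    unfolding msize_def by (subst (2) sum.remove[of _ i]) auto
  finally show ?thesis .
qed

lemma msize_eq_0 [simp]: "msize \<alpha> = 0 \<longleftrightarrow> \<alpha> = (\<lambda>_. 0)"
  by (auto simp: msize_def fun_eq_iff)

lemma msize_0 [simp]: "msize (\<lambda>_. 0) = 0"
  by simp

lemma mshift_pred: "\<alpha> i \<noteq> 0 \<Longrightarrow> mshift i (\<alpha>(i := \<alpha> i - 1)) = \<alpha>"
  by (auto simp: fun_eq_iff)

lemma cpartial_0 [simp]: "cpartial (\<lambda>_. 0) g = g"
  by (simp add: cpartial_def msize_def)

text \<open>The direction picked by \<open>SOME\<close> in \<open>cpd_aux\<close> depends on
  \<alpha> alone, so one decomposition serves all functions \<open>g\<close> at once.\<close>

lemma cpartial_step: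
  assumes "\<alpha> \<noteq> (\<lambda>_. 0)"
  obtains j \<gamma> where "\<alpha> = mshift j \<gamma>" "\<And>g. cpartial \<alpha> g = partial1 j (cpartial \<gamma> g)"
proof -
  define j where "j = (SOME i. \<alpha> i \<noteq> 0)"
  define \<gamma> where "\<gamma> = \<alpha>(j := \<alpha> j - 1)"
  have "\<exists>i. \<alpha> i \<noteq> 0" using assms by (auto simp: fun_eq_iff)
  then have j: "\<alpha> j \<noteq> 0" unfolding j_def by (rule someI_ex)
  have \<alpha>: "\<alpha> = mshift j \<gamma>" unfolding \<gamma>_def using mshift_pred[of \<alpha> j] j by simp
  have size: "msize \<alpha> = Suc (msize \<gamma>)" by (subst \<alpha>) simp
  have "cpartial \<alpha> g = partial1 j (cpartial \<gamma> g)" for g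
    unfolding cpartial_def size using assms by (simp only: cpd_aux.simps Let_def j_def[symmetric] \<gamma>_def[symmetric] if_False)
  then show thesis using that \<alpha> by blast
qed

text \<open>Induction along the directions that \<open>cpartial\<close> itself chooses:
  \<open>j\<close> cannot be prescribed, but in exchange \<open>cpartial\<close> unfolds by a plain
  equation that holds without any differentiability.\<close>

lemma mindex_induct [case_names zero step]:
  assumes "P (\<lambda>_. 0)"
    and "\<And>\<gamma> j. P \<gamma> \<Longrightarrow> (\<And>g. cpartial (mshift j \<gamma>) g = partial1 j (cpartial \<gamma> g)) \<Longrightarrow> P (mshift j \<gamma>)"
  shows "P (\<alpha> :: ('d::finite) mindex)"
proof (induction "msize \<alpha>" arbitrary: \<alpha>)
  case 0
  then have "\<alpha> = (\<lambda>_. 0)" using msize_eq_0[of \<alpha>] by simp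
  then show ?case using assms(1) by simp
next
  case (Suc n)
  then have "\<alpha> \<noteq> (\<lambda>_. 0)" using msize_eq_0[of \<alpha>] by auto
  then obtain j \<gamma> where *: "\<alpha> = mshift j \<gamma>" "\<And>g. cpartial \<alpha> g = partial1 j (cpartial \<gamma> g)"
    by (rule cpartial_step) blast
  have "P \<gamma>" by (rule Suc.hyps(1)) (use Suc.hyps(2) *(1) in simp)
  then show ?case unfolding *(1) by (rule assms(2)) (use * in simp)
qed

lemma cpartial_cong:
  assumes "open S" "x \<in> S" "\<And>y. y \<in> S \<Longrightarrow> g y = h y"
  shows "cpartial \<alpha> g x = cpartial \<alpha> h x"
  using assms(2)
proof (induction \<alpha> arbitrary: x rule: mindex_induct)
  case zero then show ?case using assms(3) by simp
next
  case (step \<gamma> j)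
  show ?case unfolding step(2) by (rule partial1_cong[OF assms(1) step(3) step(1)])
qed

text \<open>The direction \<open>j\<close> that \<open>cpartial\<close> places outermost may differ
  from \<open>i\<close>. Then \<alpha> and \<gamma> have a common predecessor \<delta>, with
  \<alpha> one step in direction \<open>j\<close> and \<gamma> one step in direction
  \<open>i\<close> above it. The induction on the order rewrites both derivatives over \<delta>, and
  Schwarz's theorem for \<open>cpartial \<delta> g\<close> exchanges \<open>i\<close> and
  \<open>j\<close>.\<close>

lemma Ck_on_cpartial_mshift:
  fixes g :: "real^'d::finite \<Rightarrow> real"
  assumes S: "open S" and g: "Ck_on k S g"
  shows "msize \<alpha> < k \<Longrightarrow> x \<in> S \<Longrightarrow> cpartial (mshift i \<alpha>) g x = partial1 i (cpartial \<alpha> g) x"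
proof (induction "msize \<alpha>" arbitrary: \<alpha> i x rule: less_induct)
  case less
  have hp: "\<exists>D. has_partial l (cpartial \<delta> g) y D" if "msize \<delta> < k" "y \<in> S" for l y and \<delta> :: "'d mindex"
    using g[unfolded Ck_on_def] that unfolding has_partial_ex by simp
  have ct: "continuous_on S (partial1 l (cpartial \<delta> g))" if "msize \<delta> < k" for l and \<delta> :: "'d mindex"
    using g[unfolded Ck_on_def] that by simp
  have "msize (mshift i \<alpha>) \<noteq> 0" unfolding msize_mshift by (rule nat.distinct(2))
  then have "mshift i \<alpha> \<noteq> (\<lambda>_. 0)" unfolding msize_eq_0 .
  then obtain j \<gamma> where j: "mshift i \<alpha> = mshift j \<gamma>"
    "\<And>g. cpartial (mshift i \<alpha>) g = partial1 j (cpartial \<gamma> g)"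
    by (rule cpartial_step) blast
  show ?case
  proof (cases "j = i")
    case True
    have "\<gamma> l = \<alpha> l" for l using fun_cong[OF j(1), of l] True by (cases "l = i") auto
    then have "\<gamma> = \<alpha>" by blast
    then show ?thesis using j(2) True by simp
  next
    case False
    define \<delta> where "\<delta> = \<alpha>(j := \<alpha> j - 1)"
    have "\<alpha> j = Suc (\<gamma> j)" using fun_cong[OF j(1), of j] False by simp
    then have \<alpha>: "\<alpha> = mshift j \<delta>" using mshift_pred[of \<alpha> j] by (simp add: \<delta>_def)
    have \<gamma>: "\<gamma> = mshift i \<delta>"
    proof
      fix l show "\<gamma> l = mshift i \<delta> l"
        using fun_cong[OF j(1), of l] False by (cases "l = i"; cases "l = j") (auto simp: \<delta>_def)
    qed
    have sz: "msize \<delta> < msize \<alpha>" "msize \<gamma> = msize \<alpha>" by (subst \<alpha>, simp) (simp add: \<gamma>, subst \<alpha>, simp)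
    have d\<gamma>: "cpartial \<gamma> g y = partial1 i (cpartial \<delta> g) y" if "y \<in> S" for y
      unfolding \<gamma> using less(1)[of \<delta> y i] sz less(2) that by simp
    have d\<alpha>: "cpartial \<alpha> g y = partial1 j (cpartial \<delta> g) y" if "y \<in> S" for y
      using less(1)[of \<delta> y j] sz less(2) that \<alpha> by simp
    have "partial1 i (cpartial \<alpha> g) x = partial1 i (partial1 j (cpartial \<delta> g)) x"
      by (rule partial1_cong[OF S less(3) d\<alpha>])
    also have "\<dots> = partial1 j (partial1 i (cpartial \<delta> g)) x"
    proof (rule partial1_commute[OF S less(3)])
      fix y assume y: "y \<in> S"
      show "\<exists>D. has_partial l (cpartial \<delta> g) y D" for l
        using hp[of \<delta> y l] sz less(2) y by simp
      have "has_partial j (cpartial \<gamma> g) y D \<longleftrightarrow> has_partial j (partial1 i (cpartial \<delta> g)) y D" for D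
        by (rule has_partial_cong[OF S y d\<gamma>])
      then show "\<exists>D. has_partial j (partial1 i (cpartial \<delta> g)) y D"
        using hp[of \<gamma> y j] sz less(2) y by simp
      have "has_partial i (cpartial \<alpha> g) y D \<longleftrightarrow> has_partial i (partial1 j (cpartial \<delta> g)) y D" for D
        by (rule has_partial_cong[OF S y d\<alpha>])
      then show "\<exists>D. has_partial i (partial1 j (cpartial \<delta> g)) y D"
        using hp[of \<alpha> y i] sz less(2) y by simp
    next
      have "continuous_on S (partial1 j (cpartial \<gamma> g)) \<longleftrightarrow> continuous_on S (partial1 j (partial1 i (cpartial \<delta> g)))"
        by (rule continuous_on_cong[OF refl]) (rule partial1_cong[OF S _ d\<gamma>])
      then show "continuous_on S (partial1 j (partial1 i (cpartial \<delta> g)))"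
        using ct[of \<gamma> j] sz less(2) by simp
      have "continuous_on S (partial1 i (cpartial \<alpha> g)) \<longleftrightarrow> continuous_on S (partial1 i (partial1 j (cpartial \<delta> g)))"
        by (rule continuous_on_cong[OF refl]) (rule partial1_cong[OF S _ d\<alpha>])
      then show "continuous_on S (partial1 i (partial1 j (cpartial \<delta> g)))"
        using ct[of \<alpha> i] less(2) by simp
    qed
    also have "\<dots> = partial1 j (cpartial \<gamma> g) x"
      by (rule partial1_cong[OF S less(3) d\<gamma>[symmetric]])
    finally show ?thesis unfolding j(2) by simp
  qed
qed

lemma Ck_on_cdiff_cpartial:
  fixes g :: "real^'d::finite \<Rightarrow> real"
  assumes S: "open S" and g: "Ck_on k S g"
  shows "msize \<alpha> + l = k \<Longrightarrow> cdiff l S (cpartial \<alpha> g)"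
proof (induction l arbitrary: \<alpha>)
  case 0 then show ?case using g by (simp add: Ck_on_def)
next
  case (Suc l)
  have "cdiff l S (partial1 i (cpartial \<alpha> g)) \<longleftrightarrow> cdiff l S (cpartial (mshift i \<alpha>) g)" for i
    by (rule cdiff_cong[OF S]) (use Ck_on_cpartial_mshift[OF S g] Suc.prems in simp)
  moreover have "cdiff l S (cpartial (mshift i \<alpha>) g)" for i
    using Suc.IH[of "mshift i \<alpha>"] Suc.prems by (simp only: msize_mshift add_Suc add_Suc_right)
  moreover have "continuous_on S (cpartial \<alpha> g)" "\<exists>D. has_partial i (cpartial \<alpha> g) x D" if "x \<in> S" for i x
    using g Suc.prems that unfolding Ck_on_def has_partial_ex by auto
  moreover have "continuous_on S (cpartial \<alpha> g)"
    using g Suc.prems unfolding Ck_on_def by auto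
  ultimately show ?case by simp
qed

lemma cdiff_cpartial: "cdiff (msize \<alpha> + l) S g \<Longrightarrow> cdiff l S (cpartial \<alpha> g)"
proof (induction \<alpha> arbitrary: l rule: mindex_induct)
  case (step \<gamma> j)
  have "cdiff (Suc l) S (cpartial \<gamma> g)" using step(1)[of "Suc l"] step(3) by (simp only: msize_mshift add_Suc add_Suc_right)
  then show ?case unfolding step(2) by (rule cdiff_Suc_partial)
qed (simp add: msize_def)

lemma Ck_on_iff_cdiff:
  fixes g :: "real^'d::finite \<Rightarrow> real"
  assumes S: "open S"
  shows "Ck_on k S g \<longleftrightarrow> cdiff k S g"
proof
  assume "Ck_on k S g"
  from Ck_on_cdiff_cpartial[OF S this, of "\<lambda>_. 0" k] show "cdiff k S g" by (simp add: msize_def)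
next
  assume g: "cdiff k S g"
  have 1: "continuous_on S (cpartial \<alpha> g)" if "msize \<alpha> \<le> k" for \<alpha> :: "'d mindex"
    by (rule cdiff_cont[of 0], rule cdiff_cpartial) (use g cdiff_mono that in simp)
  have "cdiff (Suc 0) S (cpartial \<alpha> g)" if "msize \<alpha> < k" for \<alpha> :: "'d mindex"
    by (rule cdiff_cpartial, rule cdiff_mono[OF g]) (use that in simp)
  then show "Ck_on k S g" unfolding Ck_on_def has_partial_ex[symmetric] using 1 by simp
qed

lemma cdiff_partial1_commute:
  assumes "open S" "cdiff (Suc (Suc 0)) S g" "x \<in> S"
  shows "partial1 i (partial1 j g) x = partial1 j (partial1 i g) x"
  by (rule partial1_commute[OF assms(1,3)]) (use assms(2) in auto)

lemma cpartial_partial1: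
  assumes S: "open S"
  shows "cdiff (Suc (msize \<gamma>)) S g \<Longrightarrow> x \<in> S \<Longrightarrow> cpartial \<gamma> (partial1 i g) x = partial1 i (cpartial \<gamma> g) x"
proof (induction \<gamma> arbitrary: x rule: mindex_induct)
  case (step \<gamma> j)
  have g: "cdiff (Suc (Suc (msize \<gamma>))) S g" using step.prems(1) by (simp only: msize_mshift)
  have "cdiff (Suc (Suc 0)) S (cpartial \<gamma> g)"
    by (rule cdiff_cpartial) (use g in \<open>simp only: add_Suc_right add_0_right\<close>)
  note comm = cdiff_partial1_commute[OF S this step.prems(2)]
  have "partial1 j (cpartial \<gamma> (partial1 i g)) x = partial1 j (partial1 i (cpartial \<gamma> g)) x"
    by (rule partial1_cong[OF S step.prems(2)]) (rule step.IH[OF cdiff_lower[OF g]])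
  then show ?case unfolding step.hyps comm .
qed simp

lemma cpartial_mshift_outer:
  assumes "open S" "cdiff (Suc (msize \<alpha>)) S g" "x \<in> S"
  shows "cpartial (mshift i \<alpha>) g x = partial1 i (cpartial \<alpha> g) x"
  using Ck_on_cpartial_mshift[OF assms(1) _ lessI assms(3)] assms(1,2) Ck_on_iff_cdiff by blast

text \<open>With the new derivative innermost, a first-order product or chain rule can be applied
  before an induction hypothesis with changed functions.\<close>

lemma cpartial_mshift_inner:
  assumes "open S" "cdiff (Suc (msize \<alpha>)) S g" "x \<in> S"
  shows "cpartial (mshift i \<alpha>) g x = cpartial \<alpha> (partial1 i g) x"
  using cpartial_mshift_outer[OF assms] cpartial_partial1[OF assms] by simp

lemma cpartial_add:
  assumes S: "open S"
  shows "cdiff (msize \<alpha>) S g \<Longrightarrow> cdiff (msize \<alpha>) S h \<Longrightarrow> x \<in> S \<Longrightarrow>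
    cpartial \<alpha> (\<lambda>x. g x + h x) x = cpartial \<alpha> g x + cpartial \<alpha> h x"
proof (induction \<alpha> arbitrary: x rule: mindex_induct)
  case (step \<gamma> j)
  have gh: "cdiff (Suc (msize \<gamma>)) S g" "cdiff (Suc (msize \<gamma>)) S h"
    using step.prems(1,2) by (simp_all only: msize_mshift)
  then have d: "cdiff (Suc 0) S (cpartial \<gamma> g)" "cdiff (Suc 0) S (cpartial \<gamma> h)"
    by (auto intro!: cdiff_cpartial simp only: add_Suc_right add_0_right)
  have "partial1 j (cpartial \<gamma> (\<lambda>x. g x + h x)) x = partial1 j (\<lambda>x. cpartial \<gamma> g x + cpartial \<gamma> h x) x"
    by (rule partial1_cong[OF S step.prems(3)]) (rule step.IH[OF gh[THEN cdiff_lower]])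
  also have "\<dots> = partial1 j (cpartial \<gamma> g) x + partial1 j (cpartial \<gamma> h) x"
    by (rule partial1_add[OF d step.prems(3)])
  finally show ?case unfolding step.hyps .
qed simp

lemma partial1_cmult:
  assumes "\<exists>D. has_partial i g x D"
  shows "partial1 i (\<lambda>x. c * g x) x = c * partial1 i g x"
  using partial1_eqI[OF has_partial_mult[OF has_partial_const[of i c] has_partial_partial1[OF assms]]]
  by simp

lemma cpartial_cmult:
  assumes S: "open S"
  shows "cdiff (msize \<alpha>) S g \<Longrightarrow> x \<in> S \<Longrightarrow> cpartial \<alpha> (\<lambda>x. c * g x) x = c * cpartial \<alpha> g x"
proof (induction \<alpha> arbitrary: x rule: mindex_induct)
  case (step \<gamma> j)
  have g: "cdiff (Suc (msize \<gamma>)) S g"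
    using step.prems(1) by (simp_all only: msize_mshift)
  then have d: "cdiff (Suc 0) S (cpartial \<gamma> g)"
    by (auto intro!: cdiff_cpartial simp only: add_Suc_right add_0_right)
  have "partial1 j (cpartial \<gamma> (\<lambda>x. c * g x)) x = partial1 j (\<lambda>x. c * cpartial \<gamma> g x) x"
    by (rule partial1_cong[OF S step.prems(2)]) (rule step.IH[OF g[THEN cdiff_lower]])
  also have "\<dots> = c * partial1 j (cpartial \<gamma> g) x"
    by (rule partial1_cmult) (use cdiff_has_partial[OF d step.prems(2)] in blast)
  finally show ?case unfolding step.hyps .
qed simp

lemma cpartial_diff:
  assumes S: "open S" and g: "cdiff (msize \<alpha>) S g" and h: "cdiff (msize \<alpha>) S h" and x: "x \<in> S"
  shows "cpartial \<alpha> (\<lambda>x. g x - h x) x = cpartial \<alpha> g x - cpartial \<alpha> h x"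
  using cpartial_add[OF S g cdiff_cmult[OF S h] x, of "-1"] cpartial_cmult[OF S h x, of "-1"] by simp

section \<open>Multi-index combinatorics and the transposed Leibniz identity\<close>

lemma finite_msize_le: "finite {\<alpha> :: ('d::finite) mindex. msize \<alpha> \<le> m}"
proof -
  have "{\<alpha> :: 'd mindex. msize \<alpha> \<le> m} \<subseteq> {\<alpha>. \<forall>i. (i \<in> UNIV \<longrightarrow> \<alpha> i \<in> {..m}) \<and> (i \<notin> UNIV \<longrightarrow> \<alpha> i = 0)}"
  proof
    fix \<alpha> :: "'d mindex" assume "\<alpha> \<in> {\<alpha>. msize \<alpha> \<le> m}"
    then have "\<alpha> i \<le> m" for i
      using member_le_sum[of i UNIV \<alpha>] by (simp add: msize_def)
    then show "\<alpha> \<in> {\<alpha>. \<forall>i. (i \<in> UNIV \<longrightarrow> \<alpha> i \<in> {..m}) \<and> (i \<notin> UNIV \<longrightarrow> \<alpha> i = 0)}" by simp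
  qed
  then show ?thesis by (rule finite_subset) (rule finite_set_of_finite_funs, auto)
qed

lemma msize_mono: "\<beta> \<le> \<alpha> \<Longrightarrow> msize \<beta> \<le> msize \<alpha>"
  unfolding msize_def by (rule sum_mono) (simp add: le_fun_def)

lemma finite_mindex_le [simp]: "finite {\<beta> :: ('d::finite) mindex. \<beta> \<le> \<alpha>}"
  by (rule finite_subset[OF _ finite_msize_le[of "msize \<alpha>"]]) (auto intro: msize_mono)

lemma msize_diff: "\<beta> \<le> \<alpha> \<Longrightarrow> msize \<beta> + msize (\<alpha> - \<beta>) = msize \<alpha>"
  unfolding msize_def by (simp add: sum.distrib[symmetric] le_fun_def)

text \<open>Pascal's rule in coordinate \<open>i\<close>, all other factors of the product being
  common. The case \<open>\<beta> i = 0\<close> is separate because truncated subtraction would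
  return \<beta> itself.\<close>

lemma mbinom_mshift:
  "mbinom (mshift i \<alpha>) \<beta> = mbinom \<alpha> \<beta> + (if \<beta> i = 0 then 0 else mbinom \<alpha> (\<beta>(i := \<beta> i - 1)))"
proof -
  let ?P = "\<Prod>j\<in>UNIV - {i}. \<alpha> j choose \<beta> j"
  have *: "mbinom a b = (a i choose b i) * (\<Prod>j\<in>UNIV - {i}. a j choose b j)" for a b
    unfolding mbinom_def by (subst prod.remove[of _ i]) auto
  have "mbinom (mshift i \<alpha>) \<beta> = (Suc (\<alpha> i) choose \<beta> i) * ?P" by (simp add: *)
  moreover have "mbinom \<alpha> \<beta> = (\<alpha> i choose \<beta> i) * ?P" by (simp add: *)
  moreover have "mbinom \<alpha> (\<beta>(i := \<beta> i - 1)) = (\<alpha> i choose (\<beta> i - 1)) * ?P" by (simp add: *)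
  ultimately show ?thesis by (cases "\<beta> i") (auto simp: algebra_simps)
qed

lemma mbinom_eq_0: "\<not> \<beta> \<le> \<alpha> \<Longrightarrow> mbinom \<alpha> \<beta> = 0"
  by (auto simp: mbinom_def le_fun_def not_le)

lemma mbinom_same: "mbinom \<alpha> \<alpha> = 1" by (simp add: mbinom_def)

text \<open>Pascal's rule splits the sum. In one half the indices not below \<alpha> carry
  coefficient 0; in the other, lowering coordinate \<open>i\<close> is a bijection from the indices
  with \<open>\<beta> i \<noteq> 0\<close> onto those below \<alpha>.\<close>

lemma sum_mbinom_mshift:
  fixes T :: "('d::finite) mindex \<Rightarrow> real"
  shows "(\<Sum>\<beta>\<in>{\<beta>. \<beta> \<le> mshift i \<alpha>}. real (mbinom (mshift i \<alpha>) \<beta>) * T \<beta>)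
       = (\<Sum>\<beta>\<in>{\<beta>. \<beta> \<le> \<alpha>}. real (mbinom \<alpha> \<beta>) * (T (mshift i \<beta>) + T \<beta>))"
proof -
  let ?A = "{\<beta>. \<beta> \<le> mshift i \<alpha>}"
  have sub: "{\<beta>. \<beta> \<le> \<alpha>} \<subseteq> ?A" by (auto simp: le_fun_def le_SucI)
  have "(\<Sum>\<beta>\<in>?A. real (mbinom (mshift i \<alpha>) \<beta>) * T \<beta>)
     = (\<Sum>\<beta>\<in>?A. real (mbinom \<alpha> \<beta>) * T \<beta>)
     + (\<Sum>\<beta>\<in>?A. if \<beta> i = 0 then 0 else real (mbinom \<alpha> (\<beta>(i := \<beta> i - 1))) * T \<beta>)"
    unfolding mbinom_mshift by (subst sum.distrib[symmetric], rule sum.cong) (auto simp: algebra_simps)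
  also have "(\<Sum>\<beta>\<in>?A. real (mbinom \<alpha> \<beta>) * T \<beta>) = (\<Sum>\<beta>\<in>{\<beta>. \<beta> \<le> \<alpha>}. real (mbinom \<alpha> \<beta>) * T \<beta>)"
    using sub by (intro sum.mono_neutral_right) (auto simp: mbinom_eq_0)
  also have "(\<Sum>\<beta>\<in>?A. if \<beta> i = 0 then 0 else real (mbinom \<alpha> (\<beta>(i := \<beta> i - 1))) * T \<beta>)
     = (\<Sum>\<beta>\<in>{\<beta>\<in>?A. \<beta> i \<noteq> 0}. real (mbinom \<alpha> (\<beta>(i := \<beta> i - 1))) * T \<beta>)"
    by (rule sum.mono_neutral_cong_right) auto
  also have "\<dots> = (\<Sum>\<beta>\<in>{\<beta>. \<beta> \<le> \<alpha>}. real (mbinom \<alpha> \<beta>) * T (mshift i \<beta>))"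
  proof (rule sum.reindex_bij_witness[where i = "mshift i" and j = "\<lambda>\<beta>. \<beta>(i := \<beta> i - 1)"])
    show "mshift i (a(i := a i - 1)) = a" if "a \<in> {\<beta> \<in> ?A. \<beta> i \<noteq> 0}" for a
      by (rule mshift_pred) (use that in simp)
    show "a(i := a i - 1) \<in> {\<beta>. \<beta> \<le> \<alpha>}" if "a \<in> {\<beta> \<in> ?A. \<beta> i \<noteq> 0}" for a
    proof -
      have le: "a j \<le> mshift i \<alpha> j" for j using that by (simp add: le_fun_def)
      have "(a(i := a i - 1)) j \<le> \<alpha> j" for j using le[of j] by (cases "j = i") auto
      then show ?thesis by (simp add: le_fun_def)
    qed
  qed (auto simp: le_fun_def fun_eq_iff)
  also have "(\<Sum>\<beta>\<in>{\<beta>. \<beta> \<le> \<alpha>}. real (mbinom \<alpha> \<beta>) * T \<beta>)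
      + (\<Sum>\<beta>\<in>{\<beta>. \<beta> \<le> \<alpha>}. real (mbinom \<alpha> \<beta>) * T (mshift i \<beta>))
      = (\<Sum>\<beta>\<in>{\<beta>. \<beta> \<le> \<alpha>}. real (mbinom \<alpha> \<beta>) * (T (mshift i \<beta>) + T \<beta>))"
    unfolding sum.distrib[symmetric] by (rule sum.cong) (auto simp: algebra_simps)
  finally show ?thesis .
qed

text \<open>Induction on \<alpha> with \<phi> arbitrary. In the pair of terms for
  \<open>mshift i \<beta>\<close> and \<beta>, the product rule in direction \<open>i\<close> splits
  the first into a term with the derivative on \<phi> and a term with it on \<psi>. The latter
  cancels against the term for \<beta>, whose sign is opposite. What is left is the identity for
  \<alpha> and \<open>partial1 i \<phi>\<close>.\<close>

lemma leibniz_transposed: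
  fixes \<phi> \<psi> :: "real^'d::finite \<Rightarrow> real"
  assumes S: "open S" and x: "x \<in> S"
  shows "cdiff (msize \<alpha>) S \<psi> \<Longrightarrow> cdiff (msize \<alpha>) S \<phi> \<Longrightarrow>
   (\<Sum>\<beta>\<in>{\<beta>. \<beta> \<le> \<alpha>}. real (mbinom \<alpha> \<beta>) * ((-1) ^ msize (\<alpha> - \<beta>) *
      cpartial \<beta> (\<lambda>y. \<phi> y * cpartial (\<alpha> - \<beta>) \<psi> y) x)) = \<psi> x * cpartial \<alpha> \<phi> x"
proof (induction \<alpha> arbitrary: \<phi> rule: mindex_induct)
  case zero
  have "{\<beta>::'d mindex. \<beta> \<le> (\<lambda>_. 0)} = {\<lambda>_. 0}" by (auto simp: le_fun_def fun_eq_iff)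
  moreover have "(\<lambda>_::'d. 0::nat) - (\<lambda>_. 0) = (\<lambda>_. 0)" by (simp add: fun_eq_iff)
  moreover have "msize (\<lambda>_::'d. 0::nat) = 0" by simp
  ultimately show ?case by (simp add: mbinom_same)
next
  case (step \<alpha> i)
  define T where "T \<beta> = (-1) ^ msize (mshift i \<alpha> - \<beta>) * cpartial \<beta> (\<lambda>y. \<phi> y * cpartial (mshift i \<alpha> - \<beta>) \<psi> y) x" for \<beta>
  have \<phi>: "cdiff (Suc (msize \<alpha>)) S \<phi>" and \<psi>: "cdiff (Suc (msize \<alpha>)) S \<psi>"
    using step.prems by (simp_all only: msize_mshift)
  have pair: "T (mshift i \<beta>) + T \<beta> = (-1) ^ msize (\<alpha> - \<beta>) *
      cpartial \<beta> (\<lambda>y. partial1 i \<phi> y * cpartial (\<alpha> - \<beta>) \<psi> y) x" if \<beta>: "\<beta> \<le> \<alpha>" for \<beta>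
  proof -
    define \<delta> where "\<delta> = \<alpha> - \<beta>"
    have "\<beta> j \<le> \<alpha> j" for j using \<beta> by (simp add: le_fun_def)
    then have 1: "mshift i \<alpha> - mshift i \<beta> = \<delta>" and 2: "mshift i \<alpha> - \<beta> = mshift i \<delta>"
      by (auto simp: \<delta>_def fun_eq_iff Suc_diff_le)
    have sz: "msize \<beta> + msize \<delta> = msize \<alpha>" using msize_diff[OF \<beta>] by (simp add: \<delta>_def)
    have d\<psi>: "cdiff (Suc (msize \<beta>)) S (cpartial \<delta> \<psi>)"
      by (rule cdiff_cpartial) (use \<psi> sz in \<open>simp only: add.commute add_Suc_right\<close>)
    have d\<phi>: "cdiff (Suc (msize \<beta>)) S \<phi>"
      by (rule cdiff_mono[OF \<phi>]) (use sz in simp)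
    have d\<delta>: "cpartial (mshift i \<delta>) \<psi> y = partial1 i (cpartial \<delta> \<psi>) y" if "y \<in> S" for y
      by (rule cpartial_mshift_outer[OF S _ that], rule cdiff_mono[OF \<psi>]) (use sz in simp)
    have "cpartial (mshift i \<beta>) (\<lambda>y. \<phi> y * cpartial \<delta> \<psi> y) x
        = cpartial \<beta> (partial1 i (\<lambda>y. \<phi> y * cpartial \<delta> \<psi> y)) x"
      by (rule cpartial_mshift_inner[OF S cdiff_mult[OF S d\<phi> d\<psi>] x])
    also have "\<dots> = cpartial \<beta> (\<lambda>y. partial1 i \<phi> y * cpartial \<delta> \<psi> y + \<phi> y * partial1 i (cpartial \<delta> \<psi>) y) x"
      by (rule cpartial_cong[OF S x]) (rule partial1_mult[OF d\<phi> d\<psi>])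
    also have "\<dots> = cpartial \<beta> (\<lambda>y. partial1 i \<phi> y * cpartial \<delta> \<psi> y) x
        + cpartial \<beta> (\<lambda>y. \<phi> y * partial1 i (cpartial \<delta> \<psi>) y) x"
      by (rule cpartial_add[OF S _ _ x])
        (intro cdiff_mult S cdiff_Suc_partial cdiff_lower[OF d\<phi>] cdiff_lower[OF d\<psi>] d\<phi> d\<psi>)+
    also have "cpartial \<beta> (\<lambda>y. \<phi> y * partial1 i (cpartial \<delta> \<psi>) y) x
        = cpartial \<beta> (\<lambda>y. \<phi> y * cpartial (mshift i \<delta>) \<psi> y) x"
      by (rule cpartial_cong[OF S x]) (simp add: d\<delta>)
    finally have 3: "cpartial (mshift i \<beta>) (\<lambda>y. \<phi> y * cpartial \<delta> \<psi> y) x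
        = cpartial \<beta> (\<lambda>y. partial1 i \<phi> y * cpartial \<delta> \<psi> y) x
        + cpartial \<beta> (\<lambda>y. \<phi> y * cpartial (mshift i \<delta>) \<psi> y) x" .
    show ?thesis unfolding T_def 1 2 3 \<delta>_def[symmetric] msize_mshift by (simp only: power_Suc) algebra
  qed
  have "(\<Sum>\<beta>\<in>{\<beta>. \<beta> \<le> mshift i \<alpha>}. real (mbinom (mshift i \<alpha>) \<beta>) * T \<beta>)
     = (\<Sum>\<beta>\<in>{\<beta>. \<beta> \<le> \<alpha>}. real (mbinom \<alpha> \<beta>) * ((-1) ^ msize (\<alpha> - \<beta>) *
      cpartial \<beta> (\<lambda>y. partial1 i \<phi> y * cpartial (\<alpha> - \<beta>) \<psi> y) x))"
    unfolding sum_mbinom_mshift by (rule sum.cong) (auto simp: pair)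
  also have "\<dots> = \<psi> x * cpartial \<alpha> (partial1 i \<phi>) x"
    by (rule step.IH[OF cdiff_lower[OF \<psi>] cdiff_Suc_partial[OF \<phi>]])
  also have "cpartial \<alpha> (partial1 i \<phi>) x = cpartial (mshift i \<alpha>) \<phi> x"
    by (rule cpartial_mshift_inner[OF S \<phi> x, symmetric])
  finally show ?case unfolding T_def .
qed

section \<open>Uniform bounds on partial derivatives\<close>

text \<open>A C^k bound with a single constant, for partials in every order, recursive like
  \<open>cdiff\<close> so that the product rule acts by induction. The set \<open>A\<close> need not
  be open: the partials are those of the function on the ambient space.\<close>

primrec partials_bounded :: "nat \<Rightarrow> (real^'d::finite) set \<Rightarrow> real \<Rightarrow> (real^'d \<Rightarrow> real) \<Rightarrow> bool" where
  "partials_bounded 0 A c g \<longleftrightarrow> (\<forall>x\<in>A. \<bar>g x\<bar> \<le> c)"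
| "partials_bounded (Suc k) A c g \<longleftrightarrow> (\<forall>x\<in>A. \<bar>g x\<bar> \<le> c) \<and> (\<forall>i. partials_bounded k A c (partial1 i g))"

lemma partials_boundedD: "partials_bounded k A c g \<Longrightarrow> x \<in> A \<Longrightarrow> \<bar>g x\<bar> \<le> c"
  by (cases k) auto

lemma partials_bounded_le: "partials_bounded k A c g \<Longrightarrow> c \<le> d \<Longrightarrow> partials_bounded k A d g"
  by (induction k arbitrary: g) (auto intro: order_trans)

lemma partials_bounded_lower: "partials_bounded (Suc k) A c g \<Longrightarrow> partials_bounded k A c g"
  by (induction k arbitrary: g) auto

lemma partials_bounded_partial1: "partials_bounded (Suc k) A c g \<Longrightarrow> partials_bounded k A c (partial1 i g)"
  by simp

lemma partials_bounded_cong: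
  assumes "open S" "A \<subseteq> S"
  shows "(\<And>y. y \<in> S \<Longrightarrow> g y = h y) \<Longrightarrow> partials_bounded k A c g \<longleftrightarrow> partials_bounded k A c h"
proof (induction k arbitrary: g h)
  case 0 then show ?case using assms(2) by (simp add: subset_iff)
next
  case (Suc k)
  have "partials_bounded k A c (partial1 i g) \<longleftrightarrow> partials_bounded k A c (partial1 i h)" for i
    by (rule Suc.IH) (rule partial1_cong[OF assms(1) _ Suc.prems])
  then show ?case using Suc.prems assms(2) by (simp add: subset_iff)
qed

lemma partials_bounded_add:
  assumes S: "open S" "A \<subseteq> S"
  shows "cdiff k S g \<Longrightarrow> cdiff k S h \<Longrightarrow> partials_bounded k A c g \<Longrightarrow> partials_bounded k A d h \<Longrightarrow>
    partials_bounded k A (c + d) (\<lambda>x. g x + h x)"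
proof (induction k arbitrary: g h)
  case 0 then show ?case by (fastforce intro: order_trans[OF abs_triangle_ineq] add_mono)
next
  case (Suc k)
  have "partials_bounded k A (c + d) (partial1 i (\<lambda>x. g x + h x)) \<longleftrightarrow>
      partials_bounded k A (c + d) (\<lambda>x. partial1 i g x + partial1 i h x)" for i
    by (rule partials_bounded_cong[OF S]) (rule partial1_add[OF Suc.prems(1,2)])
  moreover have "partials_bounded k A (c + d) (\<lambda>x. partial1 i g x + partial1 i h x)" for i
    using Suc.prems by (intro Suc.IH) simp_all
  moreover have "\<bar>g x + h x\<bar> \<le> c + d" if "x \<in> A" for x
    using partials_boundedD[OF Suc.prems(3) that] partials_boundedD[OF Suc.prems(4) that] by linarith
  ultimately show ?case by simp
qed

text \<open>Each derivative turns a product into two products, whence the factor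
  \<open>2 ^ k\<close>.\<close>

lemma partials_bounded_mult:
  assumes S: "open S" "A \<subseteq> S"
  shows "cdiff k S g \<Longrightarrow> cdiff k S h \<Longrightarrow> partials_bounded k A c g \<Longrightarrow> partials_bounded k A d h \<Longrightarrow>
    partials_bounded k A (2 ^ k * (c * d)) (\<lambda>x. g x * h x)"
proof (induction k arbitrary: g h)
  case 0
  have "\<bar>g x * h x\<bar> \<le> c * d" if "x \<in> A" for x
    using partials_boundedD[OF 0(3) that] partials_boundedD[OF 0(4) that]
    unfolding abs_mult by (intro mult_mono) auto
  then show ?case by simp
next
  case (Suc k)
  note g = Suc.prems(1) and h = Suc.prems(2) and bg = Suc.prems(3) and bh = Suc.prems(4)
  have "partials_bounded k A (2 ^ Suc k * (c * d)) (partial1 i (\<lambda>x. g x * h x)) \<longleftrightarrow>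
      partials_bounded k A (2 ^ Suc k * (c * d)) (\<lambda>x. partial1 i g x * h x + g x * partial1 i h x)" for i
    by (rule partials_bounded_cong[OF S]) (rule partial1_mult[OF g h])
  moreover have "partials_bounded k A (2 ^ k * (c * d) + 2 ^ k * (c * d))
      (\<lambda>x. partial1 i g x * h x + g x * partial1 i h x)" for i
    by (rule partials_bounded_add[OF S
          cdiff_mult[OF S(1) cdiff_Suc_partial[OF g] cdiff_lower[OF h]]
          cdiff_mult[OF S(1) cdiff_lower[OF g] cdiff_Suc_partial[OF h]]
          Suc.IH[OF cdiff_Suc_partial[OF g] cdiff_lower[OF h]
             partials_bounded_partial1[OF bg] partials_bounded_lower[OF bh]]
          Suc.IH[OF cdiff_lower[OF g] cdiff_Suc_partial[OF h]
             partials_bounded_lower[OF bg] partials_bounded_partial1[OF bh]]])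
  moreover have "\<bar>g x * h x\<bar> \<le> 2 ^ Suc k * (c * d)" if "x \<in> A" for x
  proof -
    have gx: "\<bar>g x\<bar> \<le> c" "\<bar>h x\<bar> \<le> d"
      using partials_boundedD[OF bg that] partials_boundedD[OF bh that] .
    then have "\<bar>g x * h x\<bar> \<le> c * d" unfolding abs_mult by (intro mult_mono) auto
    \<comment> \<open>Neither constant is assumed nonnegative; the point \<open>x\<close> of
      \<open>A\<close> makes both so, since they bound absolute values there.\<close>
    moreover have "1 * (c * d) \<le> 2 ^ Suc k * (c * d)"
      using gx by (intro mult_right_mono mult_nonneg_nonneg one_le_power) (auto intro: order_trans[OF abs_ge_zero])
    ultimately show ?thesis by simp
  qed
  moreover have "2 ^ k * (c * d) + 2 ^ k * (c * d) = 2 ^ Suc k * (c * d)" by simp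
  ultimately show ?case by (simp only: partials_bounded.simps) blast
qed

lemma partials_bounded_compact:
  assumes "compact K" "K \<subseteq> S"
  shows "cdiff k S g \<Longrightarrow> \<exists>c\<ge>0. partials_bounded k K c g"
proof (induction k arbitrary: g)
  case 0
  have "bounded (g ` K)"
    using 0 assms by (intro compact_imp_bounded compact_continuous_image) (auto intro: continuous_on_subset)
  then obtain c where "\<forall>x\<in>K. \<bar>g x\<bar> \<le> c" unfolding bounded_iff by auto
  then show ?case by (intro exI[of _ "\<bar>c\<bar>"]) auto
next
  case (Suc k)
  have "bounded (g ` K)"
    using cdiff_cont[OF Suc.prems] assms
    by (intro compact_imp_bounded compact_continuous_image) (auto intro: continuous_on_subset)
  then obtain c where c: "\<forall>x\<in>K. \<bar>g x\<bar> \<le> c" unfolding bounded_iff by auto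
  have "\<exists>d\<ge>0. partials_bounded k K d (partial1 i g)" for i
    by (rule Suc.IH[OF cdiff_Suc_partial[OF Suc.prems]])
  then obtain d where d: "\<And>i. d i \<ge> 0" "\<And>i. partials_bounded k K (d i) (partial1 i g)" by metis
  define e where "e = \<bar>c\<bar> + (\<Sum>i\<in>UNIV. d i)"
  have s: "d i \<le> (\<Sum>i\<in>UNIV. d i)" for i using d(1) by (intro member_le_sum) auto
  have "d i \<le> e" for i using s[of i] unfolding e_def by linarith
  then have "partials_bounded k K e (partial1 i g)" for i using partials_bounded_le[OF d(2)] by blast
  moreover have "0 \<le> (\<Sum>i\<in>UNIV. d i)" using d(1) by (simp add: sum_nonneg)
  moreover have "\<bar>g x\<bar> \<le> e" if "x \<in> K" for x
    using c that \<open>0 \<le> (\<Sum>i\<in>UNIV. d i)\<close> unfolding e_def by fastforce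
  ultimately show ?case by (intro exI[of _ e]) (auto simp: e_def)
qed

text \<open>Translates bounds indexed by multi-indices, the form of the hypothesis on
  \<open>v\<close>, into bounds for partials taken in any order; commutation brings each first
  partial innermost.\<close>

lemma cpartial_partials_bounded:
  fixes g :: "real^'d::finite \<Rightarrow> real"
  assumes S: "open S" "A \<subseteq> S"
  shows "cdiff k S g \<Longrightarrow> (\<And>\<alpha> :: 'd mindex. \<And>x. msize \<alpha> \<le> k \<Longrightarrow> x \<in> A \<Longrightarrow> \<bar>cpartial \<alpha> g x\<bar> \<le> c) \<Longrightarrow>
     partials_bounded k A c g"
proof (induction k arbitrary: g)
  case 0 from 0(2)[of "\<lambda>_. 0"] show ?case by simp
next
  case (Suc k)
  note g = Suc.prems(1)
  have "\<bar>cpartial \<alpha> (partial1 i g) x\<bar> \<le> c" if "msize \<alpha> \<le> k" "x \<in> A" for \<alpha> :: "'d mindex" and i x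
  proof -
    have "cpartial (mshift i \<alpha>) g x = cpartial \<alpha> (partial1 i g) x"
      by (rule cpartial_mshift_inner[OF S(1) cdiff_mono[OF g]]) (use that S in auto)
    then show ?thesis using Suc.prems(2)[of "mshift i \<alpha>" x] that by (simp only: msize_mshift)
  qed
  then have "partials_bounded k A c (partial1 i g)" for i
    by (rule Suc.IH[OF cdiff_Suc_partial[OF g]])
  moreover have "\<bar>g x\<bar> \<le> c" if "x \<in> A" for x
    using Suc.prems(2)[of "\<lambda>_. 0" x] that by simp
  ultimately show ?case by simp
qed

lemma has_partial_power:
  assumes "has_partial i g x D"
  shows "has_partial i (\<lambda>x. g x ^ Suc n) x (real (Suc n) * g x ^ n * D)"
  using DERIV_power_Suc[OF assms[unfolded has_partial_def], of n]
  unfolding has_partial_def by (simp add: algebra_simps)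

text \<open>Each derivative that falls on a power of \<open>v\<close> costs one factor \<open>v\<close>, so one factor survives
  \<open>msize \<beta>\<close> derivatives of \<open>v ^ (msize \<beta> + 1)\<close>.\<close>

lemma cpartial_power_mult_estimate:
  assumes S: "open S" and K: "compact K" "K \<subseteq> S"
  shows "cdiff (msize \<beta>) S v \<Longrightarrow> \<exists>C\<ge>0. \<forall>\<psi> \<epsilon>. cdiff (msize \<beta>) S \<psi> \<longrightarrow> partials_bounded (msize \<beta>) K \<epsilon> \<psi> \<longrightarrow>
    (\<forall>x\<in>K. \<bar>cpartial \<beta> (\<lambda>y. v y ^ (msize \<beta> + Suc r) * \<psi> y) x\<bar> \<le> C * \<epsilon> * \<bar>v x\<bar> ^ Suc r)"
proof (induction \<beta> rule: mindex_induct)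
  case zero
  have "\<bar>v x ^ Suc r * \<psi> x\<bar> \<le> 1 * \<epsilon> * \<bar>v x\<bar> ^ Suc r" if "partials_bounded 0 K \<epsilon> \<psi>" "x \<in> K" for \<psi> \<epsilon> x
  proof -
    have "\<bar>v x\<bar> ^ Suc r * \<bar>\<psi> x\<bar> \<le> \<bar>v x\<bar> ^ Suc r * \<epsilon>"
      using partials_boundedD[OF that] by (intro mult_left_mono) auto
    then show ?thesis by (simp only: abs_mult power_abs mult.commute mult_1)
  qed
  then show ?case by (intro exI[of _ 1]) (simp only: cpartial_0 msize_0 add_0 zero_le_one, blast)
next
  case (step \<gamma> j)
  define k where "k = msize \<gamma>"
  have v: "cdiff (Suc k) S v" using step.prems by (simp only: msize_mshift k_def)
  obtain C where C: "C \<ge> 0" "\<And>\<psi> \<epsilon> x. cdiff k S \<psi> \<Longrightarrow> partials_bounded k K \<epsilon> \<psi> \<Longrightarrow> x \<in> K \<Longrightarrow>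
     \<bar>cpartial \<gamma> (\<lambda>y. v y ^ (k + Suc r) * \<psi> y) x\<bar> \<le> C * \<epsilon> * \<bar>v x\<bar> ^ Suc r"
    using step.IH cdiff_lower[OF v] unfolding k_def by blast
  define w where "w = (\<lambda>x. real (Suc (k + Suc r)) * partial1 j v x)"
  have w: "cdiff k S w" unfolding w_def by (rule cdiff_cmult[OF S cdiff_Suc_partial[OF v]])
  obtain c1 where c1: "c1 \<ge> 0" "partials_bounded k K c1 w"
    using partials_bounded_compact[OF K w] by blast
  obtain c2 where c2: "c2 \<ge> 0" "partials_bounded k K c2 v"
    using partials_bounded_compact[OF K cdiff_lower[OF v]] by blast
  have main: "\<bar>cpartial (mshift j \<gamma>) (\<lambda>y. v y ^ (Suc k + Suc r) * \<psi> y) x\<bar>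
      \<le> (C * (2 ^ k * c1 + 2 ^ k * c2)) * \<epsilon> * \<bar>v x\<bar> ^ Suc r"
    if \<psi>: "cdiff (Suc k) S \<psi>" and b: "partials_bounded (Suc k) K \<epsilon> \<psi>" and x: "x \<in> K" for \<psi> \<epsilon> x
  proof -
    \<comment> \<open>One derivative of \<open>v ^ (Suc k + Suc r) * \<psi>\<close> is
      \<open>v ^ (k + Suc r) * T\<close>. The exponent has dropped by one together with the order,
      so the induction hypothesis applies with \<open>T\<close> in place of \<psi>, and the bound on
      \<open>T\<close> is a multiple of that on \<psi>.\<close>
    define T where "T = (\<lambda>x. w x * \<psi> x + v x * partial1 j \<psi> x)"
    have T1: "cdiff k S (\<lambda>x. w x * \<psi> x)" by (rule cdiff_mult[OF S w cdiff_lower[OF \<psi>]])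
    have T2: "cdiff k S (\<lambda>x. v x * partial1 j \<psi> x)"
      by (rule cdiff_mult[OF S cdiff_lower[OF v] cdiff_Suc_partial[OF \<psi>]])
    have T: "cdiff k S T" unfolding T_def by (rule cdiff_add[OF S T1 T2])
    have bT: "partials_bounded k K (2 ^ k * (c1 * \<epsilon>) + 2 ^ k * (c2 * \<epsilon>)) T" unfolding T_def
      by (rule partials_bounded_add[OF S K(2) T1 T2
        partials_bounded_mult[OF S K(2) w cdiff_lower[OF \<psi>] c1(2) partials_bounded_lower[OF b]]
        partials_bounded_mult[OF S K(2) cdiff_lower[OF v] cdiff_Suc_partial[OF \<psi>] c2(2) partials_bounded_partial1[OF b]]])
    have xS: "x \<in> S" using x K by auto
    have "cpartial (mshift j \<gamma>) (\<lambda>y. v y ^ (Suc k + Suc r) * \<psi> y) x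
        = cpartial \<gamma> (partial1 j (\<lambda>y. v y ^ (Suc k + Suc r) * \<psi> y)) x"
      by (rule cpartial_mshift_inner[OF S _ xS])
        (unfold k_def[symmetric], rule cdiff_mult[OF S cdiff_power[OF S v] \<psi>])
    also have "\<dots> = cpartial \<gamma> (\<lambda>y. v y ^ (k + Suc r) * T y) x"
    proof (rule cpartial_cong[OF S xS])
      fix y assume y: "y \<in> S"
      have "partial1 j (\<lambda>y. v y ^ Suc (k + Suc r) * \<psi> y) y
         = (real (Suc (k + Suc r)) * v y ^ (k + Suc r) * partial1 j v y) * \<psi> y
           + v y ^ Suc (k + Suc r) * partial1 j \<psi> y"
        by (rule partial1_eqI[OF has_partial_mult[OF has_partial_power[OF cdiff_has_partial[OF v y]]
             cdiff_has_partial[OF \<psi> y]]])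
      then show "partial1 j (\<lambda>y. v y ^ (Suc k + Suc r) * \<psi> y) y = v y ^ (k + Suc r) * T y"
        by (simp add: T_def w_def algebra_simps)
    qed
    finally show ?thesis using C(2)[OF T bT x] by (simp add: algebra_simps)
  qed
  have "0 \<le> C * (2 ^ k * c1 + 2 ^ k * c2)" using C(1) c1(1) c2(1) by simp
  then show ?case unfolding msize_mshift k_def[symmetric] using main by blast
qed

section \<open>Mollification\<close>

definition conv :: "(real^'d::finite \<Rightarrow> real) \<Rightarrow> (real^'d \<Rightarrow> real) \<Rightarrow> real^'d \<Rightarrow> real" where
  "conv g \<rho> x = (\<integral>z. g z * \<rho> (x - z) \<partial>lborel)"

text \<open>Invariance of \<open>lborel\<close> under the reflection
  \<open>z \<mapsto> x - z\<close>. It allows a derivative to be put on either factor: on the kernel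
  for smoothness, on \<open>g\<close> for approximation.\<close>

lemma conv_commute:
  fixes g \<rho> :: "real^'d::finite \<Rightarrow> real"
  assumes [measurable]: "g \<in> borel_measurable borel" "\<rho> \<in> borel_measurable borel"
  shows "conv g \<rho> = conv \<rho> g"
proof
  fix x
  have "(lborel :: (real^'d) measure) = density (distr lborel borel (\<lambda>z. x + (-1) *\<^sub>R z)) (\<lambda>_. ennreal (\<bar>-1\<bar> ^ DIM(real^'d)))"
    by (rule lborel_affine) simp
  then have l: "(lborel :: (real^'d) measure) = distr lborel borel (\<lambda>z. x - z)"
    by (simp add: density_1)
  have "conv g \<rho> x = (\<integral>z. g z * \<rho> (x - z) \<partial>distr lborel borel (\<lambda>z. x - z))"
    unfolding conv_def by (subst l) simp
  also have "\<dots> = (\<integral>z. g (x - z) * \<rho> (x - (x - z)) \<partial>lborel)"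
    by (rule integral_distr) measurable
  finally show "conv g \<rho> x = conv \<rho> g x" by (simp add: conv_def mult.commute)
qed

lemma compact_support_integrable:
  fixes f :: "real^'d::finite \<Rightarrow> real"
  assumes "continuous_on UNIV f" "compact K" "\<And>x. x \<notin> K \<Longrightarrow> f x = 0"
  shows "integrable lborel f"
proof -
  have i: "integrable lborel (\<lambda>x. indicator K x *\<^sub>R f x)"
    by (rule borel_integrable_compact[OF assms(2) continuous_on_subset[OF assms(1)]]) simp
  have ind: "indicator K x *\<^sub>R f x = f x" for x using assms(3)[of x] by (cases "x \<in> K") auto
  have "(\<lambda>x. indicator K x *\<^sub>R f x) = f" by (rule ext) (rule ind)
  then show ?thesis using i by (simp only:)
qed

text \<open>On a fixed box the convolution is a gauge integral with parameter \<open>x\<close>, to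
  which continuity in a parameter and differentiation under the integral apply.\<close>

lemma conv_eq_integral_cbox:
  fixes g \<rho> :: "real^'d::finite \<Rightarrow> real"
  assumes g: "continuous_on UNIV g" and \<rho>: "continuous_on UNIV \<rho>"
    and supp: "\<And>z. z \<notin> cbox a b \<Longrightarrow> g z = 0"
  shows "conv g \<rho> x = integral (cbox a b) (\<lambda>z. g z * \<rho> (x - z))"
proof -
  have "continuous_on UNIV (\<lambda>z. g z * \<rho> (x - z))"
    by (intro continuous_intros g continuous_on_compose2[OF \<rho>]) auto
  then have "integrable lborel (\<lambda>z. g z * \<rho> (x - z))"
    by (rule compact_support_integrable[OF _ compact_cbox[of a b]]) (simp add: supp)
  then have "conv g \<rho> x = integral UNIV (\<lambda>z. g z * \<rho> (x - z))"
    unfolding conv_def by (rule integral_lborel[symmetric])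
  also have "(\<lambda>z. g z * \<rho> (x - z)) = (\<lambda>z. if z \<in> cbox a b then g z * \<rho> (x - z) else 0)"
    using supp by auto
  also have "integral UNIV \<dots> = integral (cbox a b) (\<lambda>z. g z * \<rho> (x - z))"
    by (rule integral_restrict_UNIV)
  finally show ?thesis .
qed

lemma conv_continuous:
  fixes g \<rho> :: "real^'d::finite \<Rightarrow> real"
  assumes g: "continuous_on UNIV g" and \<rho>: "continuous_on UNIV \<rho>"
    and supp: "\<And>z. z \<notin> cbox a b \<Longrightarrow> g z = 0"
  shows "continuous_on UNIV (conv g \<rho>)"
proof -
  have "continuous_on UNIV (\<lambda>x. integral (cbox a b) (\<lambda>z. g z * \<rho> (x - z)))"
    by (rule integral_continuous_on_param)
      (auto intro!: continuous_intros continuous_on_compose2[OF g] continuous_on_compose2[OF \<rho>] simp: split_beta)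
  moreover have "conv g \<rho> = (\<lambda>x. integral (cbox a b) (\<lambda>z. g z * \<rho> (x - z)))"
    by (rule ext) (rule conv_eq_integral_cbox[OF assms])
  ultimately show ?thesis by simp
qed

lemma conv_has_partial:
  fixes g \<rho> :: "real^'d::finite \<Rightarrow> real"
  assumes g: "continuous_on UNIV g" and \<rho>: "cdiff (Suc 0) UNIV \<rho>"
    and supp: "\<And>z. z \<notin> cbox a b \<Longrightarrow> g z = 0"
  shows "has_partial i (conv g \<rho>) x (conv g (partial1 i \<rho>) x)"
proof -
  have d\<rho>: "continuous_on UNIV (partial1 i \<rho>)" "continuous_on UNIV \<rho>"
    using \<rho> cdiff_cont by auto
  have "((\<lambda>s. integral (cbox a b) (\<lambda>z. g z * \<rho> (x + s *\<^sub>R axis i 1 - z))) has_field_derivative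
      integral (cbox a b) (\<lambda>z. g z * partial1 i \<rho> (x + 0 *\<^sub>R axis i 1 - z))) (at 0 within UNIV)"
  proof (rule leibniz_rule_field_derivative[where f = "\<lambda>s z. g z * \<rho> (x + s *\<^sub>R axis i 1 - z)"
        and fx = "\<lambda>s z. g z * partial1 i \<rho> (x + s *\<^sub>R axis i 1 - z)"])
    fix s :: real and z
    have "((\<lambda>s. \<rho> ((x - z) + s *\<^sub>R axis i 1)) has_real_derivative partial1 i \<rho> ((x - z) + s *\<^sub>R axis i 1)) (at s)"
      by (intro DERIV_along_axis exI) (rule cdiff_has_partial[OF \<rho> UNIV_I])
    then have "((\<lambda>s. \<rho> (x + s *\<^sub>R axis i 1 - z)) has_real_derivative partial1 i \<rho> (x + s *\<^sub>R axis i 1 - z)) (at s)"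
      by (simp only: diff_add_eq)
    then show "((\<lambda>s. g z * \<rho> (x + s *\<^sub>R axis i 1 - z)) has_field_derivative
        g z * partial1 i \<rho> (x + s *\<^sub>R axis i 1 - z)) (at s within UNIV)"
      by (rule DERIV_cmult)
  next
    fix s :: real
    show "(\<lambda>z. g z * \<rho> (x + s *\<^sub>R axis i 1 - z)) integrable_on cbox a b"
      by (intro integrable_continuous continuous_intros continuous_on_compose2[OF g]
          continuous_on_compose2[OF d\<rho>(2)]) auto
  next
    show "continuous_on (UNIV \<times> cbox a b) (\<lambda>(s, z). g z * partial1 i \<rho> (x + s *\<^sub>R axis i 1 - z))"
      unfolding split_beta
      by (intro continuous_intros continuous_on_compose2[OF g] continuous_on_compose2[OF d\<rho>(1)]) auto
  qed auto
  moreover have "conv g (partial1 i \<rho>) y = integral (cbox a b) (\<lambda>z. g z * partial1 i \<rho> (y - z))"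
      "conv g \<rho> y = integral (cbox a b) (\<lambda>z. g z * \<rho> (y - z))" for y
    by (rule conv_eq_integral_cbox[OF g d\<rho>(1)], erule supp)
      (rule conv_eq_integral_cbox[OF g d\<rho>(2)], erule supp)
  ultimately show ?thesis unfolding has_partial_def by simp
qed

lemma conv_cdiff:
  fixes g \<rho> :: "real^'d::finite \<Rightarrow> real"
  assumes g: "continuous_on UNIV g" and supp: "\<And>z. z \<notin> cbox a b \<Longrightarrow> g z = 0"
  shows "cdiff k UNIV \<rho> \<Longrightarrow> cdiff k UNIV (conv g \<rho>)"
proof (induction k arbitrary: \<rho>)
  case 0
  have "continuous_on UNIV (conv g \<rho>)"
    by (rule conv_continuous[OF g cdiff_cont[OF 0]]) (rule supp)
  then show ?case by simp
next
  case (Suc k)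
  show ?case
  proof (rule cdiff_SucI[OF open_UNIV])
    show "continuous_on UNIV (conv g \<rho>)"
      by (rule conv_continuous[OF g cdiff_cont[OF Suc.prems]]) (rule supp)
    have \<rho>: "cdiff (Suc 0) UNIV \<rho>" by (rule cdiff_mono[OF Suc.prems]) simp
    show "has_partial i (conv g \<rho>) x (conv g (partial1 i \<rho>) x)" for i x
      by (rule conv_has_partial[OF g \<rho>]) (rule supp)
    show "cdiff k UNIV (conv g (partial1 i \<rho>))" for i
      by (rule Suc.IH[OF cdiff_Suc_partial[OF Suc.prems]])
  qed
qed

lemma partial1_outside_support:
  fixes g :: "real^'d::finite \<Rightarrow> real"
  assumes "closed K" "\<And>z. z \<notin> K \<Longrightarrow> g z = 0" "x \<notin> K"
  shows "partial1 i g x = 0"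
proof -
  have "partial1 i g x = partial1 i (\<lambda>_. 0) x"
    by (rule partial1_cong[OF open_Compl[OF assms(1)]]) (simp_all add: assms(2,3))
  also have "\<dots> = 0" by (rule partial1_eqI[OF has_partial_const])
  finally show ?thesis .
qed

lemma compact_subset_cbox:
  fixes K :: "(real^'d::finite) set"
  assumes "compact K" obtains a b where "K \<subseteq> cbox a b"
proof -
  obtain a where "K \<subseteq> cbox (-a) a"
    using bounded_subset_cbox_symmetric[OF compact_imp_bounded[OF assms]] .
  then show thesis by (rule that)
qed

text \<open>Uniform continuity holds on the closed 1-neighbourhood \<open>K'\<close> of
  \<open>K\<close>. Points at distance below 1 either both lie in \<open>K'\<close> or both lie
  outside \<open>K\<close>, where \<open>f\<close> vanishes.\<close>

lemma compact_support_uniformly_continuous: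
  fixes f :: "real^'d::finite \<Rightarrow> real"
  assumes f: "continuous_on UNIV f" and K: "compact K" "\<And>x. x \<notin> K \<Longrightarrow> f x = 0" and e: "e > 0"
  shows "\<exists>d>0. \<forall>x y. dist x y < d \<longrightarrow> \<bar>f x - f y\<bar> < e"
proof -
  define K' where "K' = {x + y |x y. x \<in> K \<and> y \<in> cball 0 1}"
  have "compact K'" unfolding K'_def by (rule compact_sums[OF K(1) compact_cball])
  with continuous_on_subset[OF f subset_UNIV] have "uniformly_continuous_on K' f"
    by (rule compact_uniformly_continuous)
  then obtain d where d: "d > 0" "\<forall>x\<in>K'. \<forall>y\<in>K'. dist y x < d \<longrightarrow> dist (f y) (f x) < e"
    using e unfolding uniformly_continuous_on_def by meson
  have near: "x \<in> K'" if "y \<in> K" "dist x y < 1" for x y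
    unfolding K'_def
    by (rule CollectI, rule exI[of _ y], rule exI[of _ "x - y"]) (use that in \<open>simp add: dist_norm norm_minus_commute less_imp_le\<close>)
  have "\<bar>f x - f y\<bar> < e" if xy: "dist x y < min d 1" for x y
  proof (cases "x \<in> K \<or> y \<in> K")
    case True
    have d1: "dist x y < 1" "dist y x < 1" "dist x x < 1" "dist y y < 1" "dist x y < d"
      using xy by (simp_all add: dist_commute)
    have "x \<in> K'" using True near[OF _ d1(1)] near[OF _ d1(3)] by blast
    moreover have "y \<in> K'" using True near[OF _ d1(2)] near[OF _ d1(4)] by blast
    ultimately have "dist (f x) (f y) < e" using d(2) d1(5) by blast
    then show ?thesis by (simp add: dist_real_def)
  next
    case False then show ?thesis using K(2) e by simp
  qed
  then show ?thesis using d(1) by (intro exI[of _ "min d 1"]) simp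
qed

text \<open>After commuting the factors, \<open>conv g \<rho> x / c\<close> is a weighted mean of
  the values \<open>g (x - y)\<close> with \<open>norm y \<le> \<delta>\<close>, each of them within
  \<epsilon> of \<open>g x\<close>.\<close>

lemma conv_close:
  fixes g \<rho> :: "real^'d::finite \<Rightarrow> real"
  assumes g: "continuous_on UNIV g" and \<rho>: "continuous_on UNIV \<rho>"
    and pos: "\<And>y. 0 \<le> \<rho> y" and supp: "\<And>y. \<delta> < norm y \<Longrightarrow> \<rho> y = 0"
    and c: "c = (\<integral>y. \<rho> y \<partial>lborel)" "c > 0"
    and close: "\<And>y. norm y \<le> \<delta> \<Longrightarrow> \<bar>g (x - y) - g x\<bar> \<le> \<epsilon>"
  shows "\<bar>conv g \<rho> x / c - g x\<bar> \<le> \<epsilon>"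
proof -
  have \<rho>0: "\<rho> y = 0" if "y \<notin> cball 0 \<delta>" for y using supp[of y] that by simp
  have i1: "integrable lborel \<rho>" by (rule compact_support_integrable[OF \<rho> compact_cball \<rho>0])
  have i2: "integrable lborel (\<lambda>y. \<rho> y * g (x - y))"
    by (rule compact_support_integrable[OF _ compact_cball[of 0 \<delta>]])
      (use \<rho>0 in \<open>auto intro!: continuous_intros \<rho> continuous_on_compose2[OF g]\<close>)
  have "conv g \<rho> x = (\<integral>y. \<rho> y * g (x - y) \<partial>lborel)"
    using conv_commute[of g \<rho>] borel_measurable_continuous_onI[OF g] borel_measurable_continuous_onI[OF \<rho>]
    by (simp add: conv_def)
  then have "conv g \<rho> x - c * g x = (\<integral>y. \<rho> y * g (x - y) - \<rho> y * g x \<partial>lborel)"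
    unfolding c(1) using i1 i2 by simp
  also have "\<bar>\<dots>\<bar> \<le> (\<integral>y. \<bar>\<rho> y * g (x - y) - \<rho> y * g x\<bar> \<partial>lborel)"
    by (rule integral_abs_bound)
  also have "\<dots> \<le> (\<integral>y. \<rho> y * \<epsilon> \<partial>lborel)"
  proof (rule integral_mono)
    show "integrable lborel (\<lambda>y. \<bar>\<rho> y * g (x - y) - \<rho> y * g x\<bar>)"
      using i1 i2 by (intro integrable_abs Bochner_Integration.integrable_diff) auto
    show "\<bar>\<rho> y * g (x - y) - \<rho> y * g x\<bar> \<le> \<rho> y * \<epsilon>" for y
    proof (cases "norm y \<le> \<delta>")
      case True
      have "\<bar>\<rho> y * g (x - y) - \<rho> y * g x\<bar> = \<rho> y * \<bar>g (x - y) - g x\<bar>"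
        using pos[of y] by (simp add: right_diff_distrib[symmetric] abs_mult)
      then show ?thesis using close[OF True] pos[of y] by (simp add: mult_left_mono)
    qed (simp add: supp)
  qed (use i1 in auto)
  also have "\<dots> = c * \<epsilon>" unfolding c(1) by simp
  finally have "\<bar>conv g \<rho> x - c * g x\<bar> \<le> c * \<epsilon>" .
  moreover have "conv g \<rho> x / c - g x = (conv g \<rho> x - c * g x) / c" using c(2) by (simp add: field_simps)
  ultimately show ?thesis using c(2) by (simp add: abs_divide field_simps)
qed

text \<open>A mollifier kernel made from the given cut-off: \<eta> is 0 near the origin and 1 beyond
  1, so this function is 1 near 0 and vanishes outside the ball of radius \<delta>. The squared norm
  keeps the argument polynomial, hence smooth at 0. The kernel is not normalised; convolutions are
  divided by its integral.\<close>

definition bump :: "(real \<Rightarrow> real) \<Rightarrow> real \<Rightarrow> real^'d::finite \<Rightarrow> real" where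
  "bump \<eta> \<delta> x = 1 - \<eta> ((x \<bullet> x) / \<delta>\<^sup>2)"

lemma cdiff_component: "cdiff k UNIV (\<lambda>x::real^'d::finite. x $ i)"
proof (cases k)
  case (Suc l)
  show ?thesis unfolding Suc
  proof (rule cdiff_SucI[OF open_UNIV])
    show "has_partial j (\<lambda>x::real^'d. x $ i) x (axis j 1 $ i)" for j x
      unfolding has_partial_def by (auto intro!: derivative_eq_intros)
  qed (auto intro: continuous_intros cdiff_const)
qed (auto intro: continuous_intros)

lemma cdiff_bump:
  assumes "cutoff_eta \<eta>"
  shows "cdiff k UNIV (bump \<eta> \<delta> :: real^'d::finite \<Rightarrow> real)"
proof -
  have "cdiff k UNIV (\<lambda>x::real^'d. (1 / \<delta>\<^sup>2) * (\<Sum>i\<in>UNIV. x $ i * x $ i))"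
    by (intro cdiff_cmult cdiff_sum cdiff_mult cdiff_component open_UNIV)
  moreover have "(\<lambda>x::real^'d. (1 / \<delta>\<^sup>2) * (\<Sum>i\<in>UNIV. x $ i * x $ i)) = (\<lambda>x. (x \<bullet> x) / \<delta>\<^sup>2)"
    by (simp add: inner_vec_def)
  ultimately have "cdiff k UNIV (\<lambda>x::real^'d. (x \<bullet> x) / \<delta>\<^sup>2)" by simp
  moreover have "(deriv ^^ l) \<eta> differentiable (at x)" for l x
    using assms by (simp add: cutoff_eta_def)
  ultimately have "cdiff k UNIV (\<lambda>x::real^'d. \<eta> ((x \<bullet> x) / \<delta>\<^sup>2))"
    by (intro cdiff_compose[OF open_UNIV, where F = \<eta>])
  then have "cdiff k UNIV (\<lambda>x::real^'d. 1 - \<eta> ((x \<bullet> x) / \<delta>\<^sup>2))"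
    by (rule cdiff_diff[OF open_UNIV cdiff_const])
  then show ?thesis by (simp add: bump_def[abs_def])
qed

lemma bump_nonneg: "cutoff_eta \<eta> \<Longrightarrow> 0 \<le> bump \<eta> \<delta> x"
  by (simp add: cutoff_eta_def bump_def)

lemma bump_support:
  assumes "cutoff_eta \<eta>" "\<delta> > 0" "\<delta> < norm x" shows "bump \<eta> \<delta> x = 0"
proof -
  have "\<delta>\<^sup>2 < (norm x)\<^sup>2" using assms by (intro power_strict_mono) auto
  then have "(x \<bullet> x) / \<delta>\<^sup>2 > 1" using assms by (simp add: power2_norm_eq_inner)
  then show ?thesis using assms(1) by (simp add: bump_def cutoff_eta_def)
qed

text \<open>A continuous nonnegative function with integral 0 over a box would vanish on that box,
  but the kernel is 1 at the origin.\<close>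

lemma bump_integral_pos:
  assumes \<eta>: "cutoff_eta \<eta>" and \<delta>: "\<delta> > 0"
  shows "0 < (\<integral>x. bump \<eta> \<delta> x \<partial>(lborel :: (real^'d::finite) measure))"
proof -
  let ?b = "bump \<eta> \<delta> :: real^'d \<Rightarrow> real"
  have cont: "continuous_on UNIV ?b" using cdiff_cont[OF cdiff_bump[OF \<eta>]] by blast
  have i: "integrable lborel ?b"
    by (rule compact_support_integrable[OF cont compact_cball[of 0 \<delta>]], rule bump_support[OF \<eta> \<delta>]) simp
  define a :: "real^'d" where "a = (\<chi> i. \<delta>)"
  have "integral (cbox (-a) a) ?b \<noteq> 0"
  proof
    assume "integral (cbox (-a) a) ?b = 0"
    moreover have "box (-a) a \<noteq> {}" using \<delta> by (simp add: box_ne_empty(2) a_def Basis_vec_def inner_axis)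
    ultimately have "\<forall>x\<in>cbox (-a) a. ?b x = 0"
      using integral_cbox_eq_0_iff[of "-a" a ?b] continuous_on_subset[OF cont] bump_nonneg[OF \<eta>] by blast
    moreover have "0 \<in> cbox (-a) a" using \<delta> by (simp add: mem_box a_def Basis_vec_def inner_axis)
    moreover have "?b 0 = 1" using \<eta> by (simp add: bump_def cutoff_eta_def)
    ultimately show False by fastforce
  qed
  moreover have "integral (cbox (-a) a) ?b \<ge> 0"
    using bump_nonneg[OF \<eta>] by (intro integral_nonneg integrable_continuous continuous_on_subset[OF cont]) auto
  moreover have "integral (cbox (-a) a) ?b \<le> integral UNIV ?b"
    using bump_nonneg[OF \<eta>] has_integral_integral_lborel[OF i]
    by (intro integral_subset_le integrable_continuous continuous_on_subset[OF cont]) auto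
  ultimately show ?thesis unfolding integral_lborel[OF i] by linarith
qed

lemma mollify_close_0:
  fixes g :: "real^'d::finite \<Rightarrow> real"
  assumes \<eta>: "cutoff_eta \<eta>" and K: "compact K" and \<epsilon>: "\<epsilon> > 0"
    and g: "continuous_on UNIV g" "\<forall>x. x \<notin> K \<longrightarrow> g x = 0"
  shows "\<exists>\<delta>0>0. \<forall>\<delta>. 0 < \<delta> \<and> \<delta> < \<delta>0 \<longrightarrow>
      (\<forall>x. \<bar>conv g (bump \<eta> \<delta>) x / (\<integral>y. bump \<eta> \<delta> y \<partial>(lborel :: (real^'d) measure)) - g x\<bar> \<le> \<epsilon>)"
proof -
  obtain d where d: "d > 0" "\<forall>x y. dist x y < d \<longrightarrow> \<bar>g x - g y\<bar> < \<epsilon>"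
    using compact_support_uniformly_continuous[OF g(1) K _ \<epsilon>] g(2) by blast
  have "\<bar>conv g (bump \<eta> \<delta>) x / (\<integral>y. bump \<eta> \<delta> y \<partial>(lborel :: (real^'d) measure)) - g x\<bar> \<le> \<epsilon>"
    if \<delta>: "0 < \<delta>" "\<delta> < d" for \<delta> x
  proof (rule conv_close[OF g(1) _ _ _ refl bump_integral_pos[OF \<eta> \<delta>(1)]])
    show "continuous_on UNIV (bump \<eta> \<delta> :: real^'d \<Rightarrow> real)" using cdiff_cont[OF cdiff_bump[OF \<eta>]] by blast
    show "\<bar>g (x - y) - g x\<bar> \<le> \<epsilon>" if "norm y \<le> \<delta>" for y
      using d(2)[rule_format, of "x - y" x] that \<delta> by (simp add: dist_norm less_imp_le)
  qed (rule bump_nonneg[OF \<eta>] bump_support[OF \<eta> \<delta>(1)], assumption?)+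
  then show ?thesis using d(1) by blast
qed

text \<open>Uniform approximation passes to derivatives because convolution commutes with them.\<close>

lemma mollify_close:
  fixes g :: "real^'d::finite \<Rightarrow> real"
  assumes \<eta>: "cutoff_eta \<eta>" and K: "compact K" and \<epsilon>: "\<epsilon> > 0"
  shows "cdiff k UNIV g \<Longrightarrow> \<forall>x. x \<notin> K \<longrightarrow> g x = 0 \<Longrightarrow>
    \<exists>\<delta>0>0. \<forall>\<delta>. 0 < \<delta> \<and> \<delta> < \<delta>0 \<longrightarrow>
      partials_bounded k UNIV \<epsilon> (\<lambda>x. conv g (bump \<eta> \<delta>) x / (\<integral>y. bump \<eta> \<delta> y \<partial>(lborel :: (real^'d) measure)) - g x)"
proof (induction k arbitrary: g)
  case 0
  have "continuous_on UNIV g" using 0(1) by simp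
  from mollify_close_0[OF \<eta> K \<epsilon> this 0(2)] show ?case by simp
next
  case (Suc k)
  note g = Suc.prems(1)
  define c where "c \<delta> = (\<integral>y. bump \<eta> \<delta> y \<partial>(lborel :: (real^'d) measure))" for \<delta>
  obtain d0 where d0: "d0 > 0" "\<And>\<delta> x. 0 < \<delta> \<Longrightarrow> \<delta> < d0 \<Longrightarrow> \<bar>conv g (bump \<eta> \<delta>) x / c \<delta> - g x\<bar> \<le> \<epsilon>"
    using mollify_close_0[OF \<eta> K \<epsilon> cdiff_cont[OF g] Suc.prems(2)] unfolding c_def by blast
  have "\<exists>d>0. \<forall>\<delta>. 0 < \<delta> \<and> \<delta> < d \<longrightarrow>
      partials_bounded k UNIV \<epsilon> (\<lambda>x. conv (partial1 i g) (bump \<eta> \<delta>) x / c \<delta> - partial1 i g x)" for i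
    unfolding c_def
    by (intro Suc.IH[OF cdiff_Suc_partial[OF g]] allI impI,
        rule partial1_outside_support[OF compact_imp_closed[OF K]]) (use Suc.prems(2) in simp_all)
  then obtain d where d: "\<And>i. d i > 0" "\<And>i \<delta>. 0 < \<delta> \<Longrightarrow> \<delta> < d i \<Longrightarrow>
      partials_bounded k UNIV \<epsilon> (\<lambda>x. conv (partial1 i g) (bump \<eta> \<delta>) x / c \<delta> - partial1 i g x)"
    by metis
  \<comment> \<open>There are finitely many directions, so one threshold serves the function and all
    its first partials.\<close>
  define e where "e = Min (insert d0 (range d))"
  have e: "e > 0" "e \<le> d0" using d0(1) d(1) by (auto simp: e_def)
  have ed: "e \<le> d i" for i unfolding e_def by (rule Min_le) auto
  have "partials_bounded (Suc k) UNIV \<epsilon> (\<lambda>x. conv g (bump \<eta> \<delta>) x / c \<delta> - g x)"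
    if \<delta>: "0 < \<delta>" "\<delta> < e" for \<delta>
  proof -
    let ?b = "bump \<eta> \<delta> :: real^'d \<Rightarrow> real"
    have cb: "continuous_on UNIV ?b" using cdiff_cont[OF cdiff_bump[OF \<eta>]] by blast
    have m: "?b \<in> borel_measurable borel" by (rule borel_measurable_continuous_onI[OF cb])
    obtain a a' :: "real^'d" where a: "cball 0 \<delta> \<subseteq> cbox a a'" using compact_subset_cbox[OF compact_cball] .
    have supp: "?b z = 0" if "z \<notin> cbox a a'" for z
    proof (rule bump_support[OF \<eta> \<delta>(1)])
      show "\<delta> < norm z" using a that by (auto simp: subset_iff not_le)
    qed
    have part: "partial1 i (\<lambda>x. conv g ?b x / c \<delta> - g x) = (\<lambda>x. conv (partial1 i g) ?b x / c \<delta> - partial1 i g x)" for i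
    proof
      fix x
      have g1: "cdiff (Suc 0) UNIV g" by (rule cdiff_mono[OF g]) simp
      have mp: "g \<in> borel_measurable borel" "partial1 i g \<in> borel_measurable borel"
        by (intro borel_measurable_continuous_onI cdiff_cont[OF g] cdiff_cont[OF cdiff_Suc_partial[OF g]])+
      \<comment> \<open>The kernel is put first so that the derivative falls on \<open>g\<close>;
        the partial of the error is then the mollification error of \<open>partial1 i g\<close>,
        covered by the induction hypothesis.\<close>
      have "has_partial i (conv ?b g) x (conv ?b (partial1 i g) x)"
        by (rule conv_has_partial[OF cb g1 supp])
      then have h: "has_partial i (conv g ?b) x (conv (partial1 i g) ?b x)"
        by (simp only: conv_commute[OF mp(1) m] conv_commute[OF mp(2) m])
      have "has_partial i (\<lambda>x. (1 / c \<delta>) * conv g ?b x + (-1) * g x) x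
         ((0 * conv g ?b x + (1 / c \<delta>) * conv (partial1 i g) ?b x) + (0 * g x + (-1) * partial1 i g x))"
        by (intro has_partial_add has_partial_mult has_partial_const h cdiff_has_partial[OF g]) simp
      then have "has_partial i (\<lambda>x. conv g ?b x / c \<delta> - g x) x (conv (partial1 i g) ?b x / c \<delta> - partial1 i g x)"
        by simp
      then show "partial1 i (\<lambda>x. conv g ?b x / c \<delta> - g x) x = conv (partial1 i g) ?b x / c \<delta> - partial1 i g x"
        by (rule partial1_eqI)
    qed
    have "\<delta> < d0" "\<And>i. \<delta> < d i" using \<delta>(2) e(2) ed less_le_trans by blast+
    then show ?thesis using d0(2)[OF \<delta>(1)] d(2)[OF \<delta>(1)] by (simp add: part)
  qed
  then show ?case using e(1) unfolding c_def by blast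
qed

text \<open>\<open>K'\<close> is chosen before \<open>k\<close>, \<open>g\<close> and \<epsilon>, so
  the constants of integral estimates over \<open>K'\<close> stay fixed while the approximation
  improves.\<close>

lemma test_fun_approx:
  fixes \<Omega> :: "(real^'d::finite) set"
  assumes \<eta>: "cutoff_eta \<eta>" and \<Omega>: "open \<Omega>" and K: "compact K" "K \<subseteq> \<Omega>"
  obtains K' where "compact K'" "K \<subseteq> K'" "K' \<subseteq> \<Omega>"
    "\<And>k g \<epsilon>. cdiff k UNIV g \<Longrightarrow> \<forall>x. x \<notin> K \<longrightarrow> g x = 0 \<Longrightarrow> \<epsilon> > 0 \<Longrightarrow>
      \<exists>\<psi>. test_fun \<Omega> \<psi> \<and> (\<forall>x. x \<notin> K' \<longrightarrow> \<psi> x = 0) \<and> partials_bounded k UNIV \<epsilon> (\<lambda>x. \<psi> x - g x)"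
proof -
  obtain r where r: "r > 0" "\<And>x. x \<in> K \<Longrightarrow> cball x r \<subseteq> \<Omega>"
  proof (cases "K = {}")
    case True then show ?thesis using that[of 1] by simp
  next
    case False
    obtain e where e: "e > 0" "(\<Union>x\<in>K. ball x e) \<subseteq> \<Omega>"
      using compact_subset_open_imp_ball_epsilon_subset[OF K(1) \<Omega> K(2)] by blast
    show ?thesis
    proof (rule that[of "e / 2"])
      show "cball x (e/2) \<subseteq> \<Omega>" if "x \<in> K" for x
      proof -
        have "cball x (e/2) \<subseteq> ball x e" using e(1) by (auto simp: subset_iff)
        then show ?thesis using e(2) that by blast
      qed
    qed (use e(1) in simp)
  qed
  define K' where "K' = {x + y |x y. x \<in> K \<and> y \<in> cball 0 r}"
  have K'1: "compact K'" unfolding K'_def by (rule compact_sums[OF K(1) compact_cball])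
  have K'2: "K \<subseteq> K'"
  proof
    fix x assume "x \<in> K"
    then show "x \<in> K'" unfolding K'_def using r(1)
      by (intro CollectI exI[of _ x] exI[of _ 0]) simp
  qed
  have K'3: "K' \<subseteq> \<Omega>"
  proof
    fix z assume "z \<in> K'"
    then obtain x y where xy: "z = x + y" "x \<in> K" "norm y \<le> r" unfolding K'_def by auto
    then have "z \<in> cball x r" by (simp add: dist_norm)
    then show "z \<in> \<Omega>" using r(2)[OF xy(2)] by blast
  qed
  show thesis
  proof (rule that[OF K'1 K'2 K'3])
    fix k g and \<epsilon> :: real
    assume g: "cdiff k UNIV g" and supp: "\<forall>x. x \<notin> K \<longrightarrow> g x = 0" and \<epsilon>: "\<epsilon> > 0"
    define c where "c \<delta> = (\<integral>y. bump \<eta> \<delta> y \<partial>(lborel :: (real^'d) measure))" for \<delta>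
    obtain d0 where d0: "d0 > 0" "\<And>\<delta>. 0 < \<delta> \<Longrightarrow> \<delta> < d0 \<Longrightarrow>
       partials_bounded k UNIV \<epsilon> (\<lambda>x. conv g (bump \<eta> \<delta>) x / c \<delta> - g x)"
      using mollify_close[OF \<eta> K(1) \<epsilon> g supp] unfolding c_def by blast
    \<comment> \<open>The bound by \<open>r\<close> keeps the support inside \<open>K'\<close>, the
      closed \<open>r\<close>-neighbourhood of \<open>K\<close>; halving \<open>d0\<close> gives
      strict inequality.\<close>
    define \<delta> where "\<delta> = min r (d0 / 2)"
    have \<delta>: "0 < \<delta>" "\<delta> \<le> r" "\<delta> < d0" using r(1) d0(1) by (auto simp: \<delta>_def min_def)
    define \<psi> where "\<psi> x = conv g (bump \<eta> \<delta>) x / c \<delta>" for x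
    have \<psi>0: "\<psi> x = 0" if x: "x \<notin> K'" for x
    proof -
      have "g z * bump \<eta> \<delta> (x - z) = 0" for z
      proof (cases "z \<in> K")
        case True
        have "\<delta> < norm (x - z)"
        proof (rule ccontr)
          assume "\<not> \<delta> < norm (x - z)"
          then have "x \<in> K'" unfolding K'_def using True \<delta>(2)
            by (intro CollectI exI[of _ z] exI[of _ "x - z"]) simp
          then show False using x by simp
        qed
        then show ?thesis using bump_support[OF \<eta> \<delta>(1), of "x - z"] by simp
      qed (simp add: supp)
      then have "(\<lambda>z. g z * bump \<eta> \<delta> (x - z)) = (\<lambda>_. 0)" by (rule ext)
      then show ?thesis by (simp only: \<psi>_def conv_def) simp
    qed
    obtain a b where ab: "K \<subseteq> cbox a b" using compact_subset_cbox[OF K(1)] .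
    have "cdiff l UNIV \<psi>" for l
    proof -
      have "cdiff l UNIV (conv g (bump \<eta> \<delta>))"
        by (rule conv_cdiff[OF cdiff_cont[OF g] _ cdiff_bump[OF \<eta>], of a b]) (use ab supp in blast)
      then have "cdiff l UNIV (\<lambda>x. (1 / c \<delta>) * conv g (bump \<eta> \<delta>) x)" by (rule cdiff_cmult[OF open_UNIV])
      then show ?thesis by (simp add: \<psi>_def[abs_def])
    qed
    then have "Ck_on l UNIV \<psi>" for l by (simp only: Ck_on_iff_cdiff open_UNIV)
    moreover have cl: "closure {x. \<psi> x \<noteq> 0} \<subseteq> K'"
      by (rule closure_minimal) (use \<psi>0 compact_imp_closed[OF K'1] in auto)
    moreover have "compact (closure {x. \<psi> x \<noteq> 0})"
      using compact_Int_closed[OF K'1 closed_closure, of "{x. \<psi> x \<noteq> 0}"] unfolding Int_absorb1[OF cl] .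
    ultimately have "test_fun \<Omega> \<psi>" unfolding test_fun_def
      using K'3 by blast
    moreover have "partials_bounded k UNIV \<epsilon> (\<lambda>x. \<psi> x - g x)" unfolding \<psi>_def by (rule d0(2)[OF \<delta>(1,3)])
    ultimately show "\<exists>\<psi>. test_fun \<Omega> \<psi> \<and> (\<forall>x. x \<notin> K' \<longrightarrow> \<psi> x = 0) \<and> partials_bounded k UNIV \<epsilon> (\<lambda>x. \<psi> x - g x)"
      using \<psi>0 by blast
  qed
qed

section \<open>Weak derivatives tested against \<open>C\<^sup>k\<close> functions\<close>

lemma cpartial_const_0: "cpartial \<alpha> (\<lambda>_. 0) x = 0"
  using cpartial_cmult[OF open_UNIV cdiff_const[of "msize \<alpha>" UNIV 0], of x 0] by simp

lemma cpartial_outside_support: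
  assumes "closed K" "\<forall>z. z \<notin> K \<longrightarrow> g z = 0" "x \<notin> K"
  shows "cpartial \<alpha> g x = 0"
proof -
  have "cpartial \<alpha> g x = cpartial \<alpha> (\<lambda>_. 0) x"
    by (rule cpartial_cong[OF open_Compl[OF assms(1)]]) (simp_all add: assms(2,3))
  then show ?thesis by (simp add: cpartial_const_0)
qed

lemma cutoff_eta_smooth: "cutoff_eta \<eta> \<Longrightarrow> (deriv ^^ l) \<eta> differentiable (at x)"
  by (simp add: cutoff_eta_def)

lemma lebesgue_open: "open S \<Longrightarrow> S \<in> sets lebesgue"
  by (simp add: borel_open)

lemma lebesgue_compact: "compact K \<Longrightarrow> K \<in> sets lebesgue"
  by (simp add: borel_compact)

lemma integrable_from_compact:
  fixes u h :: "real^'d::finite \<Rightarrow> real"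
  assumes K: "compact K" "K \<subseteq> S" and S: "open S" and h: "integrable (lebesgue_on K) h"
    and u: "u \<in> borel_measurable (lebesgue_on K)" and le: "\<And>x. x \<in> K \<Longrightarrow> \<bar>u x\<bar> \<le> c * \<bar>h x\<bar>"
    and supp: "\<And>x. x \<in> S \<Longrightarrow> x \<notin> K \<Longrightarrow> u x = 0"
  shows "integrable (lebesgue_on S) u" "\<bar>\<integral>x. u x \<partial>lebesgue_on S\<bar> \<le> c * (\<integral>x. \<bar>h x\<bar> \<partial>lebesgue_on K)"
proof -
  note KL = lebesgue_compact[OF K(1)] and OL = lebesgue_open[OF S]
  have hc: "integrable (lebesgue_on K) (\<lambda>x. c * \<bar>h x\<bar>)" using h by simp
  have sp: "space (lebesgue_on K) = K" by simp
  have iu: "integrable (lebesgue_on K) u"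
  proof (rule Bochner_Integration.integrable_bound[OF hc u])
    show "AE x in lebesgue_on K. norm (u x) \<le> norm (c * \<bar>h x\<bar>)"
    proof (rule AE_I2)
      fix x assume "x \<in> space (lebesgue_on K)"
      then have "\<bar>u x\<bar> \<le> c * \<bar>h x\<bar>" using le sp by blast
      then show "norm (u x) \<le> norm (c * \<bar>h x\<bar>)" by simp
    qed
  qed
  have eq: "(\<lambda>x. if x \<in> S then u x else 0) = (\<lambda>x. if x \<in> K then u x else 0)"
    using supp K(2) by (auto simp: fun_eq_iff)
  show "integrable (lebesgue_on S) u"
    using iu Lebesgue_Measure.integrable_restrict_UNIV[OF OL, of u]
      Lebesgue_Measure.integrable_restrict_UNIV[OF KL, of u] eq by simp
  have "(\<integral>x. u x \<partial>lebesgue_on S) = (\<integral>x. u x \<partial>lebesgue_on K)"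
    using Lebesgue_Measure.integral_restrict_UNIV[OF OL, of u] Lebesgue_Measure.integral_restrict_UNIV[OF KL, of u] eq by simp
  also have "\<bar>\<dots>\<bar> \<le> (\<integral>x. \<bar>u x\<bar> \<partial>lebesgue_on K)" by (rule integral_abs_bound)
  also have "\<dots> \<le> (\<integral>x. c * \<bar>h x\<bar> \<partial>lebesgue_on K)"
    by (rule integral_mono) (use iu hc le sp in auto)
  also have "\<dots> = c * (\<integral>x. \<bar>h x\<bar> \<partial>lebesgue_on K)" by simp
  finally show "\<bar>\<integral>x. u x \<partial>lebesgue_on S\<bar> \<le> c * (\<integral>x. \<bar>h x\<bar> \<partial>lebesgue_on K)" .
qed

lemma cont_measurable_on_compact:
  fixes g :: "real^'d::finite \<Rightarrow> real"
  assumes "continuous_on S g" "K \<subseteq> S" "compact K"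
  shows "g \<in> borel_measurable (lebesgue_on K)"
  by (rule continuous_imp_measurable_on_sets_lebesgue[OF continuous_on_subset[OF assms(1,2)] lebesgue_compact[OF assms(3)]])

text \<open>Only \<open>f * v\<close> is integrable on compact sets. The differentiated factor is at
  most \<open>C * e * \<bar>v x\<bar>\<close> on \<open>K\<close> by
  \<open>cpartial_power_mult_estimate\<close>, and this surviving \<open>v\<close> is what makes the
  product with \<open>f\<close> integrable.\<close>

lemma wderiv_lhs_bound:
  fixes S :: "(real^'d::finite) set"
  assumes S: "open S" and v: "cdiff (msize \<beta>) S v" and f: "L1loc_w S v f"
    and K: "compact K" "K \<subseteq> S"
  obtains C where "C \<ge> 0"
    "\<And>\<phi> e. cdiff (msize \<beta>) UNIV \<phi> \<Longrightarrow> \<forall>x. x \<notin> K \<longrightarrow> \<phi> x = 0 \<Longrightarrow> partials_bounded (msize \<beta>) K e \<phi> \<Longrightarrow>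
      integrable (lebesgue_on S) (\<lambda>x. f x * cpartial \<beta> (\<lambda>y. v y ^ (msize \<beta> + 1) * \<phi> y) x) \<and>
      \<bar>\<integral>x. f x * cpartial \<beta> (\<lambda>y. v y ^ (msize \<beta> + 1) * \<phi> y) x \<partial>lebesgue_on S\<bar> \<le> C * e"
proof -
  obtain C where C: "C \<ge> 0" "\<And>\<psi> \<epsilon> x. cdiff (msize \<beta>) S \<psi> \<Longrightarrow> partials_bounded (msize \<beta>) K \<epsilon> \<psi> \<Longrightarrow> x \<in> K \<Longrightarrow>
     \<bar>cpartial \<beta> (\<lambda>y. v y ^ (msize \<beta> + Suc 0) * \<psi> y) x\<bar> \<le> C * \<epsilon> * \<bar>v x\<bar> ^ Suc 0"
    using cpartial_power_mult_estimate[OF S K v, of 0] by blast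
  have fv: "integrable (lebesgue_on K) (\<lambda>x. f x * v x)" using f K by (simp add: L1loc_w_def)
  define I where "I = (\<integral>x. \<bar>f x * v x\<bar> \<partial>lebesgue_on K)"
  have I: "I \<ge> 0" unfolding I_def by simp
  have "integrable (lebesgue_on S) (\<lambda>x. f x * cpartial \<beta> (\<lambda>y. v y ^ (msize \<beta> + 1) * \<phi> y) x) \<and>
      \<bar>\<integral>x. f x * cpartial \<beta> (\<lambda>y. v y ^ (msize \<beta> + 1) * \<phi> y) x \<partial>lebesgue_on S\<bar> \<le> C * I * e"
    if \<phi>: "cdiff (msize \<beta>) UNIV \<phi>" and supp: "\<forall>x. x \<notin> K \<longrightarrow> \<phi> x = 0" and b: "partials_bounded (msize \<beta>) K e \<phi>"
    for \<phi> e
  proof -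
    define A where "A = cpartial \<beta> (\<lambda>y. v y ^ (msize \<beta> + 1) * \<phi> y)"
    have \<phi>': "cdiff (msize \<beta>) S \<phi>" by (rule cdiff_subset[OF \<phi>]) simp
    have A: "\<bar>A x\<bar> \<le> C * e * \<bar>v x\<bar>" if "x \<in> K" for x
      using C(2)[OF \<phi>' b that] by (simp add: A_def)
    have A0: "A x = 0" if "x \<notin> K" for x
      unfolding A_def by (rule cpartial_outside_support[OF compact_imp_closed[OF K(1)] _ that]) (simp add: supp)
    have "cdiff (msize \<beta>) S (\<lambda>y. v y ^ (msize \<beta> + 1) * \<phi> y)"
      by (rule cdiff_mult[OF S cdiff_power[OF S v] \<phi>'])
    then have "cdiff 0 S A" unfolding A_def by (intro cdiff_cpartial) simp
    then have mA: "A \<in> borel_measurable (lebesgue_on K)"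
      by (intro cont_measurable_on_compact[OF _ K(2,1)]) simp
    have mv: "v \<in> borel_measurable (lebesgue_on K)"
      by (rule cont_measurable_on_compact[OF cdiff_cont[OF v] K(2,1)])
    have mfv: "(\<lambda>x. f x * v x) \<in> borel_measurable (lebesgue_on K)" using fv by (rule borel_measurable_integrable)
    have eq: "f x * A x = (f x * v x) * (A x / v x)" if "x \<in> K" for x
      using A[OF that] by (cases "v x = 0") auto
    have m: "(\<lambda>x. (f x * v x) * (A x / v x)) \<in> borel_measurable (lebesgue_on K)"
      by (rule borel_measurable_times[OF mfv borel_measurable_divide[OF mA mv]])
    have mfA: "(\<lambda>x. f x * A x) \<in> borel_measurable (lebesgue_on K)"
      by (rule measurable_cong[THEN iffD2, OF _ m]) (simp add: eq)
    have le: "\<bar>f x * A x\<bar> \<le> (C * e) * \<bar>f x * v x\<bar>" if "x \<in> K" for x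
      using mult_left_mono[OF A[OF that], of "\<bar>f x\<bar>"] by (simp add: abs_mult mult_ac)
    have z: "f x * A x = 0" if "x \<in> S" "x \<notin> K" for x using A0[OF that(2)] by simp
    have "\<bar>\<integral>x. f x * A x \<partial>lebesgue_on S\<bar> \<le> (C * e) * I"
      unfolding I_def by (rule integrable_from_compact(2)[OF K S fv mfA le z])
    moreover have "integrable (lebesgue_on S) (\<lambda>x. f x * A x)"
      by (rule integrable_from_compact(1)[OF K S fv mfA le z])
    ultimately show ?thesis unfolding A_def by (simp add: mult_ac)
  qed
  then show thesis using that[of "C * I"] C(1) I by simp
qed

lemma wderiv_rhs_bound:
  fixes S :: "(real^'d::finite) set" and w :: "real^'d \<Rightarrow> real"
  assumes S: "open S" and g: "L1loc_w S w g" and K: "compact K" "K \<subseteq> S"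
  obtains C where "C \<ge> 0"
    "\<And>\<phi> e. continuous_on UNIV \<phi> \<Longrightarrow> \<forall>x. x \<notin> K \<longrightarrow> \<phi> x = 0 \<Longrightarrow> \<forall>x\<in>K. \<bar>\<phi> x\<bar> \<le> e \<Longrightarrow>
      integrable (lebesgue_on S) (\<lambda>x. w x * \<phi> x * g x) \<and>
      \<bar>\<integral>x. w x * \<phi> x * g x \<partial>lebesgue_on S\<bar> \<le> C * e"
proof -
  have gw: "integrable (lebesgue_on K) (\<lambda>x. g x * w x)" using g K by (simp add: L1loc_w_def)
  define I where "I = (\<integral>x. \<bar>g x * w x\<bar> \<partial>lebesgue_on K)"
  have I: "I \<ge> 0" unfolding I_def by simp
  have "integrable (lebesgue_on S) (\<lambda>x. w x * \<phi> x * g x) \<and>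
      \<bar>\<integral>x. w x * \<phi> x * g x \<partial>lebesgue_on S\<bar> \<le> I * e"
    if \<phi>: "continuous_on UNIV \<phi>" and supp: "\<forall>x. x \<notin> K \<longrightarrow> \<phi> x = 0" and b: "\<forall>x\<in>K. \<bar>\<phi> x\<bar> \<le> e" for \<phi> e
  proof -
    have m\<phi>: "\<phi> \<in> borel_measurable (lebesgue_on K)" by (rule cont_measurable_on_compact[OF \<phi> subset_UNIV K(1)])
    have mgw: "(\<lambda>x. g x * w x) \<in> borel_measurable (lebesgue_on K)" using gw by (rule borel_measurable_integrable)
    have m: "(\<lambda>x. (g x * w x) * \<phi> x) \<in> borel_measurable (lebesgue_on K)"
      using mgw m\<phi> by (rule borel_measurable_times)
    have le: "\<bar>(g x * w x) * \<phi> x\<bar> \<le> e * \<bar>g x * w x\<bar>" if "x \<in> K" for x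
      using mult_left_mono[of "\<bar>\<phi> x\<bar>" e "\<bar>g x * w x\<bar>"] b that by (simp add: abs_mult mult_ac)
    have z: "(g x * w x) * \<phi> x = 0" if "x \<in> S" "x \<notin> K" for x using supp that(2) by simp
    have "\<bar>\<integral>x. (g x * w x) * \<phi> x \<partial>lebesgue_on S\<bar> \<le> e * I"
      unfolding I_def by (rule integrable_from_compact(2)[OF K S gw m le z])
    moreover have "integrable (lebesgue_on S) (\<lambda>x. (g x * w x) * \<phi> x)"
      by (rule integrable_from_compact(1)[OF K S gw m le z])
    moreover have "(\<lambda>x. (g x * w x) * \<phi> x) = (\<lambda>x. w x * \<phi> x * g x)" by (simp add: mult_ac)
    ultimately show ?thesis by (simp add: mult.commute[of I])
  qed
  then show thesis using that[of I] I by blast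
qed

text \<open>The defining identity extends from smooth to \<open>C\<^sup>k\<close> test functions since both sides are
  continuous in the \<open>C\<^sup>k\<close> norm on a fixed compact set.\<close>

lemma wderiv_Ck_test:
  fixes S :: "(real^'d::finite) set"
  assumes \<eta>: "cutoff_eta \<eta>" and S: "open S" and v: "cdiff (msize \<beta>) S v" and f: "L1loc_w S v f"
    and wd: "is_wderiv_v S v \<beta> f g"
    and \<phi>: "cdiff (msize \<beta>) UNIV \<phi>" and K: "compact K" "K \<subseteq> S" and supp: "\<forall>x. x \<notin> K \<longrightarrow> \<phi> x = 0"
  shows "integrable (lebesgue_on S) (\<lambda>x. f x * cpartial \<beta> (\<lambda>y. v y ^ (msize \<beta> + 1) * \<phi> y) x)"
    and "integrable (lebesgue_on S) (\<lambda>x. v x ^ (msize \<beta> + 1) * \<phi> x * g x)"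
    and "(\<integral>x. f x * cpartial \<beta> (\<lambda>y. v y ^ (msize \<beta> + 1) * \<phi> y) x \<partial>lebesgue_on S)
        = (-1) ^ msize \<beta> * (\<integral>x. v x ^ (msize \<beta> + 1) * \<phi> x * g x \<partial>lebesgue_on S)"
proof -
  define k where "k = msize \<beta>"
  define w where "w x = v x ^ (k + 1)" for x
  define A where "A \<phi> = cpartial \<beta> (\<lambda>y. w y * \<phi> y)" for \<phi>
  obtain K' where K': "compact K'" "K \<subseteq> K'" "K' \<subseteq> S"
    and ap: "\<And>k \<phi> \<epsilon>. cdiff k UNIV \<phi> \<Longrightarrow> \<forall>x. x \<notin> K \<longrightarrow> \<phi> x = 0 \<Longrightarrow> \<epsilon> > 0 \<Longrightarrow>
      \<exists>\<psi>. test_fun S \<psi> \<and> (\<forall>x. x \<notin> K' \<longrightarrow> \<psi> x = 0) \<and> partials_bounded k UNIV \<epsilon> (\<lambda>x. \<psi> x - \<phi> x)"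
    using test_fun_approx[OF \<eta> S K] by blast
  have supp': "\<forall>x. x \<notin> K' \<longrightarrow> \<phi> x = 0" using supp K'(2) by blast
  obtain C1 where C1: "C1 \<ge> 0" "\<And>\<phi> e. cdiff k UNIV \<phi> \<Longrightarrow> \<forall>x. x \<notin> K' \<longrightarrow> \<phi> x = 0 \<Longrightarrow> partials_bounded k K' e \<phi> \<Longrightarrow>
      integrable (lebesgue_on S) (\<lambda>x. f x * A \<phi> x) \<and> \<bar>\<integral>x. f x * A \<phi> x \<partial>lebesgue_on S\<bar> \<le> C1 * e"
    using wderiv_lhs_bound[OF S v f K'(1,3)] unfolding A_def w_def k_def by blast
  have g: "L1loc_w S w g" using wd by (simp add: is_wderiv_v_def w_def[abs_def] k_def)
  obtain C2 where C2: "C2 \<ge> 0" "\<And>\<phi> e. continuous_on UNIV \<phi> \<Longrightarrow> \<forall>x. x \<notin> K' \<longrightarrow> \<phi> x = 0 \<Longrightarrow> \<forall>x\<in>K'. \<bar>\<phi> x\<bar> \<le> e \<Longrightarrow>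
      integrable (lebesgue_on S) (\<lambda>x. w x * \<phi> x * g x) \<and> \<bar>\<integral>x. w x * \<phi> x * g x \<partial>lebesgue_on S\<bar> \<le> C2 * e"
    using wderiv_rhs_bound[OF S g K'(1,3)] by blast
  have iA: "integrable (lebesgue_on S) (\<lambda>x. f x * A \<psi> x)" and iR: "integrable (lebesgue_on S) (\<lambda>x. w x * \<psi> x * g x)"
    if s: "cdiff k UNIV \<psi>" "\<forall>x. x \<notin> K' \<longrightarrow> \<psi> x = 0" for \<psi>
  proof -
    obtain c where "partials_bounded k K' c \<psi>"
      using partials_bounded_compact[OF K'(1) subset_UNIV s(1)] by blast
    moreover from this have "\<forall>x\<in>K'. \<bar>\<psi> x\<bar> \<le> c" using partials_boundedD by blast
    ultimately show "integrable (lebesgue_on S) (\<lambda>x. f x * A \<psi> x)" "integrable (lebesgue_on S) (\<lambda>x. w x * \<psi> x * g x)"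
      using C1(2)[OF s] C2(2)[OF cdiff_cont[OF s(1)] s(2)] by blast+
  qed
  note \<phi>k = \<phi>[folded k_def]
  show "integrable (lebesgue_on S) (\<lambda>x. f x * cpartial \<beta> (\<lambda>y. v y ^ (msize \<beta> + 1) * \<phi> y) x)"
    using iA[OF \<phi>k supp'] by (simp only: A_def w_def k_def)
  show "integrable (lebesgue_on S) (\<lambda>x. v x ^ (msize \<beta> + 1) * \<phi> x * g x)"
    using iR[OF \<phi>k supp'] by (simp only: w_def k_def)
  define L where "L \<psi> = (\<integral>x. f x * A \<psi> x \<partial>lebesgue_on S)" for \<psi>
  define R where "R \<psi> = (-1) ^ k * (\<integral>x. w x * \<psi> x * g x \<partial>lebesgue_on S)" for \<psi>
  have test: "L \<psi> = R \<psi>" if "test_fun S \<psi>" for \<psi>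
    using wd that by (simp add: is_wderiv_v_def L_def R_def A_def w_def k_def)
  have close: "\<bar>L \<phi> - R \<phi>\<bar> \<le> (C1 + C2) * \<epsilon>" if \<epsilon>: "\<epsilon> > 0" for \<epsilon>
  proof -
    obtain \<psi> where \<psi>: "test_fun S \<psi>" "\<forall>x. x \<notin> K' \<longrightarrow> \<psi> x = 0" "partials_bounded k UNIV \<epsilon> (\<lambda>x. \<psi> x - \<phi> x)"
      using ap[OF \<phi>k supp \<epsilon>] by blast
    have "Ck_on k UNIV \<psi>" using \<psi>(1) by (simp add: test_fun_def)
    then have \<psi>k: "cdiff k UNIV \<psi>" by (simp only: Ck_on_iff_cdiff open_UNIV)
    define \<theta> where "\<theta> = (\<lambda>x. \<psi> x - \<phi> x)"
    have \<theta>: "cdiff k UNIV \<theta>" unfolding \<theta>_def by (rule cdiff_diff[OF open_UNIV \<psi>k \<phi>k])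
    have \<theta>0: "\<forall>x. x \<notin> K' \<longrightarrow> \<theta> x = 0" using \<psi>(2) supp' by (simp add: \<theta>_def)
    have b: "\<bar>\<theta> x\<bar> \<le> \<epsilon>" for x using partials_boundedD[OF \<psi>(3)] by (simp add: \<theta>_def)
    have bK: "partials_bounded k K' \<epsilon> \<theta>"
    proof -
      have "partials_bounded k K' \<epsilon> h" if "partials_bounded k UNIV \<epsilon> h" for h k
        using that by (induction k arbitrary: h) auto
      then show ?thesis using \<psi>(3) by (simp add: \<theta>_def)
    qed
    \<comment> \<open>Linearity of \<open>A\<close> is claimed on \<open>S\<close> only, since
      \<open>v\<close> is differentiable only there; the integrals see nothing else.\<close>
    have A\<theta>: "A \<theta> x = A \<psi> x - A \<phi> x" if x: "x \<in> S" for x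
    proof -
      have "A \<theta> x = cpartial \<beta> (\<lambda>y. w y * \<psi> y - w y * \<phi> y) x"
        unfolding A_def \<theta>_def by (simp add: right_diff_distrib)
      also have "\<dots> = A \<psi> x - A \<phi> x" unfolding A_def w_def
        by (rule cpartial_diff[OF S _ _ x]; rule cdiff_mult[OF S cdiff_power[OF S v]])
          (rule cdiff_subset[OF \<psi>k[unfolded k_def]] cdiff_subset[OF \<phi>], simp)+
      finally show ?thesis .
    qed
    have "L \<theta> = (\<integral>x. f x * A \<psi> x - f x * A \<phi> x \<partial>lebesgue_on S)"
      unfolding L_def by (rule Bochner_Integration.integral_cong[OF refl]) (simp add: A\<theta> right_diff_distrib)
    also have "\<dots> = L \<psi> - L \<phi>" unfolding L_def
      by (rule Bochner_Integration.integral_diff[OF iA[OF \<psi>k \<psi>(2)] iA[OF \<phi>k supp']])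
    finally have L: "L \<theta> = L \<psi> - L \<phi>" .
    have "(\<integral>x. w x * \<theta> x * g x \<partial>lebesgue_on S) = (\<integral>x. w x * \<psi> x * g x - w x * \<phi> x * g x \<partial>lebesgue_on S)"
      unfolding \<theta>_def by (simp add: algebra_simps)
    also have "\<dots> = (\<integral>x. w x * \<psi> x * g x \<partial>lebesgue_on S) - (\<integral>x. w x * \<phi> x * g x \<partial>lebesgue_on S)"
      by (rule Bochner_Integration.integral_diff[OF iR[OF \<psi>k \<psi>(2)] iR[OF \<phi>k supp']])
    finally have R: "R \<theta> = R \<psi> - R \<phi>" unfolding R_def by (simp only: right_diff_distrib)
    have "\<bar>L \<theta>\<bar> \<le> C1 * \<epsilon>" using C1(2)[OF \<theta> \<theta>0 bK] by (simp add: L_def)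
    moreover have "\<bar>R \<theta>\<bar> \<le> C2 * \<epsilon>"
      using C2(2)[OF cdiff_cont[OF \<theta>] \<theta>0, of \<epsilon>] b by (simp add: R_def abs_mult power_abs)
    moreover have "L \<phi> - R \<phi> = R \<theta> - L \<theta>" using L R test[OF \<psi>(1)] by simp
    ultimately show ?thesis by (simp add: distrib_right)
  qed
  have "L \<phi> = R \<phi>"
  proof (rule ccontr)
    assume "L \<phi> \<noteq> R \<phi>"
    then have pos: "\<bar>L \<phi> - R \<phi>\<bar> > 0" by simp
    \<comment> \<open>With this choice the error bound is at most half of the gap itself; the added
      1 keeps the denominator positive when both constants vanish.\<close>
    define \<epsilon> where "\<epsilon> = \<bar>L \<phi> - R \<phi>\<bar> / (2 * (C1 + C2 + 1))"
    have "\<epsilon> > 0" unfolding \<epsilon>_def using pos C1(1) C2(1) by simp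
    then have "\<bar>L \<phi> - R \<phi>\<bar> \<le> (C1 + C2) * \<epsilon>" by (rule close)
    also have "\<dots> \<le> (C1 + C2 + 1) * \<epsilon>" using \<open>\<epsilon> > 0\<close> by (simp add: mult_right_mono)
    also have "\<dots> = \<bar>L \<phi> - R \<phi>\<bar> / 2" unfolding \<epsilon>_def using C1(1) C2(1) by (simp add: field_simps)
    finally show False using pos by simp
  qed
  then show "(\<integral>x. f x * cpartial \<beta> (\<lambda>y. v y ^ (msize \<beta> + 1) * \<phi> y) x \<partial>lebesgue_on S)
        = (-1) ^ msize \<beta> * (\<integral>x. v x ^ (msize \<beta> + 1) * \<phi> x * g x \<partial>lebesgue_on S)"
    by (simp only: L_def R_def A_def w_def k_def)
qed

section \<open>Uniqueness of weak derivatives\<close>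

text \<open>Completeness of Lebesgue measure: a set that agrees almost everywhere with a measurable
  one is measurable. It transfers measurability to the representatives chosen by
  \<open>Dv\<close>.\<close>

lemma borel_measurable_lebesgue_on_AE:
  fixes f g :: "real^'d::finite \<Rightarrow> real"
  assumes S: "S \<in> sets lebesgue" and f: "f \<in> borel_measurable (lebesgue_on S)"
    and eq: "AE x in lebesgue_on S. f x = g x"
  shows "g \<in> borel_measurable (lebesgue_on S)"
proof (rule measurableI)
  fix A :: "real set" assume A: "A \<in> sets borel"
  have fA: "f -` A \<inter> S \<in> sets lebesgue"
    using measurable_sets[OF f A] S by (simp add: sets_restrict_space_iff)
  have "AE x in lebesgue. x \<in> S \<longrightarrow> f x = g x"
    using eq S by (simp add: AE_restrict_space_iff)
  then have "AE x in lebesgue. x \<in> f -` A \<inter> S \<longleftrightarrow> x \<in> g -` A \<inter> S"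
    by eventually_elim auto
  then have "g -` A \<inter> S \<in> sets lebesgue"
    by (rule completion.in_sets_AE[OF _ fA]) simp
  then show "g -` A \<inter> space (lebesgue_on S) \<in> sets (lebesgue_on S)"
    using S by (simp add: sets_restrict_space_iff)
qed simp

lemma integrable_lebesgue_on_subset:
  fixes f :: "real^'d::finite \<Rightarrow> real"
  assumes f: "integrable (lebesgue_on S) f" and "S \<in> sets lebesgue" "K \<in> sets lebesgue" "K \<subseteq> S"
  shows "integrable (lebesgue_on K) f"
proof -
  have "integrable lebesgue (\<lambda>x. if x \<in> S then f x else 0)"
    using f Lebesgue_Measure.integrable_restrict_UNIV[OF assms(2), of f] by simp
  from integrable_mult_indicator[OF _ this, of K]
  have "integrable lebesgue (\<lambda>x. indicator K x *\<^sub>R (if x \<in> S then f x else 0))" using assms(3) by simp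
  moreover have "(\<lambda>x. indicator K x *\<^sub>R (if x \<in> S then f x else 0)) = (\<lambda>x. if x \<in> K then f x else 0)"
    using assms(4) by (auto simp: fun_eq_iff indicator_def)
  ultimately show ?thesis using Lebesgue_Measure.integrable_restrict_UNIV[OF assms(3), of f] by simp
qed

text \<open>On a closed box inside \<open>S\<close> all integrals over subboxes vanish, so Lebesgue
  differentiation gives \<open>h = 0\<close> off a negligible set; countably many such boxes exhaust
  \<open>S\<close>.\<close>

lemma AE_zero_if_integrals_zero:
  fixes h :: "real^'d::finite \<Rightarrow> real"
  assumes S: "open S" and i: "\<And>K. compact K \<Longrightarrow> K \<subseteq> S \<Longrightarrow> integrable (lebesgue_on K) h"
    and z: "\<And>K. compact K \<Longrightarrow> K \<subseteq> S \<Longrightarrow> (\<integral>x. h x \<partial>lebesgue_on K) = 0"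
  shows "AE x in lebesgue_on S. h x = 0"
proof -
  have box: "AE x in lebesgue. x \<in> B \<longrightarrow> h x = 0" if B: "B = cbox a b" "B \<subseteq> S" for B a b
  proof -
    define h1 where "h1 x = (if x \<in> B then h x else 0)" for x
    have cB: "compact B" using B by simp
    have "integrable lebesgue h1"
      unfolding h1_def Lebesgue_Measure.integrable_restrict_UNIV[OF lebesgue_compact[OF cB]]
      by (rule i[OF cB B(2)])
    then have "h1 integrable_on UNIV" by (rule integrable_on_lebesgue)
    then have hk: "h1 integrable_on cbox c d" for c d by (rule integrable_on_subcbox) simp
    have h0: "integral (cbox c d) h1 = 0" for c d
    proof -
      have c: "compact (B \<inter> cbox c d)" "B \<inter> cbox c d \<subseteq> S" using cB B(2) by (auto intro: compact_Int)
      have "integral (cbox c d) h1 = integral (B \<inter> cbox c d) h"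
        unfolding h1_def by (rule Henstock_Kurzweil_Integration.integral_restrict_Int)
      also have "\<dots> = (\<integral>x. h x \<partial>lebesgue_on (B \<inter> cbox c d))"
        by (rule lebesgue_integral_eq_integral[OF i[OF c] lebesgue_compact[OF c(1)], symmetric])
      finally show ?thesis using z[OF c] by simp
    qed
    obtain N where N: "negligible N" "\<forall>x e. x \<notin> N \<longrightarrow> 0 < e \<longrightarrow> (\<exists>d>0. \<forall>t. 0 < t \<and> t < d \<longrightarrow>
       norm (integral (cbox x (x + t *\<^sub>R One)) h1 /\<^sub>R t ^ DIM(real^'d) - h1 x) < e)"
    proof (rule integrable_ccontinuous_explicit[OF hk])
      fix N
      assume "negligible N" and N: "\<And>x e. x \<notin> N \<Longrightarrow> 0 < e \<Longrightarrow> \<exists>d>0. \<forall>t. 0 < t \<and> t < d \<longrightarrow>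
       norm (integral (cbox x (x + t *\<^sub>R One)) h1 /\<^sub>R t ^ DIM(real^'d) - h1 x) < e"
      show thesis by (rule that[OF \<open>negligible N\<close>]) (intro allI impI N)
    qed
    have h10: "h1 x = 0" if "x \<notin> N" for x
    proof (rule ccontr)
      assume "h1 x \<noteq> 0"
      then have "0 < \<bar>h1 x\<bar>" by simp
      from N(2)[rule_format, OF that this] obtain d where d: "d > 0" "\<forall>t. 0 < t \<and> t < d \<longrightarrow>
        norm (integral (cbox x (x + t *\<^sub>R One)) h1 /\<^sub>R t ^ DIM(real^'d) - h1 x) < \<bar>h1 x\<bar>" by blast
      \<comment> \<open>Off the negligible set, averages over small cubes come arbitrarily close to
        \<open>h1 x\<close>. They are all 0, so closeness below \<open>\<bar>h1 x\<bar>\<close> is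
        absurd.\<close>
      have "norm (integral (cbox x (x + (d/2) *\<^sub>R One)) h1 /\<^sub>R (d/2) ^ DIM(real^'d) - h1 x) < \<bar>h1 x\<bar>"
        by (rule d(2)[rule_format]) (use d(1) in simp)
      then show False by (simp add: h0)
    qed
    have "AE x in lebesgue. x \<notin> N" by (rule AE_not_in[OF N(1)[unfolded negligible_iff_null_sets]])
    then show ?thesis
    proof eventually_elim
      case (elim x)
      have "h1 x = h x" if "x \<in> B" using that by (simp add: h1_def)
      then show ?case using h10[OF elim] by simp
    qed
  qed
  obtain D where D: "countable D" "D \<subseteq> Pow S" "\<And>X. X \<in> D \<Longrightarrow> \<exists>a b. X = cbox a b" "\<Union>D = S"
    using open_countable_Union_open_cbox[OF S] by metis
  have "AE x in lebesgue. \<forall>B\<in>D. x \<in> B \<longrightarrow> h x = 0"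
    unfolding AE_ball_countable[OF D(1)]
  proof
    fix B assume B: "B \<in> D"
    then obtain a b where ab: "B = cbox a b" using D(3) by blast
    show "AE x in lebesgue. x \<in> B \<longrightarrow> h x = 0"
      by (rule box[OF ab]) (use B D(2) in blast)
  qed
  then have "AE x in lebesgue. x \<in> S \<longrightarrow> h x = 0"
  proof eventually_elim
    case (elim x)
    then show ?case using D(4) by blast
  qed
  then show ?thesis using lebesgue_open[OF S] by (simp add: AE_restrict_space_iff)
qed

text \<open>The fundamental lemma of the calculus of variations. Smooth tests are first replaced by
  continuous ones of compact support, and these decrease to the indicator of a compact set
  \<open>K\<close>, so that the integral of \<open>h\<close> over \<open>K\<close> is 0.\<close>

lemma AE_zero_if_tests_zero:
  fixes h :: "real^'d::finite \<Rightarrow> real"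
  assumes \<eta>: "cutoff_eta \<eta>" and S: "open S" and h: "L1loc_w S (\<lambda>_. 1) h"
    and t: "\<And>\<phi>. test_fun S \<phi> \<Longrightarrow> (\<integral>x. \<phi> x * h x \<partial>lebesgue_on S) = 0"
  shows "AE x in lebesgue_on S. h x = 0"
proof (rule AE_zero_if_integrals_zero[OF S])
  have ih: "integrable (lebesgue_on K) h" if "compact K" "K \<subseteq> S" for K
    using h that by (simp add: L1loc_w_def)
  then show "integrable (lebesgue_on K) h" if "compact K" "K \<subseteq> S" for K using that by blast
  \<comment> \<open>Reading \<open>h\<close> as an order-zero weak derivative of the zero function,
    with weight 1, lets \<open>wderiv_Ck_test\<close> supply the passage from smooth to continuous
    test functions.\<close>
  have wd: "is_wderiv_v S (\<lambda>_. 1) (\<lambda>_. 0) (\<lambda>_. 0) h"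
    using h t by (simp add: is_wderiv_v_def)
  have zero: "L1loc_w S (\<lambda>_. 1) (\<lambda>_. 0)" by (simp add: L1loc_w_def)
  have cont: "integrable (lebesgue_on S) (\<lambda>x. \<phi> x * h x) \<and> (\<integral>x. \<phi> x * h x \<partial>lebesgue_on S) = 0"
    if "continuous_on UNIV \<phi>" "compact K" "K \<subseteq> S" "\<forall>x. x \<notin> K \<longrightarrow> \<phi> x = 0" for \<phi> K
  proof -
    have \<phi>: "cdiff (msize (\<lambda>_::'d. 0)) UNIV \<phi>" using that(1) by simp
    show ?thesis
      using wderiv_Ck_test(2,3)[OF \<eta> S cdiff_const zero wd \<phi> that(2,3,4)] by simp
  qed
  fix K assume K: "compact K" "K \<subseteq> S"
  show "(\<integral>x. h x \<partial>lebesgue_on K) = 0"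
  proof (cases "K = {}")
    case False
    obtain e where e: "e > 0" "(\<Union>x\<in>K. ball x e) \<subseteq> S"
      using compact_subset_open_imp_ball_epsilon_subset[OF K(1) S K(2)] by blast
    define r where "r = e / 2"
    have r: "r > 0" "r < e" using e(1) by (auto simp: r_def)
    define K1 where "K1 = {x. infdist x K \<le> r}"
    have K1: "compact K1" unfolding K1_def by (rule compact_infdist_le[OF False K(1) r(1)])
    have K1S: "K1 \<subseteq> S"
    proof
      fix x assume "x \<in> K1"
      obtain y where y: "y \<in> K" "infdist x K = dist x y"
        using infdist_attains_inf[OF compact_imp_closed[OF K(1)] False] by blast
      then have "x \<in> ball y e" using \<open>x \<in> K1\<close> r(2) by (simp add: K1_def dist_commute)
      then show "x \<in> S" using e(2) y(1) by blast
    qed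
    \<comment> \<open>The slope offset \<open>J\<close> exceeds \<open>1 / r\<close>, so every
      \<open>\<phi> j\<close> vanishes at distance more than \<open>r\<close> from \<open>K\<close>
      and all supports lie in the single compact set \<open>K1\<close>.\<close>
    obtain J :: nat where J: "1 / r < real J" using reals_Archimedean2 by blast
    define \<phi> where "\<phi> j x = max 0 (1 - real (j + J) * infdist x K)" for j x
    have c\<phi>: "continuous_on UNIV (\<phi> j)" for j
      unfolding \<phi>_def by (intro continuous_intros)
    have s\<phi>: "\<phi> j x = 0" if "x \<notin> K1" for j x
    proof -
      have "infdist x K > r" using that by (simp add: K1_def)
      then have "1 < real J * infdist x K" using J r(1)
        by (smt (verit, best) divide_less_eq mult_less_cancel_left_pos mult.commute of_nat_0_le_iff zero_less_divide_1_iff)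
      also have "\<dots> \<le> real (j + J) * infdist x K" by (intro mult_right_mono infdist_nonneg) simp
      finally show ?thesis by (simp add: \<phi>_def)
    qed
    have b\<phi>: "\<bar>\<phi> j x\<bar> \<le> 1" for j x
      using mult_nonneg_nonneg[OF of_nat_0_le_iff infdist_nonneg, of "j + J" x K] by (simp add: \<phi>_def)
    have F: "integrable (lebesgue_on S) (\<lambda>x. \<phi> j x * h x)" "(\<integral>x. \<phi> j x * h x \<partial>lebesgue_on S) = 0" for j
      using cont[OF c\<phi> K1 K1S, of j] s\<phi> by blast+
    have OL: "S \<in> sets lebesgue" and KL: "K \<in> sets lebesgue" and K1L: "K1 \<in> sets lebesgue"
      using lebesgue_open[OF S] lebesgue_compact[OF K(1)] lebesgue_compact[OF K1] .
    \<comment> \<open>Dominated convergence with majorant \<open>\<bar>h\<bar>\<close> on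
      \<open>K1\<close>: \<open>\<phi> j\<close> is 1 on \<open>K\<close>, and at any point at
      positive distance from \<open>K\<close> it is eventually 0.\<close>
    have "(\<lambda>j. \<integral>x. \<phi> j x * h x \<partial>lebesgue_on S) \<longlonglongrightarrow> (\<integral>x. (if x \<in> K then h x else 0) \<partial>lebesgue_on S)"
    proof (rule integral_dominated_convergence)
      have iK: "integrable lebesgue (\<lambda>x. if x \<in> K then h x else 0)"
        unfolding Lebesgue_Measure.integrable_restrict_UNIV[OF KL] by (rule ih[OF K])
      have "integrable (lebesgue_on S) (\<lambda>x. if x \<in> K then h x else 0)"
        by (rule integrable_lebesgue_on_subset[where S = UNIV]) (use iK OL in \<open>simp_all add: lebesgue_on_UNIV_eq\<close>)
      then show "(\<lambda>x. if x \<in> K then h x else 0) \<in> borel_measurable (lebesgue_on S)"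
        by (rule borel_measurable_integrable)
      show "(\<lambda>x. \<phi> j x * h x) \<in> borel_measurable (lebesgue_on S)" for j
        by (rule borel_measurable_integrable[OF F(1)])
      have iK1: "integrable lebesgue (\<lambda>x. if x \<in> K1 then \<bar>h x\<bar> else 0)"
        unfolding Lebesgue_Measure.integrable_restrict_UNIV[OF K1L] using ih[OF K1 K1S] by simp
      show "integrable (lebesgue_on S) (\<lambda>x. if x \<in> K1 then \<bar>h x\<bar> else 0)"
        by (rule integrable_lebesgue_on_subset[where S = UNIV]) (use iK1 OL in \<open>simp_all add: lebesgue_on_UNIV_eq\<close>)
      show "AE x in lebesgue_on S. norm (\<phi> j x * h x) \<le> (if x \<in> K1 then \<bar>h x\<bar> else 0)" for j
      proof (rule AE_I2)
        fix x
        show "norm (\<phi> j x * h x) \<le> (if x \<in> K1 then \<bar>h x\<bar> else 0)"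
          using mult_right_mono[OF b\<phi>[of j x], of "\<bar>h x\<bar>"] s\<phi>[of x j] by (simp add: abs_mult)
      qed
      show "AE x in lebesgue_on S. (\<lambda>j. \<phi> j x * h x) \<longlonglongrightarrow> (if x \<in> K then h x else 0)"
      proof (rule AE_I2)
        fix x
        show "(\<lambda>j. \<phi> j x * h x) \<longlonglongrightarrow> (if x \<in> K then h x else 0)"
        proof (cases "x \<in> K")
          case True
          then have "\<phi> j x = 1" for j by (simp add: \<phi>_def)
          then show ?thesis using True by simp
        next
          case nK: False
          then have pos: "infdist x K > 0"
            using in_closed_iff_infdist_zero[OF compact_imp_closed[OF K(1)] False, of x] infdist_nonneg[of x K]
            by linarith
          obtain j0 :: nat where j0: "1 / infdist x K < real j0" using reals_Archimedean2 by blast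
          have "\<phi> j x = 0" if "j \<ge> j0" for j
          proof -
            have "1 < real j0 * infdist x K" using j0 pos by (simp add: field_simps)
            also have "\<dots> \<le> real (j + J) * infdist x K" using that by (intro mult_right_mono infdist_nonneg) simp
            finally show ?thesis by (simp add: \<phi>_def)
          qed
          then have "\<forall>\<^sub>F j in sequentially. \<phi> j x * h x = 0"
            by (intro eventually_sequentiallyI[of j0]) simp
          then show ?thesis using nK by (simp add: tendsto_eventually)
        qed
      qed
    qed
    then have "(\<integral>x. (if x \<in> K then h x else 0) \<partial>lebesgue_on S) = 0"
      unfolding F(2) by (simp add: LIMSEQ_const_iff)
    then show ?thesis
      using Lebesgue_Measure.integral_restrict[OF K(2) KL OL, of h] by simp
  qed simp
qed

lemma is_wderiv_v_L1loc:
  "is_wderiv_v S v \<alpha> f g \<Longrightarrow> L1loc_w S (\<lambda>x. v x ^ (msize \<alpha> + 1)) g"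
  unfolding is_wderiv_v_def by (rule conjunct1)

lemma is_wderiv_v_test:
  "is_wderiv_v S v \<alpha> f g \<Longrightarrow> test_fun S \<phi> \<Longrightarrow>
    (\<integral>x. f x * cpartial \<alpha> (\<lambda>y. v y ^ (msize \<alpha> + 1) * \<phi> y) x \<partial>lebesgue_on S)
        = (-1) ^ msize \<alpha> * (\<integral>x. v x ^ (msize \<alpha> + 1) * \<phi> x * g x \<partial>lebesgue_on S)"
  unfolding is_wderiv_v_def by (elim conjE allE impE)

text \<open>The defining identity determines only the product of the derivative with the power of
  \<open>v\<close>; since \<open>v\<close> is nonzero almost everywhere, this power can be divided
  out.\<close>

lemma wderiv_unique:
  fixes f :: "real^'d::finite \<Rightarrow> real"
  assumes \<eta>: "cutoff_eta \<eta>" and S: "open S" and v: "AE x in lebesgue_on S. v x \<noteq> 0"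
    and g: "is_wderiv_v S v \<alpha> f g1" "is_wderiv_v S v \<alpha> f g2"
  shows "AE x in lebesgue_on S. g1 x = g2 x"
proof -
  define w where "w x = v x ^ (msize \<alpha> + 1)" for x
  have g1: "L1loc_w S w g1" and g2: "L1loc_w S w g2"
    unfolding w_def[abs_def] by (rule is_wderiv_v_L1loc[OF g(1)], rule is_wderiv_v_L1loc[OF g(2)])
  have "AE x in lebesgue_on S. w x * (g1 x - g2 x) = 0"
  proof (rule AE_zero_if_tests_zero[OF \<eta> S])
    have d: "integrable (lebesgue_on K) (\<lambda>x. g1 x * w x - g2 x * w x)" if "compact K" "K \<subseteq> S" for K
      by (rule Bochner_Integration.integrable_diff[OF g1[unfolded L1loc_w_def, rule_format]
            g2[unfolded L1loc_w_def, rule_format]]) (simp_all add: that)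
    have "g1 x * w x - g2 x * w x = w x * (g1 x - g2 x) * 1" for x
      by (simp add: right_diff_distrib mult.commute)
    then show "L1loc_w S (\<lambda>_. 1) (\<lambda>x. w x * (g1 x - g2 x))"
      using d unfolding L1loc_w_def by (simp only: simp_thms) blast
    fix \<phi> assume \<phi>: "test_fun S \<phi>"
    define K where "K = closure {x. \<phi> x \<noteq> 0}"
    have K: "compact K" "K \<subseteq> S" using \<phi> unfolding test_fun_def K_def by blast+
    have "{x. \<phi> x \<noteq> 0} \<subseteq> K" unfolding K_def by (rule closure_subset)
    then have supp: "\<forall>x. x \<notin> K \<longrightarrow> \<phi> x = 0" by blast
    have "Ck_on 0 UNIV \<phi>" using \<phi> unfolding test_fun_def by blast
    then have c: "continuous_on UNIV \<phi>" unfolding Ck_on_iff_cdiff[OF open_UNIV] by (rule cdiff_cont)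
    have "cdiff 0 UNIV \<phi>" using c by simp
    from partials_bounded_compact[OF K(1) subset_UNIV this]
    obtain e where "partials_bounded 0 K e \<phi>" by blast
    then have e: "\<forall>x\<in>K. \<bar>\<phi> x\<bar> \<le> e" by simp
    have i: "integrable (lebesgue_on S) (\<lambda>x. w x * \<phi> x * g x)" if g: "L1loc_w S w g" for g
    proof -
      obtain C where "C \<ge> 0" and C: "\<And>\<phi> e. continuous_on UNIV \<phi> \<Longrightarrow> \<forall>x. x \<notin> K \<longrightarrow> \<phi> x = 0 \<Longrightarrow> \<forall>x\<in>K. \<bar>\<phi> x\<bar> \<le> e \<Longrightarrow>
        integrable (lebesgue_on S) (\<lambda>x. w x * \<phi> x * g x) \<and> \<bar>\<integral>x. w x * \<phi> x * g x \<partial>lebesgue_on S\<bar> \<le> C * e"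
        using wderiv_rhs_bound[OF S g K] by blast
      from C[OF c supp e] show ?thesis ..
    qed
    have "(-1) ^ msize \<alpha> * (\<integral>x. w x * \<phi> x * g1 x \<partial>lebesgue_on S) = (-1) ^ msize \<alpha> * (\<integral>x. w x * \<phi> x * g2 x \<partial>lebesgue_on S)"
      unfolding w_def is_wderiv_v_test[OF g(1) \<phi>, symmetric] is_wderiv_v_test[OF g(2) \<phi>, symmetric] by (rule refl)
    moreover have "(-1) ^ msize \<alpha> \<noteq> (0::real)" by simp
    ultimately have "(\<integral>x. w x * \<phi> x * g1 x \<partial>lebesgue_on S) = (\<integral>x. w x * \<phi> x * g2 x \<partial>lebesgue_on S)"
      unfolding mult_cancel_left by blast
    then have "(\<integral>x. w x * \<phi> x * g1 x - w x * \<phi> x * g2 x \<partial>lebesgue_on S) = 0"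
      unfolding Bochner_Integration.integral_diff[OF i[OF g1] i[OF g2]] by (rule right_minus_eq[THEN iffD2])
    moreover have "(\<lambda>x. \<phi> x * (w x * (g1 x - g2 x))) = (\<lambda>x. w x * \<phi> x * g1 x - w x * \<phi> x * g2 x)"
      by (rule ext) (simp add: right_diff_distrib mult_ac)
    ultimately show "(\<integral>x. \<phi> x * (w x * (g1 x - g2 x)) \<partial>lebesgue_on S) = 0"
      by (simp only:)
  qed
  with v show ?thesis
  proof eventually_elim
    case (elim x)
    then show ?case by (simp add: w_def)
  qed
qed

section \<open>Estimates in L^p\<close>

lemma sum_powr_le:
  fixes t :: "'b \<Rightarrow> real"
  assumes B: "finite B" and t: "\<And>b. b \<in> B \<Longrightarrow> 0 \<le> t b" and p: "0 \<le> p"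
  shows "(\<Sum>b\<in>B. t b) powr p \<le> real (card B) powr p * (\<Sum>b\<in>B. t b powr p)"
proof (cases "B = {}")
  case False
  \<comment> \<open>Bounding the sum by \<open>card B\<close> times its largest term replaces a
    convexity argument and produces the constant \<open>card B powr p\<close>.\<close>
  define M where "M = Max (t ` B)"
  have M: "M \<in> t ` B" unfolding M_def using B False by simp
  then obtain b0 where b0: "b0 \<in> B" "M = t b0" by blast
  have le: "t b \<le> M" if "b \<in> B" for b unfolding M_def using B that by simp
  have "(\<Sum>b\<in>B. t b) \<le> real (card B) * M" using sum_bounded_above[of B t M] le by simp
  then have "(\<Sum>b\<in>B. t b) powr p \<le> (real (card B) * M) powr p"
    using t p by (intro powr_mono2) (auto intro: sum_nonneg)
  also have "\<dots> = real (card B) powr p * M powr p"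
    using t b0 by (simp add: powr_mult)
  also have "M powr p \<le> (\<Sum>b\<in>B. t b powr p)"
    unfolding b0(2) using b0(1) B by (intro member_le_sum) auto
  finally show ?thesis by (simp add: mult_left_mono)
qed simp

lemma Lp_dominated:
  fixes G :: "'b \<Rightarrow> 'a \<Rightarrow> real"
  assumes B: "finite B" and p: "1 \<le> p" and c: "0 \<le> c"
    and G: "\<And>b. b \<in> B \<Longrightarrow> integrable M (\<lambda>x. \<bar>G b x\<bar> powr p)"
    and F: "F \<in> borel_measurable M" and le: "AE x in M. \<bar>F x\<bar> \<le> c * (\<Sum>b\<in>B. \<bar>G b x\<bar>)"
  shows "integrable M (\<lambda>x. \<bar>F x\<bar> powr p)"
    and "(\<integral>x. \<bar>F x\<bar> powr p \<partial>M) \<le> (c * real (card B)) powr p * (\<Sum>b\<in>B. \<integral>x. \<bar>G b x\<bar> powr p \<partial>M)"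
proof -
  let ?R = "\<lambda>x. (c * real (card B)) powr p * (\<Sum>b\<in>B. \<bar>G b x\<bar> powr p)"
  have bound: "AE x in M. \<bar>F x\<bar> powr p \<le> ?R x"
    using le
  proof eventually_elim
    case (elim x)
    have "\<bar>F x\<bar> powr p \<le> (c * (\<Sum>b\<in>B. \<bar>G b x\<bar>)) powr p" using elim p by (intro powr_mono2) auto
    also have "\<dots> = c powr p * (\<Sum>b\<in>B. \<bar>G b x\<bar>) powr p" using c by (simp add: powr_mult sum_nonneg)
    also have "\<dots> \<le> c powr p * (real (card B) powr p * (\<Sum>b\<in>B. \<bar>G b x\<bar> powr p))"
      using B p by (intro mult_left_mono sum_powr_le) auto
    also have "\<dots> = ?R x" using c by (simp add: powr_mult mult.assoc)
    finally show ?case .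
  qed
  have iR: "integrable M ?R" using G by (intro integrable_mult_right Bochner_Integration.integrable_sum)
  have m: "(\<lambda>x. \<bar>F x\<bar> powr p) \<in> borel_measurable M" using F by measurable
  show i: "integrable M (\<lambda>x. \<bar>F x\<bar> powr p)"
    by (rule Bochner_Integration.integrable_bound[OF iR m]) (use bound in eventually_elim, simp)
  have "(\<integral>x. \<bar>F x\<bar> powr p \<partial>M) \<le> (\<integral>x. ?R x \<partial>M)" by (rule integral_mono_AE[OF i iR bound])
  also have "\<dots> = (c * real (card B)) powr p * (\<Sum>b\<in>B. \<integral>x. \<bar>G b x\<bar> powr p \<partial>M)"
    using G by (simp add: Bochner_Integration.integral_sum)
  finally show "(\<integral>x. \<bar>F x\<bar> powr p \<partial>M) \<le> (c * real (card B)) powr p * (\<Sum>b\<in>B. \<integral>x. \<bar>G b x\<bar> powr p \<partial>M)" .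
qed

text \<open>On a compact set, which has finite measure, \<open>1 + \<bar>F x\<bar> powr p\<close> is
  an integrable majorant of \<open>\<bar>F x\<bar>\<close>.\<close>

lemma Lp_imp_L1loc:
  fixes F :: "real^'d::finite \<Rightarrow> real"
  assumes S: "open S" and p: "1 \<le> p" and F: "F \<in> borel_measurable (lebesgue_on S)"
    "integrable (lebesgue_on S) (\<lambda>x. \<bar>F x\<bar> powr p)" and K: "compact K" "K \<subseteq> S"
  shows "integrable (lebesgue_on K) F"
proof -
  note OL = lebesgue_open[OF S] and KL = lebesgue_compact[OF K(1)]
  have "integrable (lebesgue_on K) (\<lambda>x. \<bar>F x\<bar> powr p)" by (rule integrable_lebesgue_on_subset[OF F(2) OL KL K(2)])
  moreover have "integrable (lebesgue_on K) (\<lambda>_. 1 :: real)"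
    by (rule finite_measure.integrable_const[OF finite_measure_lebesgue_on[OF lmeasurable_compact[OF K(1)]]])
  ultimately have i: "integrable (lebesgue_on K) (\<lambda>x. 1 + \<bar>F x\<bar> powr p)" by simp
  have "lebesgue_on K = restrict_space (lebesgue_on S) K"
    using restrict_restrict_space[of S lebesgue K] OL KL K(2) by (simp add: Int_absorb1)
  then have m: "F \<in> borel_measurable (lebesgue_on K)" using measurable_restrict_space1[OF F(1), of K] by simp
  show ?thesis
  proof (rule Bochner_Integration.integrable_bound[OF i m], rule AE_I2)
    fix x
    have "\<bar>F x\<bar> \<le> 1 + \<bar>F x\<bar> powr p"
    proof (cases "\<bar>F x\<bar> \<le> 1")
      case True then show ?thesis using powr_ge_zero[of "\<bar>F x\<bar>" p] by linarith
    next
      case False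
      then have "\<bar>F x\<bar> powr 1 \<le> \<bar>F x\<bar> powr p" using p by (intro powr_mono) auto
      then show ?thesis using False by simp
    qed
    then show "norm (F x) \<le> norm (1 + \<bar>F x\<bar> powr p)" by simp
  qed
qed

section \<open>The cut-off functions\<close>

text \<open>A derivative relative to a nondegenerate interval is unique even at its endpoints, so
  constancy on one side of \<open>t\<close> suffices.\<close>

lemma deriv_eq_0_on_interval:
  fixes F :: "real \<Rightarrow> real"
  assumes F: "F differentiable (at t)" and ab: "a < b" "t \<in> {a..b}" and c: "\<And>x. x \<in> {a..b} \<Longrightarrow> F x = q"
  shows "deriv F t = 0"
proof -
  have "(F has_field_derivative deriv F t) (at t)" using F by (simp add: DERIV_deriv_iff_real_differentiable)
  then have 1: "(F has_field_derivative deriv F t) (at t within {a..b})" by (rule has_field_derivative_at_within)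
  have "((\<lambda>_. q) has_field_derivative 0) (at t within {a..b})" by simp
  then have 2: "(F has_field_derivative 0) (at t within {a..b})"
    by (rule has_field_derivative_transform_within[where d = 1]) (use ab(2) in \<open>simp_all add: c\<close>)
  have "at t within {a..b} \<noteq> bot" using ab by (simp add: trivial_limit_within)
  from has_field_derivative_unique[OF 1 2 this] show ?thesis .
qed

text \<open>At |t| = 1/2 constancy is known on the inner side only, which is enough for a one-sided
  argument. The half-open shape 1/2 < |t| \<le> 1 matches
  \<open>Mset \<Omega> v n - Mset \<Omega> v (2*n)\<close>. Two constants are allowed because \<eta>
  is 0 inside and 1 outside.\<close>

lemma deriv_vanishes_off_annulus:
  fixes F :: "real \<Rightarrow> real"
  assumes F: "\<And>t. F differentiable (at t)" and q: "\<And>t. \<bar>t\<bar> \<le> 1/2 \<Longrightarrow> F t = q" "\<And>t. 1 < \<bar>t\<bar> \<Longrightarrow> F t = q'"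
    and t: "\<not> (1/2 < \<bar>t\<bar> \<and> \<bar>t\<bar> \<le> 1)"
  shows "deriv F t = 0"
proof -
  consider "\<bar>t\<bar> \<le> 1/2" | "t > 1" | "t < -1" using t by linarith
  then show ?thesis
  proof cases
    case 1
    show ?thesis by (rule deriv_eq_0_on_interval[OF F, of "-1/2" "1/2" t q]) (use 1 q(1) in auto)
  next
    case 2
    show ?thesis by (rule deriv_eq_0_on_interval[OF F, of t "t+1" t q']) (use 2 q(2) in auto)
  next
    case 3
    show ?thesis by (rule deriv_eq_0_on_interval[OF F, of "t-1" t t q']) (use 3 q(2) in auto)
  qed
qed

lemma partials_bounded_mono: "partials_bounded k A c g \<Longrightarrow> l \<le> k \<Longrightarrow> partials_bounded l A c g"
  by (induction k) (auto simp: le_Suc_eq dest: partials_bounded_lower simp del: partials_bounded.simps(2))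

lemma partials_bounded_const: "\<bar>q\<bar> \<le> c \<Longrightarrow> partials_bounded k (A :: (real^'d::finite) set) c (\<lambda>_. q)"
proof (induction k arbitrary: q)
  case (Suc k)
  have "partial1 i (\<lambda>_. q) = (\<lambda>_. 0)" for i :: 'd
    using partial1_eqI[OF has_partial_const[of i q]] by blast
  moreover have "\<bar>0::real\<bar> \<le> c" using Suc.prems by linarith
  ultimately show ?case using Suc.IH[of 0] Suc.prems by simp
qed simp

text \<open>Products of the form \<open>G (c * v x) * h x\<close> are closed under differentiation
  up to sums, so the induction keeps \<open>G\<close> and \<open>h\<close> general. As
  \<open>G\<close> vanishes off the annulus, bounds on \<open>v\<close> and \<open>h\<close> over
  \<open>A\<close> alone control the product on all of \<Omega>.\<close>

lemma cpartial_compose_mult_bounded: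
  fixes v :: "real^'d::finite \<Rightarrow> real"
  assumes \<Omega>: "open \<Omega>" and A: "A = {x\<in>\<Omega>. 1/2 < \<bar>c * v x\<bar> \<and> \<bar>c * v x\<bar> \<le> 1}"
    and v: "cdiff k0 \<Omega> v" and bv: "partials_bounded k0 A Cv v"
  shows "(\<And>l t. (deriv ^^ l) G differentiable (at t)) \<Longrightarrow> \<forall>t. \<not> (1/2 < \<bar>t\<bar> \<and> \<bar>t\<bar> \<le> 1) \<longrightarrow> G t = 0 \<Longrightarrow>
    cdiff k \<Omega> h \<Longrightarrow> partials_bounded k A Ch h \<Longrightarrow> k \<le> k0 \<Longrightarrow> msize \<gamma> \<le> k \<Longrightarrow>
    \<exists>D. \<forall>x\<in>\<Omega>. \<bar>cpartial \<gamma> (\<lambda>x. G (c * v x) * h x) x\<bar> \<le> D"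
proof (induction \<gamma> arbitrary: G h k Ch rule: mindex_induct)
  case zero
  have "G differentiable (at t)" for t using zero.prems(1)[of 0 t] by simp
  then have "continuous_on {-1..1} G"
    by (intro continuous_at_imp_continuous_on) (simp add: differentiable_imp_continuous_within)
  then have "bounded (G ` {-1..1})" by (intro compact_imp_bounded compact_continuous_image) auto
  then obtain B where B: "\<forall>t\<in>{-1..1}. \<bar>G t\<bar> \<le> B" unfolding bounded_iff by auto
  have "\<bar>G (c * v x) * h x\<bar> \<le> \<bar>B\<bar> * \<bar>Ch\<bar>" if "x \<in> \<Omega>" for x
  proof (cases "x \<in> A")
    case True
    then have "\<bar>G (c * v x)\<bar> \<le> \<bar>B\<bar>" using B[rule_format, of "c * v x"] by (simp add: A abs_le_iff)
    moreover have "\<bar>h x\<bar> \<le> \<bar>Ch\<bar>" using partials_boundedD[OF zero.prems(4) True] by linarith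
    ultimately show ?thesis unfolding abs_mult by (intro mult_mono) auto
  next
    case False
    then have "G (c * v x) = 0" using zero.prems(2) that by (simp add: A)
    then show ?thesis by simp
  qed
  then show ?case by (intro exI[of _ "\<bar>B\<bar> * \<bar>Ch\<bar>"]) simp
next
  case (step \<gamma> j)
  have "Suc (msize \<gamma>) \<le> k" using step.prems(6) by (simp only: msize_mshift)
  then obtain l where k: "k = Suc l" using Suc_le_D by blast
  have le: "msize \<gamma> \<le> l" "l \<le> k0" "Suc l \<le> k0" using \<open>Suc (msize \<gamma>) \<le> k\<close> step.prems(5) k by auto
  note h = step.prems(3)[unfolded k] and bh = step.prems(4)[unfolded k]
  have vl: "cdiff (Suc l) \<Omega> v" by (rule cdiff_mono[OF v le(3)])
  have bvl: "partials_bounded (Suc l) A Cv v" by (rule partials_bounded_mono[OF bv le(3)])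
  have AO: "A \<subseteq> \<Omega>" by (auto simp: A)
  have dG: "G differentiable (at t)" for t using step.prems(1)[of 0 t] by simp
  have dG': "(deriv ^^ i) (deriv G) differentiable (at t)" for i t
    using step.prems(1)[of "Suc i" t] by (simp add: funpow_Suc_right del: funpow.simps)
  have G0: "deriv G t = 0" if "\<not> (1/2 < \<bar>t\<bar> \<and> \<bar>t\<bar> \<le> 1)" for t
    by (rule deriv_vanishes_off_annulus[OF dG _ _ that, of 0 0]) (use step.prems(2) in auto)
  \<comment> \<open>\<open>h1\<close> absorbs the inner derivative from the chain rule, so that
    \<open>deriv G (c * v x) * h1 x\<close> has the same form again, with one order of
    differentiability less.\<close>
  define h1 where "h1 x = (c * partial1 j v x) * h x" for x
  have cv: "cdiff l \<Omega> (\<lambda>x. c * partial1 j v x)" by (rule cdiff_cmult[OF \<Omega> cdiff_Suc_partial[OF vl]])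
  have h1: "cdiff l \<Omega> h1" unfolding h1_def by (rule cdiff_mult[OF \<Omega> cv cdiff_lower[OF h]])
  have bcv: "partials_bounded l A (2 ^ l * (\<bar>c\<bar> * Cv)) (\<lambda>x. c * partial1 j v x)"
    by (rule partials_bounded_mult[OF \<Omega> AO cdiff_const cdiff_Suc_partial[OF vl]
          partials_bounded_const partials_bounded_partial1[OF bvl]]) simp
  have bh1: "partials_bounded l A (2 ^ l * (2 ^ l * (\<bar>c\<bar> * Cv) * Ch)) h1" unfolding h1_def
    by (rule partials_bounded_mult[OF \<Omega> AO cv cdiff_lower[OF h] bcv partials_bounded_lower[OF bh]])
  obtain D1 where D1: "\<forall>x\<in>\<Omega>. \<bar>cpartial \<gamma> (\<lambda>x. deriv G (c * v x) * h1 x) x\<bar> \<le> D1"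
    using step.IH[OF dG' _ h1 bh1 le(2,1)] G0 by blast
  obtain D2 where D2: "\<forall>x\<in>\<Omega>. \<bar>cpartial \<gamma> (\<lambda>x. G (c * v x) * partial1 j h x) x\<bar> \<le> D2"
    using step.IH[OF step.prems(1,2) cdiff_Suc_partial[OF h] partials_bounded_partial1[OF bh] le(2,1)] by blast
  have Gv: "cdiff (Suc l) \<Omega> (\<lambda>x. G (c * v x))" by (rule cdiff_compose[OF \<Omega> step.prems(1) cdiff_cmult[OF \<Omega> vl]])
  have G'v: "cdiff l \<Omega> (\<lambda>x. deriv G (c * v x))"
    by (rule cdiff_compose[OF \<Omega> dG' cdiff_cmult[OF \<Omega> cdiff_lower[OF vl]]])
  have "\<bar>cpartial (mshift j \<gamma>) (\<lambda>x. G (c * v x) * h x) x\<bar> \<le> D1 + D2" if x: "x \<in> \<Omega>" for x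
  proof -
    have "cpartial (mshift j \<gamma>) (\<lambda>x. G (c * v x) * h x) x = cpartial \<gamma> (partial1 j (\<lambda>x. G (c * v x) * h x)) x"
      by (rule cpartial_mshift_inner[OF \<Omega> cdiff_mono[OF cdiff_mult[OF \<Omega> Gv h]] x]) (use le in simp)
    also have "\<dots> = cpartial \<gamma> (\<lambda>x. deriv G (c * v x) * h1 x + G (c * v x) * partial1 j h x) x"
    proof (rule cpartial_cong[OF \<Omega> x])
      fix y assume y: "y \<in> \<Omega>"
      have "has_partial j (\<lambda>x. c * v x) y (c * partial1 j v y)"
        using has_partial_mult[OF has_partial_const[of j c y] cdiff_has_partial[OF vl y, of j]] by simp
      then have "has_partial j (\<lambda>x. G (c * v x)) y (deriv G (c * v y) * (c * partial1 j v y))"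
        by (rule has_partial_compose[OF dG])
      from has_partial_mult[OF this cdiff_has_partial[OF h y]]
      have "partial1 j (\<lambda>x. G (c * v x) * h x) y =
        deriv G (c * v y) * (c * partial1 j v y) * h y + G (c * v y) * partial1 j h y" by (rule partial1_eqI)
      then show "partial1 j (\<lambda>x. G (c * v x) * h x) y = deriv G (c * v y) * h1 y + G (c * v y) * partial1 j h y"
        by (simp add: h1_def mult.assoc)
    qed
    also have "\<dots> = cpartial \<gamma> (\<lambda>x. deriv G (c * v x) * h1 x) x + cpartial \<gamma> (\<lambda>x. G (c * v x) * partial1 j h x) x"
      by (rule cpartial_add[OF \<Omega> cdiff_mono[OF cdiff_mult[OF \<Omega> G'v h1] le(1)]
            cdiff_mono[OF cdiff_mult[OF \<Omega> cdiff_lower[OF Gv] cdiff_Suc_partial[OF h]] le(1)] x])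
    finally show ?thesis using D1 D2 x abs_triangle_ineq by (smt (verit, best))
  qed
  then show ?case by blast
qed

lemma cutoff_eta_0: "cutoff_eta \<eta> \<Longrightarrow> \<bar>t\<bar> \<le> 1/2 \<Longrightarrow> \<eta> t = 0"
proof -
  assume \<eta>: "cutoff_eta \<eta>" and "\<bar>t\<bar> \<le> 1/2"
  then have "t \<in> {-1/2..1/2}" by auto
  then show "\<eta> t = 0" using \<eta> unfolding cutoff_eta_def by blast
qed

lemma cutoff_eta_1: "cutoff_eta \<eta> \<Longrightarrow> 1 < \<bar>t\<bar> \<Longrightarrow> \<eta> t = 1"
proof -
  assume \<eta>: "cutoff_eta \<eta>" and "1 < \<bar>t\<bar>"
  then have "t \<notin> {-1..1}" by auto
  then show "\<eta> t = 1" using \<eta> unfolding cutoff_eta_def by blast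
qed

locale cutoff_setting =
  fixes \<Omega> :: "(real^'d::finite) set" and p :: real and m n :: nat
    and v :: "real^'d \<Rightarrow> real" and s :: "'d mindex \<Rightarrow> real" and \<eta> :: "real \<Rightarrow> real"
  assumes \<Omega>: "open \<Omega>" and p: "1 \<le> p"
    and v: "Ck_star_on m \<Omega> v"
    and adm: "admissible m s"
    and n: "n \<ge> 1"
    and \<eta>: "cutoff_eta \<eta>"
    and bnd: "\<forall>\<alpha>::'d mindex. 0 < msize \<alpha> \<and> msize \<alpha> \<le> m \<longrightarrow>
           (\<exists>C>0. \<forall>x\<in>Mset \<Omega> v n - Mset \<Omega> v (2*n). \<bar>cpartial \<alpha> v x\<bar> \<le> C)"
begin

abbreviation M where "M \<equiv> lebesgue_on \<Omega>"

abbreviation WS where "WS \<equiv> Wsv \<Omega> p m s v"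

abbreviation chi_v where "chi_v \<equiv> chi \<eta> v n"

lemma Omega_lebesgue: "\<Omega> \<in> sets lebesgue" by (rule lebesgue_open[OF \<Omega>])

lemma v_cdiff: "cdiff m \<Omega> v" using v unfolding Ck_star_on_def Ck_on_iff_cdiff[OF \<Omega>] by blast

lemma v_AE: "AE x in M. v x \<noteq> 0" using v unfolding Ck_star_on_def by blast

lemma s_nonneg: "msize \<alpha> \<le> m \<Longrightarrow> 0 \<le> s \<alpha>" using adm by (simp add: admissible_def)

text \<open>Forced by 0 \<le> s(\<alpha>) \<le> |\<alpha>| at \<alpha> = 0. The weight of order zero
  is therefore \<open>\<bar>v\<bar>\<close> itself.\<close>

lemma s_zero: "s (\<lambda>_. 0) = 0"
proof -
  have "0 \<le> s (\<lambda>_. 0) \<and> s (\<lambda>_. 0) \<le> real (msize (\<lambda>_::'d. 0))"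
    using adm unfolding admissible_def by (metis msize_0 le0)
  then show ?thesis by simp
qed

lemma chi_v_eq: "chi_v = (\<lambda>x. \<eta> (real n * v x))" by (rule ext) (simp add: chi_def)

lemma chi_cdiff: "cdiff m \<Omega> chi_v"
  unfolding chi_v_eq by (rule cdiff_compose[OF \<Omega> cutoff_eta_smooth[OF \<eta>] cdiff_cmult[OF \<Omega> v_cdiff]])

lemma chi_partial_zero:
  assumes "x \<in> \<Omega>" "\<bar>v x\<bar> < 1 / (2 * real n)"
  shows "cpartial \<gamma> chi_v x = 0"
proof -
  define U where "U = {x\<in>\<Omega>. \<bar>v x\<bar> < 1 / (2 * real n)}"
  have "open U" unfolding U_def
    using continuous_open_preimage[OF continuous_on_rabs[OF cdiff_cont[OF v_cdiff]] \<Omega>, of "{..< 1 / (2 * real n)}"]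
    by (simp add: vimage_def Int_def)
  have "cpartial \<gamma> chi_v x = cpartial \<gamma> (\<lambda>_. 0) x"
  proof (rule cpartial_cong[OF \<open>open U\<close>])
    show "x \<in> U" using assms by (simp add: U_def)
    fix y assume "y \<in> U"
    then have "\<bar>real n * v y\<bar> \<le> 1/2" using n by (simp add: U_def abs_mult field_simps)
    then show "chi_v y = 0" unfolding chi_def by (rule cutoff_eta_0[OF \<eta>])
  qed
  then show ?thesis by (simp add: cpartial_const_0)
qed

text \<open>Order zero is the bound on \<eta>; in positive order every term contains a derivative of
  \<eta>, which confines it to the set where the derivatives of \<open>v\<close> are
  bounded.\<close>

lemma chi_partial_bounded:
  assumes "msize \<gamma> \<le> m" shows "\<exists>D. \<forall>x\<in>\<Omega>. \<bar>cpartial \<gamma> chi_v x\<bar> \<le> D"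
proof (cases "\<gamma> = (\<lambda>_. 0)")
  case True
  have "\<bar>chi_v x\<bar> \<le> 1" for x using \<eta> by (simp add: chi_def cutoff_eta_def)
  then show ?thesis unfolding True by auto
next
  case False
  define A where "A = {x\<in>\<Omega>. 1/2 < \<bar>real n * v x\<bar> \<and> \<bar>real n * v x\<bar> \<le> 1}"
  \<comment> \<open>The preimage of the annulus under \<open>n * v\<close> is exactly the set of the
    boundedness hypothesis.\<close>
  have A: "A = Mset \<Omega> v n - Mset \<Omega> v (2*n)"
    using n by (auto simp: A_def Mset_def abs_mult field_simps)
  have "\<exists>C. \<forall>x\<in>A. \<bar>cpartial \<alpha> v x\<bar> \<le> C" if "msize \<alpha> \<le> m" for \<alpha> :: "'d mindex"
  proof (cases "\<alpha> = (\<lambda>_. 0)")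
    case True
    \<comment> \<open>The hypothesis covers positive orders; for order zero the bound is membership
      in \<open>Mset \<Omega> v n\<close>.\<close>
    have "\<bar>v x\<bar> \<le> 1 / real n" if "x \<in> A" for x using that by (simp add: A Mset_def)
    then show ?thesis unfolding True by auto
  next
    case False
    then have "0 < msize \<alpha>" using msize_eq_0[of \<alpha>] by blast
    then show ?thesis using bnd that unfolding A by blast
  qed
  then have "\<forall>\<alpha>. \<exists>C. msize \<alpha> \<le> m \<longrightarrow> (\<forall>x\<in>A. \<bar>cpartial \<alpha> v x\<bar> \<le> C)" by blast
  then obtain C where C: "\<And>\<alpha> x. msize \<alpha> \<le> m \<Longrightarrow> x \<in> A \<Longrightarrow> \<bar>cpartial \<alpha> v x\<bar> \<le> C \<alpha>"
    using choice[of "\<lambda>\<alpha> C. msize \<alpha> \<le> m \<longrightarrow> (\<forall>x\<in>A. \<bar>cpartial \<alpha> v x\<bar> \<le> C)"] by blast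
  define Cv where "Cv = Max (C ` {\<alpha>. msize \<alpha> \<le> m})"
  have AO: "A \<subseteq> \<Omega>" by (auto simp: A_def)
  have bv: "partials_bounded m A Cv v"
  proof (rule cpartial_partials_bounded[OF \<Omega> AO v_cdiff])
    fix \<alpha> :: "'d mindex" and x assume "msize \<alpha> \<le> m" "x \<in> A"
    then have "\<bar>cpartial \<alpha> v x\<bar> \<le> C \<alpha>" by (rule C)
    also have "\<dots> \<le> Cv" unfolding Cv_def using finite_msize_le \<open>msize \<alpha> \<le> m\<close> by (intro Max_ge) auto
    finally show "\<bar>cpartial \<alpha> v x\<bar> \<le> Cv" .
  qed
  \<comment> \<open>One derivative is split off because \<eta> is 1 far out, whereas
    \<open>deriv \<eta>\<close> vanishes off the annulus, as
    \<open>cpartial_compose_mult_bounded\<close> demands.\<close>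
  obtain j \<gamma>' where \<gamma>: "\<gamma> = mshift j \<gamma>'" by (rule cpartial_step[OF False])
  have sz: "Suc (msize \<gamma>') \<le> m" using assms unfolding \<gamma> msize_mshift .
  then obtain l where m: "m = Suc l" using Suc_le_D by blast
  have d\<eta>: "\<eta> differentiable (at t)" for t using cutoff_eta_smooth[OF \<eta>, of 0] by simp
  have d\<eta>': "(deriv ^^ i) (deriv \<eta>) differentiable (at t)" for i t
    using cutoff_eta_smooth[OF \<eta>, of "Suc i" t] by (simp add: funpow_Suc_right del: funpow.simps)
  have \<eta>0: "\<forall>t. \<not> (1/2 < \<bar>t\<bar> \<and> \<bar>t\<bar> \<le> 1) \<longrightarrow> deriv \<eta> t = 0"
  proof (intro allI impI)
    fix t :: real assume t: "\<not> (1/2 < \<bar>t\<bar> \<and> \<bar>t\<bar> \<le> 1)"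
    show "deriv \<eta> t = 0"
      by (rule deriv_vanishes_off_annulus[OF d\<eta> cutoff_eta_0[OF \<eta>] cutoff_eta_1[OF \<eta>] t])
  qed
  define h where "h x = real n * partial1 j v x" for x
  note vS = v_cdiff[unfolded m] and bS = bv[unfolded m]
  have h: "cdiff l \<Omega> h" unfolding h_def by (rule cdiff_cmult[OF \<Omega> cdiff_Suc_partial[OF vS]])
  have bh: "partials_bounded l A (2 ^ l * (real n * Cv)) h" unfolding h_def
    by (rule partials_bounded_mult[OF \<Omega> AO cdiff_const cdiff_Suc_partial[OF vS]
          partials_bounded_const partials_bounded_partial1[OF bS]]) simp
  obtain D where D: "\<forall>x\<in>\<Omega>. \<bar>cpartial \<gamma>' (\<lambda>x. deriv \<eta> (real n * v x) * h x) x\<bar> \<le> D"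
    using cpartial_compose_mult_bounded[OF \<Omega> A_def vS bS d\<eta>' \<eta>0 h bh, of \<gamma>'] sz m by auto
  have "cpartial \<gamma> chi_v x = cpartial \<gamma>' (\<lambda>x. deriv \<eta> (real n * v x) * h x) x" if x: "x \<in> \<Omega>" for x
  proof -
    have "cpartial \<gamma> chi_v x = cpartial \<gamma>' (partial1 j chi_v) x" unfolding \<gamma>
      by (rule cpartial_mshift_inner[OF \<Omega> cdiff_mono[OF chi_cdiff sz] x])
    also have "\<dots> = cpartial \<gamma>' (\<lambda>x. deriv \<eta> (real n * v x) * h x) x"
    proof (rule cpartial_cong[OF \<Omega> x])
      fix y assume y: "y \<in> \<Omega>"
      have "has_partial j (\<lambda>x. real n * v x) y (h y)"
        using has_partial_mult[OF has_partial_const[of j "real n" y] cdiff_has_partial[OF vS y, of j]]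
        by (simp add: h_def)
      then have "has_partial j chi_v y (deriv \<eta> (real n * v y) * h y)"
        unfolding chi_v_eq by (rule has_partial_compose[OF d\<eta>])
      then show "partial1 j chi_v y = deriv \<eta> (real n * v y) * h y" by (rule partial1_eqI)
    qed
    finally show ?thesis .
  qed
  then show ?thesis using D by auto
qed

end

section \<open>Quotients by powers of \<open>v\<close> as test functions\<close>

lemma test_fun_cdiff: "test_fun S \<phi> \<Longrightarrow> cdiff k UNIV \<phi>"
  unfolding test_fun_def Ck_on_iff_cdiff[OF open_UNIV] by blast

lemma test_fun_support:
  assumes "test_fun S \<phi>"
  obtains K where "compact K" "K \<subseteq> S" "\<forall>x. x \<notin> K \<longrightarrow> \<phi> x = 0"
proof -
  have "{x. \<phi> x \<noteq> 0} \<subseteq> closure {x. \<phi> x \<noteq> 0}" by (rule closure_subset)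
  then have "\<forall>x. x \<notin> closure {x. \<phi> x \<noteq> 0} \<longrightarrow> \<phi> x = 0" by blast
  then show thesis using that assms unfolding test_fun_def by blast
qed

context cutoff_setting
begin

text \<open>Three open sets cover the space: where \<open>v \<noteq> 0\<close> in \<Omega> the
  quotient is formed from C^k functions, near the zeros of \<open>v\<close> the derivative of \<chi>
  vanishes, and off \<open>K\<close> the factor \<phi> does. The condition on \<open>k\<close>
  accounts for the derivatives of \<chi> already used.\<close>

lemma quotient_cdiff:
  assumes \<phi>: "cdiff k UNIV \<phi>" and K: "compact K" "K \<subseteq> \<Omega>" "\<forall>x. x \<notin> K \<longrightarrow> \<phi> x = 0"
    and k: "k + msize \<gamma> \<le> m"
  shows "cdiff k UNIV (\<lambda>x. \<phi> x * cpartial \<gamma> chi_v x * inverse (v x ^ r))"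
proof -
  define Q where "Q x = \<phi> x * cpartial \<gamma> chi_v x * inverse (v x ^ r)" for x
  define U1 where "U1 = {x\<in>\<Omega>. v x \<noteq> 0}"
  define U2 where "U2 = {x\<in>\<Omega>. \<bar>v x\<bar> < 1 / (2 * real n)}"
  have U1: "open U1" unfolding U1_def
    using continuous_open_preimage[OF cdiff_cont[OF v_cdiff] \<Omega> open_Compl[OF closed_singleton[of 0]]]
    by (simp add: vimage_def Int_def)
  have U2: "open U2" unfolding U2_def
    using continuous_open_preimage[OF continuous_on_rabs[OF cdiff_cont[OF v_cdiff]] \<Omega>, of "{..< 1 / (2 * real n)}"]
    by (simp add: vimage_def Int_def)
  have U3: "open (- K)" using compact_imp_closed[OF K(1)] by (rule open_Compl)
  have U1\<Omega>: "U1 \<subseteq> \<Omega>" by (auto simp: U1_def)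
  have c1: "cdiff k \<Omega> (cpartial \<gamma> chi_v)"
    by (rule cdiff_cpartial, rule cdiff_mono[OF chi_cdiff]) (use k in simp)
  have v1: "cdiff k U1 v" by (rule cdiff_subset[OF cdiff_mono[OF v_cdiff] U1\<Omega>]) (use k in simp)
  have "cdiff k U1 Q" unfolding Q_def
    by (intro cdiff_mult U1 cdiff_inverse cdiff_power cdiff_subset[OF \<phi>] cdiff_subset[OF c1 U1\<Omega>] v1)
      (simp_all add: U1_def)
  moreover have "cdiff k U2 Q"
  proof -
    have "cdiff k U2 Q \<longleftrightarrow> cdiff k U2 (\<lambda>_. 0)"
      by (rule cdiff_cong[OF U2]) (simp add: Q_def U2_def chi_partial_zero)
    then show ?thesis by (simp add: cdiff_const)
  qed
  moreover have "cdiff k (- K) Q"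
  proof -
    have "cdiff k (- K) Q \<longleftrightarrow> cdiff k (- K) (\<lambda>_. 0)"
      by (rule cdiff_cong[OF U3]) (use K(3) in \<open>simp add: Q_def\<close>)
    then show ?thesis by (simp add: cdiff_const)
  qed
  ultimately have "cdiff k ((U1 \<union> U2) \<union> - K) Q"
    by (intro cdiff_Un open_Un U1 U2 U3)
  moreover have "(U1 \<union> U2) \<union> - K = UNIV" using K(2) n by (auto simp: U1_def U2_def)
  ultimately show ?thesis by (simp add: Q_def[abs_def])
qed

text \<open>At a zero of \<open>v\<close> the cancellation fails formally, but the derivative of
  \<chi> vanishes there and both sides are 0.\<close>

lemma quotient_cancel:
  assumes "x \<in> \<Omega>"
  shows "v x ^ r * (\<phi> x * cpartial \<gamma> chi_v x * inverse (v x ^ r)) = \<phi> x * cpartial \<gamma> chi_v x"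
proof (cases "v x = 0")
  case True
  then have "cpartial \<gamma> chi_v x = 0" using chi_partial_zero[OF assms] n by simp
  then show ?thesis by simp
qed simp

section \<open>Consequences of membership in the weighted space\<close>

abbreviation weighted_deriv where
  "weighted_deriv u \<beta> x \<equiv> Dv \<Omega> v \<beta> u x * s_weights s v \<beta> x"

lemma Wsv_Lpw:
  assumes u: "WS u" and \<beta>: "msize \<beta> \<le> m"
  shows "Lpw \<Omega> p (s_weights s v \<beta>) (Dv \<Omega> v \<beta> u)"
proof (cases "\<beta> = (\<lambda>_. 0)")
  case True
  then show ?thesis using u by (simp add: Wsob_def Dv_def)
next
  case False
  then have "0 < msize \<beta>" using msize_eq_0[of \<beta>] by blast
  then show ?thesis using u \<beta> unfolding Wsob_def by blast
qed

lemma Wsv_wderiv: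
  assumes u: "WS u" and \<beta>: "msize \<beta> \<le> m" "\<beta> \<noteq> (\<lambda>_. 0)"
  shows "is_wderiv_v \<Omega> v \<beta> u (Dv \<Omega> v \<beta> u)"
proof -
  have "0 < msize \<beta>" using \<beta>(2) msize_eq_0[of \<beta>] by blast
  then have "\<exists>g. is_wderiv_v \<Omega> v \<beta> u g" using u \<beta>(1) unfolding Wsob_def by blast
  then show ?thesis unfolding Dv_def using \<beta>(2) by (simp add: someI_ex)
qed

lemma v_measurable: "v \<in> borel_measurable M"
  by (rule continuous_imp_measurable_on_sets_lebesgue[OF cdiff_cont[OF v_cdiff] Omega_lebesgue])

lemma Wsv_L1loc:
  assumes u: "WS u" shows "L1loc_w \<Omega> v u"
proof -
  have L: "Lpw \<Omega> p (s_weights s v (\<lambda>_. 0)) u" using u unfolding Wsob_def by blast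
  have w: "s_weights s v (\<lambda>_. 0) x = \<bar>v x\<bar>" for x by (simp add: s_weights_def s_zero)
  have m: "(\<lambda>x. u x * \<bar>v x\<bar>) \<in> borel_measurable M"
    and i: "integrable M (\<lambda>x. \<bar>u x * \<bar>v x\<bar>\<bar> powr p)"
    using L unfolding Lpw_def w by blast+
  \<comment> \<open>The quotient \<open>v x / \<bar>v x\<bar>\<close> is the sign of
    \<open>v x\<close>, also at zeros because \<open>0 / 0 = 0\<close>; it turns the weight
    \<open>\<bar>v\<bar>\<close> into \<open>v\<close>.\<close>
  have "(\<lambda>x. (u x * \<bar>v x\<bar>) * (v x / \<bar>v x\<bar>)) \<in> borel_measurable M"
    by (rule borel_measurable_times[OF m borel_measurable_divide[OF v_measurable borel_measurable_abs[OF v_measurable]]])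
  moreover have "(\<lambda>x. (u x * \<bar>v x\<bar>) * (v x / \<bar>v x\<bar>)) = (\<lambda>x. u x * v x)" by (rule ext) simp
  ultimately have muv: "(\<lambda>x. u x * v x) \<in> borel_measurable M" by simp
  have "integrable M (\<lambda>x. \<bar>u x * v x\<bar> powr p)" using i by (simp add: abs_mult)
  then show ?thesis unfolding L1loc_w_def using Lp_imp_L1loc[OF \<Omega> p muv] by blast
qed

section \<open>The Leibniz formula for the cut-off product and its L^p bound\<close>

definition cut_deriv where
  "cut_deriv u \<alpha> x = (\<Sum>\<beta>\<in>{\<beta>. \<beta> \<le> \<alpha>}. real (mbinom \<alpha> \<beta>) * Dv \<Omega> v \<beta> u x * cpartial (\<alpha> - \<beta>) chi_v x)"

lemma mindex_le_props:
  assumes "\<beta> \<le> \<alpha>" "msize \<alpha> \<le> m"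
  shows "msize \<beta> \<le> m" "msize (\<alpha> - \<beta>) \<le> m" "msize \<beta> + msize (\<alpha> - \<beta>) \<le> m"
  using msize_diff[OF assms(1)] assms(2) by auto

text \<open>Where the derivative of \<chi> can be nonzero, |v| \<ge> 1/(2n), so the weight is at
  least \<open>b\<close>; here \<open>s \<beta> \<ge> 0\<close> makes the power monotone in its
  base. Trading the derivative for the weight turns each Leibniz term into a multiple of a quantity
  in L^p.\<close>

lemma chi_partial_weight_bound:
  assumes \<gamma>: "msize \<gamma> \<le> m" and \<beta>: "msize \<beta> \<le> m"
  shows "\<exists>c\<ge>0. \<forall>x\<in>\<Omega>. \<bar>cpartial \<gamma> chi_v x\<bar> \<le> c * s_weights s v \<beta> x"
proof -
  obtain D where D: "\<forall>x\<in>\<Omega>. \<bar>cpartial \<gamma> chi_v x\<bar> \<le> D" using chi_partial_bounded[OF \<gamma>] by blast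
  define b where "b = (1 / (2 * real n)) powr (s \<beta> + 1)"
  have b: "b > 0" unfolding b_def using n by simp
  have "\<bar>cpartial \<gamma> chi_v x\<bar> \<le> (\<bar>D\<bar> / b) * s_weights s v \<beta> x" if x: "x \<in> \<Omega>" for x
  proof (cases "\<bar>v x\<bar> < 1 / (2 * real n)")
    case True
    have "0 \<le> s_weights s v \<beta> x" by (simp add: s_weights_def)
    then show ?thesis using chi_partial_zero[OF x True] b by simp
  next
    case False
    then have "b \<le> s_weights s v \<beta> x" unfolding b_def s_weights_def
      using s_nonneg[OF \<beta>] by (intro powr_mono2) auto
    then have "(\<bar>D\<bar> / b) * b \<le> (\<bar>D\<bar> / b) * s_weights s v \<beta> x" using b by (intro mult_left_mono) auto
    moreover have "\<bar>cpartial \<gamma> chi_v x\<bar> \<le> \<bar>D\<bar>" using D x by fastforce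
    ultimately show ?thesis using b by simp
  qed
  moreover have "0 \<le> \<bar>D\<bar> / b" using b by simp
  ultimately show ?thesis by blast
qed

lemma weight_measurable: "s_weights s v \<beta> \<in> borel_measurable M"
  unfolding s_weights_def[abs_def]
  using v_measurable by measurable

text \<open>The constant is chosen before \<open>u\<close>, as the norm estimate and hence
  continuity require. Summing over all indices of order at most \<open>m\<close> makes the majorant
  independent of \<alpha>.\<close>

lemma cut_deriv_dominated:
  assumes \<alpha>: "msize \<alpha> \<le> m"
  shows "\<exists>c\<ge>0. \<forall>u. WS u \<longrightarrow> cut_deriv u \<alpha> \<in> borel_measurable M \<and>
    (\<forall>x\<in>\<Omega>. \<bar>cut_deriv u \<alpha> x\<bar> \<le> c * (\<Sum>\<beta>\<in>{\<beta>. msize \<beta> \<le> m}. \<bar>weighted_deriv u \<beta> x\<bar>))"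
proof -
  let ?B = "{\<beta>. \<beta> \<le> \<alpha>}"
  define c where "c \<beta> = (SOME c. c \<ge> 0 \<and> (\<forall>x\<in>\<Omega>. \<bar>cpartial (\<alpha> - \<beta>) chi_v x\<bar> \<le> c * s_weights s v \<beta> x))" for \<beta>
  have c: "c \<beta> \<ge> 0 \<and> (\<forall>x\<in>\<Omega>. \<bar>cpartial (\<alpha> - \<beta>) chi_v x\<bar> \<le> c \<beta> * s_weights s v \<beta> x)"
    if "\<beta> \<in> ?B" for \<beta>
  proof -
    have "\<beta> \<le> \<alpha>" using that by simp
    from chi_partial_weight_bound[OF mindex_le_props(2)[OF this \<alpha>] mindex_le_props(1)[OF this \<alpha>]]
    show ?thesis unfolding c_def by (rule someI_ex)
  qed
  define e where "e \<beta> = real (mbinom \<alpha> \<beta>) * c \<beta>" for \<beta>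
  have e: "0 \<le> e \<beta>" if "\<beta> \<in> ?B" for \<beta> unfolding e_def using c[OF that] by simp
  define E where "E = (\<Sum>\<beta>\<in>?B. e \<beta>)"
  have E: "0 \<le> E" unfolding E_def by (rule sum_nonneg) (rule e)
  have eE: "e \<beta> \<le> E" if "\<beta> \<in> ?B" for \<beta> unfolding E_def by (rule member_le_sum[OF that]) (use e in auto)
  have "cut_deriv u \<alpha> \<in> borel_measurable M \<and>
    (\<forall>x\<in>\<Omega>. \<bar>cut_deriv u \<alpha> x\<bar> \<le> E * (\<Sum>\<beta>\<in>{\<beta>. msize \<beta> \<le> m}. \<bar>weighted_deriv u \<beta> x\<bar>))" if u: "WS u" for u
  proof
    have "(\<lambda>x. real (mbinom \<alpha> \<beta>) * Dv \<Omega> v \<beta> u x * cpartial (\<alpha> - \<beta>) chi_v x) \<in> borel_measurable M"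
      if \<beta>: "\<beta> \<in> ?B" for \<beta>
    proof -
      have le: "\<beta> \<le> \<alpha>" using \<beta> by simp
      have m1: "(\<lambda>x. weighted_deriv u \<beta> x) \<in> borel_measurable M"
        using Wsv_Lpw[OF u mindex_le_props(1)[OF le \<alpha>]] unfolding Lpw_def by blast
      have "cdiff 0 \<Omega> (cpartial (\<alpha> - \<beta>) chi_v)"
        by (rule cdiff_cpartial, rule cdiff_mono[OF chi_cdiff]) (use mindex_le_props(2)[OF le \<alpha>] in simp)
      then have m2: "cpartial (\<alpha> - \<beta>) chi_v \<in> borel_measurable M"
        by (intro continuous_imp_measurable_on_sets_lebesgue Omega_lebesgue) simp
      \<comment> \<open>Only the product of \<open>Dv \<Omega> v \<beta> u\<close> with its weight
        is known to be measurable, so the weight is multiplied in and divided out. Where it is 0,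
        the bound \<open>c\<close> forces the derivative of \<chi> to be 0 too.\<close>
      have m3: "(\<lambda>x. real (mbinom \<alpha> \<beta>) * (weighted_deriv u \<beta> x * (cpartial (\<alpha> - \<beta>) chi_v x / s_weights s v \<beta> x)))
          \<in> borel_measurable M"
        by (intro borel_measurable_times[OF borel_measurable_const] borel_measurable_times[OF m1]
            borel_measurable_divide[OF m2 weight_measurable])
      show ?thesis
      proof (rule measurable_cong[THEN iffD2, OF _ m3])
        fix x assume "x \<in> space M"
        then have x: "x \<in> \<Omega>" by simp
        show "real (mbinom \<alpha> \<beta>) * Dv \<Omega> v \<beta> u x * cpartial (\<alpha> - \<beta>) chi_v x
          = real (mbinom \<alpha> \<beta>) * (weighted_deriv u \<beta> x * (cpartial (\<alpha> - \<beta>) chi_v x / s_weights s v \<beta> x))"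
          using c[OF \<beta>, THEN conjunct2, rule_format, OF x] by (cases "s_weights s v \<beta> x = 0") simp_all
      qed
    qed
    then show "cut_deriv u \<alpha> \<in> borel_measurable M"
      unfolding cut_deriv_def[abs_def] by (rule borel_measurable_sum)
    show "\<forall>x\<in>\<Omega>. \<bar>cut_deriv u \<alpha> x\<bar> \<le> E * (\<Sum>\<beta>\<in>{\<beta>. msize \<beta> \<le> m}. \<bar>weighted_deriv u \<beta> x\<bar>)"
    proof
      fix x assume x: "x \<in> \<Omega>"
      have "\<bar>cut_deriv u \<alpha> x\<bar> \<le> (\<Sum>\<beta>\<in>?B. \<bar>real (mbinom \<alpha> \<beta>) * Dv \<Omega> v \<beta> u x * cpartial (\<alpha> - \<beta>) chi_v x\<bar>)"
        unfolding cut_deriv_def by (rule sum_abs)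
      also have "\<dots> \<le> (\<Sum>\<beta>\<in>?B. E * \<bar>weighted_deriv u \<beta> x\<bar>)"
      proof (rule sum_mono)
        fix \<beta> assume \<beta>: "\<beta> \<in> ?B"
        have w: "0 \<le> s_weights s v \<beta> x" by (simp add: s_weights_def)
        have "\<bar>real (mbinom \<alpha> \<beta>) * Dv \<Omega> v \<beta> u x * cpartial (\<alpha> - \<beta>) chi_v x\<bar>
            = (real (mbinom \<alpha> \<beta>) * \<bar>Dv \<Omega> v \<beta> u x\<bar>) * \<bar>cpartial (\<alpha> - \<beta>) chi_v x\<bar>" by (simp add: abs_mult)
        also have "\<dots> \<le> (real (mbinom \<alpha> \<beta>) * \<bar>Dv \<Omega> v \<beta> u x\<bar>) * (c \<beta> * s_weights s v \<beta> x)"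
          by (rule mult_left_mono[OF c[OF \<beta>, THEN conjunct2, rule_format, OF x]]) simp
        also have "\<dots> = e \<beta> * \<bar>weighted_deriv u \<beta> x\<bar>" using w by (simp add: e_def abs_mult)
        also have "\<dots> \<le> E * \<bar>weighted_deriv u \<beta> x\<bar>" by (rule mult_right_mono[OF eE[OF \<beta>]]) simp
        finally show "\<bar>real (mbinom \<alpha> \<beta>) * Dv \<Omega> v \<beta> u x * cpartial (\<alpha> - \<beta>) chi_v x\<bar> \<le> E * \<bar>weighted_deriv u \<beta> x\<bar>" .
      qed
      also have "\<dots> \<le> (\<Sum>\<beta>\<in>{\<beta>. msize \<beta> \<le> m}. E * \<bar>weighted_deriv u \<beta> x\<bar>)"
        by (rule sum_mono2[OF finite_msize_le]) (use mindex_le_props(1)[OF _ \<alpha>] E in auto)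
      finally show "\<bar>cut_deriv u \<alpha> x\<bar> \<le> E * (\<Sum>\<beta>\<in>{\<beta>. msize \<beta> \<le> m}. \<bar>weighted_deriv u \<beta> x\<bar>)"
        by (simp add: sum_distrib_left)
    qed
  qed
  then show ?thesis using E by blast
qed

text \<open>The \<open>p\<close>-th power of \<open>Wsv_norm\<close>, with the factors ordered as in
  \<open>Lpw\<close>.\<close>

definition energy where
  "energy u = (\<Sum>\<beta>\<in>{\<beta>. msize \<beta> \<le> m}. \<integral>x. \<bar>weighted_deriv u \<beta> x\<bar> powr p \<partial>M)"

lemma cut_deriv_Lp:
  assumes \<alpha>: "msize \<alpha> \<le> m"
  shows "\<exists>C\<ge>0. \<forall>u. WS u \<longrightarrow> cut_deriv u \<alpha> \<in> borel_measurable M \<and>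
    integrable M (\<lambda>x. \<bar>cut_deriv u \<alpha> x\<bar> powr p) \<and>
    (\<integral>x. \<bar>cut_deriv u \<alpha> x\<bar> powr p \<partial>M) \<le> C * energy u"
proof -
  let ?N = "{\<beta> :: 'd mindex. msize \<beta> \<le> m}"
  obtain c where c: "c \<ge> 0" "\<forall>u. WS u \<longrightarrow> cut_deriv u \<alpha> \<in> borel_measurable M \<and>
    (\<forall>x\<in>\<Omega>. \<bar>cut_deriv u \<alpha> x\<bar> \<le> c * (\<Sum>\<beta>\<in>?N. \<bar>weighted_deriv u \<beta> x\<bar>))"
    using cut_deriv_dominated[OF \<alpha>] by blast
  define C where "C = (c * real (card ?N)) powr p"
  have "cut_deriv u \<alpha> \<in> borel_measurable M \<and>
    integrable M (\<lambda>x. \<bar>cut_deriv u \<alpha> x\<bar> powr p) \<and>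
    (\<integral>x. \<bar>cut_deriv u \<alpha> x\<bar> powr p \<partial>M) \<le> C * energy u" if u: "WS u" for u
  proof -
    have G: "integrable M (\<lambda>x. \<bar>weighted_deriv u \<beta> x\<bar> powr p)" if "\<beta> \<in> ?N" for \<beta>
      using Wsv_Lpw[OF u, of \<beta>] that unfolding Lpw_def by simp
    have mu: "cut_deriv u \<alpha> \<in> borel_measurable M"
      and le': "\<forall>x\<in>\<Omega>. \<bar>cut_deriv u \<alpha> x\<bar> \<le> c * (\<Sum>\<beta>\<in>?N. \<bar>weighted_deriv u \<beta> x\<bar>)"
      using c(2)[rule_format, OF u] by simp_all
    have le: "AE x in M. \<bar>cut_deriv u \<alpha> x\<bar> \<le> c * (\<Sum>\<beta>\<in>?N. \<bar>weighted_deriv u \<beta> x\<bar>)"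
      by (rule AE_I2) (use le' in simp)
    have "integrable M (\<lambda>x. \<bar>cut_deriv u \<alpha> x\<bar> powr p)"
      by (rule Lp_dominated(1)[OF finite_msize_le p c(1), where G = "\<lambda>\<beta> x. weighted_deriv u \<beta> x", OF G mu le])
    moreover have "(\<integral>x. \<bar>cut_deriv u \<alpha> x\<bar> powr p \<partial>M) \<le> C * energy u"
      unfolding C_def energy_def
      by (rule Lp_dominated(2)[OF finite_msize_le p c(1), where G = "\<lambda>\<beta> x. weighted_deriv u \<beta> x", OF G mu le])
    ultimately show ?thesis using mu by (intro conjI)
  qed
  moreover have "C \<ge> 0" by (simp add: C_def)
  ultimately show ?thesis by blast
qed

text \<open>The quotient \<open>Q\<close> is chosen so that
  \<open>v ^ (msize \<beta> + 1) * Q\<close> equals the derivative of \<chi> times \<phi> on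
  \<Omega>; inserted as a C^k test function, it frees the weak derivative of its weight.\<close>

lemma wderiv_term:
  assumes u: "WS u" and \<beta>: "\<beta> \<le> \<alpha>" and \<alpha>: "msize \<alpha> \<le> m" and \<phi>: "test_fun \<Omega> \<phi>"
  shows "integrable M (\<lambda>x. u x * cpartial \<beta> (\<lambda>y. \<phi> y * cpartial (\<alpha> - \<beta>) chi_v y) x)"
    and "integrable M (\<lambda>x. \<phi> x * cpartial (\<alpha> - \<beta>) chi_v x * Dv \<Omega> v \<beta> u x)"
    and "(\<integral>x. u x * cpartial \<beta> (\<lambda>y. \<phi> y * cpartial (\<alpha> - \<beta>) chi_v y) x \<partial>M)
      = (-1) ^ msize \<beta> * (\<integral>x. \<phi> x * cpartial (\<alpha> - \<beta>) chi_v x * Dv \<Omega> v \<beta> u x \<partial>M)"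
proof -
  define \<gamma> where "\<gamma> = \<alpha> - \<beta>"
  define r where "r = msize \<beta> + 1"
  define Q where "Q x = \<phi> x * cpartial \<gamma> chi_v x * inverse (v x ^ r)" for x
  obtain K where K: "compact K" "K \<subseteq> \<Omega>" "\<forall>x. x \<notin> K \<longrightarrow> \<phi> x = 0" by (rule test_fun_support[OF \<phi>])
  have Q: "cdiff (msize \<beta>) UNIV Q" unfolding Q_def[abs_def]
    by (rule quotient_cdiff[OF test_fun_cdiff[OF \<phi>] K]) (use mindex_le_props(3)[OF \<beta> \<alpha>] in \<open>simp add: \<gamma>_def\<close>)
  have Q0: "\<forall>x. x \<notin> K \<longrightarrow> Q x = 0" using K(3) by (simp add: Q_def)
  have vQ: "v x ^ r * Q x = \<phi> x * cpartial \<gamma> chi_v x" if "x \<in> \<Omega>" for x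
    unfolding Q_def by (rule quotient_cancel[OF that])
  have uv: "L1loc_w \<Omega> v u" by (rule Wsv_L1loc[OF u])
  have cong: "cpartial \<beta> (\<lambda>y. v y ^ r * Q y) x = cpartial \<beta> (\<lambda>y. \<phi> y * cpartial \<gamma> chi_v y) x" if "x \<in> \<Omega>" for x
    by (rule cpartial_cong[OF \<Omega> that vQ])
  have main: "integrable M (\<lambda>x. u x * cpartial \<beta> (\<lambda>y. v y ^ r * Q y) x) \<and>
    integrable M (\<lambda>x. v x ^ r * Q x * Dv \<Omega> v \<beta> u x) \<and>
    (\<integral>x. u x * cpartial \<beta> (\<lambda>y. v y ^ r * Q y) x \<partial>M)
      = (-1) ^ msize \<beta> * (\<integral>x. v x ^ r * Q x * Dv \<Omega> v \<beta> u x \<partial>M)"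
  proof (cases "\<beta> = (\<lambda>_. 0)")
    \<comment> \<open>For order zero \<open>Dv\<close> returns \<open>u\<close> by definition and
      the identity is trivial; what has to be shown is integrability, which comes from
      \<open>L1loc_w \<Omega> v u\<close>.\<close>
    case True
    have r: "r = 1" by (simp add: r_def True)
    have D: "Dv \<Omega> v \<beta> u = u" by (simp add: Dv_def True)
    have c: "continuous_on UNIV Q" by (rule cdiff_cont[OF Q])
    have "cdiff 0 UNIV Q" using c by simp
    from partials_bounded_compact[OF K(1) subset_UNIV this]
    obtain e where "partials_bounded 0 K e Q" by blast
    then have e: "\<forall>x\<in>K. \<bar>Q x\<bar> \<le> e" by simp
    obtain C where C: "C \<ge> 0" "\<And>\<phi> e. continuous_on UNIV \<phi> \<Longrightarrow> \<forall>x. x \<notin> K \<longrightarrow> \<phi> x = 0 \<Longrightarrow> \<forall>x\<in>K. \<bar>\<phi> x\<bar> \<le> e \<Longrightarrow>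
        integrable M (\<lambda>x. v x * \<phi> x * u x) \<and> \<bar>\<integral>x. v x * \<phi> x * u x \<partial>M\<bar> \<le> C * e"
      using wderiv_rhs_bound[OF \<Omega> uv K(1,2)] by blast
    have i: "integrable M (\<lambda>x. v x * Q x * u x)" using C(2)[OF c Q0 e] by blast
    have comm: "(\<lambda>x. u x * (v x * Q x)) = (\<lambda>x. v x * Q x * u x)" by (rule ext) simp
    show ?thesis using i unfolding r D unfolding True by (simp add: comm)
  next
    case False
    have wd: "is_wderiv_v \<Omega> v \<beta> u (Dv \<Omega> v \<beta> u)" by (rule Wsv_wderiv[OF u mindex_le_props(1)[OF \<beta> \<alpha>] False])
    have v\<beta>: "cdiff (msize \<beta>) \<Omega> v" by (rule cdiff_mono[OF v_cdiff mindex_le_props(1)[OF \<beta> \<alpha>]])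
    show ?thesis
      unfolding r_def using wderiv_Ck_test[OF \<eta> \<Omega> v\<beta> uv wd Q K(1,2) Q0] by blast
  qed
  have 1: "integrable M (\<lambda>x. u x * cpartial \<beta> (\<lambda>y. v y ^ r * Q y) x) \<longleftrightarrow>
      integrable M (\<lambda>x. u x * cpartial \<beta> (\<lambda>y. \<phi> y * cpartial \<gamma> chi_v y) x)"
    by (rule Bochner_Integration.integrable_cong[OF refl]) (simp add: cong)
  have 2: "integrable M (\<lambda>x. v x ^ r * Q x * Dv \<Omega> v \<beta> u x) \<longleftrightarrow>
      integrable M (\<lambda>x. \<phi> x * cpartial \<gamma> chi_v x * Dv \<Omega> v \<beta> u x)"
    by (rule Bochner_Integration.integrable_cong[OF refl]) (simp add: vQ)
  have 3: "(\<integral>x. u x * cpartial \<beta> (\<lambda>y. v y ^ r * Q y) x \<partial>M)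
      = (\<integral>x. u x * cpartial \<beta> (\<lambda>y. \<phi> y * cpartial \<gamma> chi_v y) x \<partial>M)"
    by (rule Bochner_Integration.integral_cong[OF refl]) (simp add: cong)
  have 4: "(\<integral>x. v x ^ r * Q x * Dv \<Omega> v \<beta> u x \<partial>M)
      = (\<integral>x. \<phi> x * cpartial \<gamma> chi_v x * Dv \<Omega> v \<beta> u x \<partial>M)"
    by (rule Bochner_Integration.integral_cong[OF refl]) (simp add: vQ)
  note main' = main[unfolded 1 2 3 4, unfolded \<gamma>_def]
  show "integrable M (\<lambda>x. u x * cpartial \<beta> (\<lambda>y. \<phi> y * cpartial (\<alpha> - \<beta>) chi_v y) x)"
    using main' by blast
  show "integrable M (\<lambda>x. \<phi> x * cpartial (\<alpha> - \<beta>) chi_v x * Dv \<Omega> v \<beta> u x)"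
    using main' by blast
  show "(\<integral>x. u x * cpartial \<beta> (\<lambda>y. \<phi> y * cpartial (\<alpha> - \<beta>) chi_v y) x \<partial>M)
      = (-1) ^ msize \<beta> * (\<integral>x. \<phi> x * cpartial (\<alpha> - \<beta>) chi_v x * Dv \<Omega> v \<beta> u x \<partial>M)"
    using main' by blast
qed

lemma cut_wderiv:
  assumes u: "WS u" and \<alpha>: "msize \<alpha> \<le> m"
  shows "is_wderiv \<Omega> \<alpha> (\<lambda>x. chi_v x * u x) (cut_deriv u \<alpha>)"
  unfolding is_wderiv_v_def
proof (intro conjI allI impI)
  obtain C where "cut_deriv u \<alpha> \<in> borel_measurable M"
    "integrable M (\<lambda>x. \<bar>cut_deriv u \<alpha> x\<bar> powr p)"
    using cut_deriv_Lp[OF \<alpha>] u by blast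
  from Lp_imp_L1loc[OF \<Omega> p this] show "L1loc_w \<Omega> (\<lambda>x. 1 ^ (msize \<alpha> + 1)) (cut_deriv u \<alpha>)"
    by (simp add: L1loc_w_def)
next
  fix \<phi> assume \<phi>: "test_fun \<Omega> \<phi>"
  let ?B = "{\<beta>. \<beta> \<le> \<alpha>}"
  define P where "P \<beta> x = u x * cpartial \<beta> (\<lambda>y. \<phi> y * cpartial (\<alpha> - \<beta>) chi_v y) x" for \<beta> x
  define R where "R \<beta> x = \<phi> x * cpartial (\<alpha> - \<beta>) chi_v x * Dv \<Omega> v \<beta> u x" for \<beta> x
  define b where "b \<beta> = real (mbinom \<alpha> \<beta>)" for \<beta>
  have iP: "integrable M (P \<beta>)" and iR: "integrable M (R \<beta>)"
    and eq: "(\<integral>x. P \<beta> x \<partial>M) = (-1) ^ msize \<beta> * (\<integral>x. R \<beta> x \<partial>M)"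
    if "\<beta> \<in> ?B" for \<beta>
    using wderiv_term[OF u _ \<alpha> \<phi>, of \<beta>] that unfolding P_def[abs_def] R_def[abs_def] by simp_all
  have c\<phi>: "cdiff (msize \<alpha>) \<Omega> \<phi>" by (rule cdiff_subset[OF test_fun_cdiff[OF \<phi>]]) simp
  have "(\<integral>x. chi_v x * u x * cpartial \<alpha> \<phi> x \<partial>M)
      = (\<integral>x. (\<Sum>\<beta>\<in>?B. (b \<beta> * (-1) ^ msize (\<alpha> - \<beta>)) * P \<beta> x) \<partial>M)"
  proof (rule Bochner_Integration.integral_cong[OF refl])
    fix x assume "x \<in> space M"
    then have x: "x \<in> \<Omega>" by simp
    have "chi_v x * u x * cpartial \<alpha> \<phi> x = u x * (chi_v x * cpartial \<alpha> \<phi> x)" by simp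
    also have "\<dots> = u x * (\<Sum>\<beta>\<in>?B. real (mbinom \<alpha> \<beta>) * ((-1) ^ msize (\<alpha> - \<beta>) *
      cpartial \<beta> (\<lambda>y. \<phi> y * cpartial (\<alpha> - \<beta>) chi_v y) x))"
      unfolding leibniz_transposed[OF \<Omega> x cdiff_mono[OF chi_cdiff \<alpha>] c\<phi>] ..
    also have "\<dots> = (\<Sum>\<beta>\<in>?B. (b \<beta> * (-1) ^ msize (\<alpha> - \<beta>)) * P \<beta> x)"
      unfolding sum_distrib_left by (rule sum.cong[OF refl]) (simp add: P_def b_def)
    finally show "chi_v x * u x * cpartial \<alpha> \<phi> x = (\<Sum>\<beta>\<in>?B. (b \<beta> * (-1) ^ msize (\<alpha> - \<beta>)) * P \<beta> x)" .
  qed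
  also have "\<dots> = (\<Sum>\<beta>\<in>?B. \<integral>x. (b \<beta> * (-1) ^ msize (\<alpha> - \<beta>)) * P \<beta> x \<partial>M)"
    by (rule Bochner_Integration.integral_sum) (intro integrable_mult_right iP)
  also have "\<dots> = (\<Sum>\<beta>\<in>?B. (-1) ^ msize \<alpha> * (\<integral>x. b \<beta> * R \<beta> x \<partial>M))"
  proof (rule sum.cong[OF refl])
    fix \<beta> assume \<beta>: "\<beta> \<in> ?B"
    \<comment> \<open>The alternating signs of the transposed identity and the signs of the
      integrations by parts combine to one sign that does not depend on \<beta>.\<close>
    have sgn: "(-1) ^ msize (\<alpha> - \<beta>) * (-1) ^ msize \<beta> = ((-1) ^ msize \<alpha> :: real)"
      using msize_diff[of \<beta> \<alpha>] \<beta> by (simp add: power_add[symmetric] add.commute)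
    have "(\<integral>x. (b \<beta> * (-1) ^ msize (\<alpha> - \<beta>)) * P \<beta> x \<partial>M)
      = (b \<beta> * (-1) ^ msize (\<alpha> - \<beta>)) * ((-1) ^ msize \<beta> * (\<integral>x. R \<beta> x \<partial>M))"
      by (simp only: Bochner_Integration.integral_mult_right_zero eq[OF \<beta>])
    also have "\<dots> = ((-1) ^ msize (\<alpha> - \<beta>) * (-1) ^ msize \<beta>) * (b \<beta> * (\<integral>x. R \<beta> x \<partial>M))"
      by (simp only: mult_ac)
    finally show "(\<integral>x. (b \<beta> * (-1) ^ msize (\<alpha> - \<beta>)) * P \<beta> x \<partial>M)
      = (-1) ^ msize \<alpha> * (\<integral>x. b \<beta> * R \<beta> x \<partial>M)"
      by (simp only: sgn Bochner_Integration.integral_mult_right_zero)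
  qed
  also have "\<dots> = (-1) ^ msize \<alpha> * (\<Sum>\<beta>\<in>?B. \<integral>x. b \<beta> * R \<beta> x \<partial>M)"
    by (rule sum_distrib_left[symmetric])
  also have "(\<Sum>\<beta>\<in>?B. \<integral>x. b \<beta> * R \<beta> x \<partial>M) = (\<integral>x. (\<Sum>\<beta>\<in>?B. b \<beta> * R \<beta> x) \<partial>M)"
    by (rule Bochner_Integration.integral_sum[symmetric]) (intro integrable_mult_right iR)
  also have "(\<lambda>x. \<Sum>\<beta>\<in>?B. b \<beta> * R \<beta> x) = (\<lambda>x. \<phi> x * cut_deriv u \<alpha> x)"
    unfolding cut_deriv_def R_def b_def sum_distrib_left
    by (rule ext) (rule sum.cong[OF refl], simp only: mult_ac)
  finally show "(\<integral>x. chi_v x * u x * cpartial \<alpha> (\<lambda>y. 1 ^ (msize \<alpha> + 1) * \<phi> y) x \<partial>M)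
    = (-1) ^ msize \<alpha> * (\<integral>x. 1 ^ (msize \<alpha> + 1) * \<phi> x * cut_deriv u \<alpha> x \<partial>M)"
    by simp
qed

end

section \<open>Differences of elements of the weighted space\<close>

lemma Lpw_diff:
  assumes p: "1 \<le> p" and f: "Lpw \<Omega> p w f" and g: "Lpw \<Omega> p w g"
  shows "Lpw \<Omega> p w (\<lambda>x. f x - g x)"
proof -
  have mf: "(\<lambda>x. f x * w x) \<in> borel_measurable (lebesgue_on \<Omega>)" and mg: "(\<lambda>x. g x * w x) \<in> borel_measurable (lebesgue_on \<Omega>)"
    and if': "integrable (lebesgue_on \<Omega>) (\<lambda>x. \<bar>f x * w x\<bar> powr p)" and ig: "integrable (lebesgue_on \<Omega>) (\<lambda>x. \<bar>g x * w x\<bar> powr p)"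
    using f g by (simp_all add: Lpw_def)
  have eq: "(\<lambda>x. (f x - g x) * w x) = (\<lambda>x. f x * w x - g x * w x)" by (rule ext) (rule left_diff_distrib)
  have m: "(\<lambda>x. (f x - g x) * w x) \<in> borel_measurable (lebesgue_on \<Omega>)"
    unfolding eq by (rule borel_measurable_diff[OF mf mg])
  define G where "G b x = (if b then f x * w x else g x * w x)" for b x
  have "integrable (lebesgue_on \<Omega>) (\<lambda>x. \<bar>(f x - g x) * w x\<bar> powr p)"
  proof (rule Lp_dominated(1)[where B = "UNIV :: bool set" and G = G and c = 1])
    show "integrable (lebesgue_on \<Omega>) (\<lambda>x. \<bar>G b x\<bar> powr p)" for b
      using if' ig by (cases b) (simp_all add: G_def)
    show "AE x in lebesgue_on \<Omega>. \<bar>(f x - g x) * w x\<bar> \<le> 1 * (\<Sum>b\<in>UNIV. \<bar>G b x\<bar>)"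
    proof (rule AE_I2)
      fix x
      have "\<bar>f x * w x - g x * w x\<bar> \<le> \<bar>f x * w x\<bar> + \<bar>g x * w x\<bar>" by (rule abs_triangle_ineq4)
      then show "\<bar>(f x - g x) * w x\<bar> \<le> 1 * (\<Sum>b\<in>UNIV. \<bar>G b x\<bar>)"
        by (simp add: G_def UNIV_bool left_diff_distrib)
    qed
  qed (use p m in auto)
  then show ?thesis using m by (simp add: Lpw_def)
qed

lemma Lpw_cong_AE:
  fixes \<Omega> :: "(real^'d::finite) set"
  assumes \<Omega>: "\<Omega> \<in> sets lebesgue" and f: "Lpw \<Omega> p w f" and eq: "AE x in lebesgue_on \<Omega>. f x = g x"
  shows "Lpw \<Omega> p w g"
proof -
  have mf: "(\<lambda>x. f x * w x) \<in> borel_measurable (lebesgue_on \<Omega>)"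
    and if': "integrable (lebesgue_on \<Omega>) (\<lambda>x. \<bar>f x * w x\<bar> powr p)" using f by (simp_all add: Lpw_def)
  have eq': "AE x in lebesgue_on \<Omega>. f x * w x = g x * w x" using eq by eventually_elim simp
  have mg: "(\<lambda>x. g x * w x) \<in> borel_measurable (lebesgue_on \<Omega>)"
    by (rule borel_measurable_lebesgue_on_AE[OF \<Omega> mf eq'])
  have "AE x in lebesgue_on \<Omega>. \<bar>f x * w x\<bar> powr p = \<bar>g x * w x\<bar> powr p"
    using eq' by eventually_elim (simp only:)
  moreover have "(\<lambda>x. \<bar>f x * w x\<bar> powr p) \<in> borel_measurable (lebesgue_on \<Omega>)" using mf by measurable
  moreover have "(\<lambda>x. \<bar>g x * w x\<bar> powr p) \<in> borel_measurable (lebesgue_on \<Omega>)" using mg by measurable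
  ultimately have "integrable (lebesgue_on \<Omega>) (\<lambda>x. \<bar>g x * w x\<bar> powr p)"
    using if' integrable_cong_AE[of "\<lambda>x. \<bar>f x * w x\<bar> powr p" "lebesgue_on \<Omega>" "\<lambda>x. \<bar>g x * w x\<bar> powr p"] by simp
  then show ?thesis using mg by (simp add: Lpw_def)
qed

context cutoff_setting
begin

text \<open>Splitting the integrals requires each to converge, which the definition of the weak
  derivative does not assert; \<open>wderiv_Ck_test\<close> supplies integrability along with the
  identity.\<close>

lemma wderiv_diff:
  assumes h: "is_wderiv_v \<Omega> v \<beta> h h'" "L1loc_w \<Omega> v h" and f: "is_wderiv_v \<Omega> v \<beta> f f'" "L1loc_w \<Omega> v f"
    and \<beta>: "msize \<beta> \<le> m"
  shows "is_wderiv_v \<Omega> v \<beta> (\<lambda>x. h x - f x) (\<lambda>x. h' x - f' x)"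
  unfolding is_wderiv_v_def
proof (intro conjI allI impI)
  define w where "w x = v x ^ (msize \<beta> + 1)" for x
  note wh = is_wderiv_v_L1loc[OF h(1), folded w_def] and wf = is_wderiv_v_L1loc[OF f(1), folded w_def]
  have d: "integrable (lebesgue_on K) (\<lambda>x. h' x * w x - f' x * w x)" if "compact K" "K \<subseteq> \<Omega>" for K
    by (rule Bochner_Integration.integrable_diff[OF wh[unfolded L1loc_w_def, rule_format]
          wf[unfolded L1loc_w_def, rule_format]]) (simp_all add: that)
  have "(\<lambda>x. (h' x - f' x) * w x) = (\<lambda>x. h' x * w x - f' x * w x)" by (rule ext) (rule left_diff_distrib)
  then have "L1loc_w \<Omega> w (\<lambda>x. h' x - f' x)" unfolding L1loc_w_def using d by (simp only: simp_thms) blast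
  then show "L1loc_w \<Omega> (\<lambda>x. v x ^ (msize \<beta> + 1)) (\<lambda>x. h' x - f' x)" unfolding w_def[abs_def] .
  fix \<phi> assume \<phi>: "test_fun \<Omega> \<phi>"
  obtain K where K: "compact K" "K \<subseteq> \<Omega>" "\<forall>x. x \<notin> K \<longrightarrow> \<phi> x = 0" by (rule test_fun_support[OF \<phi>])
  note vb = cdiff_mono[OF v_cdiff \<beta>] and c\<phi> = test_fun_cdiff[OF \<phi>, of "msize \<beta>"]
  note th = wderiv_Ck_test[OF \<eta> \<Omega> vb h(2,1) c\<phi> K, folded w_def]
    and tf = wderiv_Ck_test[OF \<eta> \<Omega> vb f(2,1) c\<phi> K, folded w_def]
  define A where "A = cpartial \<beta> (\<lambda>y. w y * \<phi> y)"
  note th = th[folded A_def] and tf = tf[folded A_def]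
  have "(\<integral>x. (h x - f x) * A x \<partial>M) = (\<integral>x. h x * A x - f x * A x \<partial>M)"
    by (simp only: left_diff_distrib)
  also have "\<dots> = (\<integral>x. h x * A x \<partial>M) - (\<integral>x. f x * A x \<partial>M)"
    by (rule Bochner_Integration.integral_diff[OF th(1) tf(1)])
  also have "\<dots> = (-1) ^ msize \<beta> * ((\<integral>x. w x * \<phi> x * h' x \<partial>M) - (\<integral>x. w x * \<phi> x * f' x \<partial>M))"
    by (simp only: th(3) tf(3) right_diff_distrib)
  also have "(\<integral>x. w x * \<phi> x * h' x \<partial>M) - (\<integral>x. w x * \<phi> x * f' x \<partial>M)
     = (\<integral>x. w x * \<phi> x * h' x - w x * \<phi> x * f' x \<partial>M)"
    by (rule Bochner_Integration.integral_diff[OF th(2) tf(2), symmetric])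
  also have "\<dots> = (\<integral>x. w x * \<phi> x * (h' x - f' x) \<partial>M)" by (simp only: right_diff_distrib)
  finally show "(\<integral>x. (h x - f x) * cpartial \<beta> (\<lambda>y. v y ^ (msize \<beta> + 1) * \<phi> y) x \<partial>M)
     = (-1) ^ msize \<beta> * (\<integral>x. v x ^ (msize \<beta> + 1) * \<phi> x * (h' x - f' x) \<partial>M)"
    unfolding A_def w_def .
qed

text \<open>\<open>Dv\<close> of a difference is a fresh choice, not the difference of the earlier
  choices. Uniqueness makes them agree almost everywhere, and weighted L^p membership passes
  along.\<close>

lemma Wsv_diff:
  assumes h: "WS h" and f: "WS f"
  shows "WS (\<lambda>x. h x - f x)"
  unfolding Wsob_def
proof (intro conjI allI impI)
  show "Lpw \<Omega> p (s_weights s v (\<lambda>_. 0)) (\<lambda>x. h x - f x)"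
    by (rule Lpw_diff[OF p]) (use h f in \<open>simp_all add: Wsob_def\<close>)
  fix \<beta> :: "'d mindex" assume \<beta>: "0 < msize \<beta> \<and> msize \<beta> \<le> m"
  then have \<beta>m: "msize \<beta> \<le> m" and \<beta>0: "\<beta> \<noteq> (\<lambda>_. 0)" by auto
  have wd: "is_wderiv_v \<Omega> v \<beta> (\<lambda>x. h x - f x) (\<lambda>x. Dv \<Omega> v \<beta> h x - Dv \<Omega> v \<beta> f x)"
    by (rule wderiv_diff[OF Wsv_wderiv[OF h \<beta>m \<beta>0] Wsv_L1loc[OF h] Wsv_wderiv[OF f \<beta>m \<beta>0] Wsv_L1loc[OF f] \<beta>m])
  then show ex: "\<exists>g. is_wderiv_v \<Omega> v \<beta> (\<lambda>x. h x - f x) g" by blast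
  have "is_wderiv_v \<Omega> v \<beta> (\<lambda>x. h x - f x) (Dv \<Omega> v \<beta> (\<lambda>x. h x - f x))"
    unfolding Dv_def using \<beta>0 someI_ex[OF ex] by simp
  from wderiv_unique[OF \<eta> \<Omega> v_AE wd this]
  show "Lpw \<Omega> p (s_weights s v \<beta>) (Dv \<Omega> v \<beta> (\<lambda>x. h x - f x))"
    by (rule Lpw_cong_AE[OF Omega_lebesgue Lpw_diff[OF p Wsv_Lpw[OF h \<beta>m] Wsv_Lpw[OF f \<beta>m]]])
qed

section \<open>Membership and norm estimate for the cut-off product\<close>

lemma cut_deriv_0: "cut_deriv u (\<lambda>_. 0) x = chi_v x * u x"
proof -
  have "{\<beta>::'d mindex. \<beta> \<le> (\<lambda>_. 0)} = {\<lambda>_. 0}" by (auto simp: le_fun_def fun_eq_iff)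
  moreover have "(\<lambda>_::'d. 0::nat) - (\<lambda>_. 0) = (\<lambda>_. 0)" by (simp add: fun_eq_iff)
  ultimately show ?thesis by (simp add: cut_deriv_def mbinom_same Dv_def)
qed

lemma Dv_cut_AE:
  assumes u: "WS u" and \<alpha>: "msize \<alpha> \<le> m"
  shows "AE x in M. cut_deriv u \<alpha> x = Dv \<Omega> (\<lambda>_. 1) \<alpha> (\<lambda>x. chi_v x * u x) x"
proof (cases "\<alpha> = (\<lambda>_. 0)")
  case True
  show ?thesis unfolding True cut_deriv_0 by (simp add: Dv_def)
next
  case False
  note wd = cut_wderiv[OF u \<alpha>]
  have "is_wderiv \<Omega> \<alpha> (\<lambda>x. chi_v x * u x) (Dv \<Omega> (\<lambda>_. 1) \<alpha> (\<lambda>x. chi_v x * u x))"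
    unfolding Dv_def using False someI[of "is_wderiv \<Omega> \<alpha> (\<lambda>x. chi_v x * u x)", OF wd] by simp
  then show ?thesis by (intro wderiv_unique[OF \<eta> \<Omega> _ wd]) simp
qed

lemma cut_Lpw:
  assumes u: "WS u" and \<alpha>: "msize \<alpha> \<le> m"
  shows "Lpw \<Omega> p (\<lambda>_. 1) (Dv \<Omega> (\<lambda>_. 1) \<alpha> (\<lambda>x. chi_v x * u x))"
proof (rule Lpw_cong_AE[OF Omega_lebesgue _ Dv_cut_AE[OF assms]])
  show "Lpw \<Omega> p (\<lambda>_. 1) (cut_deriv u \<alpha>)"
    using cut_deriv_Lp[OF \<alpha>] u unfolding Lpw_def by (simp only: mult_1_right) blast
qed

lemma cut_W:
  assumes u: "WS u"
  shows "W \<Omega> p m (\<lambda>x. chi_v x * u x)"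
  unfolding Wsob_def
proof (intro conjI allI impI)
  have "msize (\<lambda>_::'d. 0) \<le> m" by simp
  from cut_Lpw[OF u this] show "Lpw \<Omega> p (\<lambda>_. 1) (\<lambda>x. chi_v x * u x)" by (simp add: Dv_def)
  fix \<alpha> :: "'d mindex" assume \<alpha>: "0 < msize \<alpha> \<and> msize \<alpha> \<le> m"
  then have "msize \<alpha> \<le> m" by simp
  from cut_wderiv[OF u this] show "\<exists>g. is_wderiv \<Omega> \<alpha> (\<lambda>x. chi_v x * u x) g" by blast
  from cut_Lpw[OF u \<open>msize \<alpha> \<le> m\<close>] show "Lpw \<Omega> p (\<lambda>_. 1) (Dv \<Omega> (\<lambda>_. 1) \<alpha> (\<lambda>x. chi_v x * u x))" .
qed

lemma energy_nonneg: "0 \<le> energy u"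
  unfolding energy_def by (intro sum_nonneg Bochner_Integration.integral_nonneg) simp

lemma cut_norm_bound:
  "\<exists>C>0. \<forall>u. WS u \<longrightarrow> W_norm \<Omega> p m (\<lambda>x. chi_v x * u x) \<le> C * Wsv_norm \<Omega> p m s v u"
proof -
  let ?N = "{\<alpha> :: 'd mindex. msize \<alpha> \<le> m}"
  define c where "c \<alpha> = (SOME C. C \<ge> 0 \<and> (\<forall>u. WS u \<longrightarrow> cut_deriv u \<alpha> \<in> borel_measurable M \<and>
    integrable M (\<lambda>x. \<bar>cut_deriv u \<alpha> x\<bar> powr p) \<and>
    (\<integral>x. \<bar>cut_deriv u \<alpha> x\<bar> powr p \<partial>M) \<le> C * energy u))" for \<alpha>
  have c: "c \<alpha> \<ge> 0 \<and> (\<forall>u. WS u \<longrightarrow> cut_deriv u \<alpha> \<in> borel_measurable M \<and>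
    integrable M (\<lambda>x. \<bar>cut_deriv u \<alpha> x\<bar> powr p) \<and>
    (\<integral>x. \<bar>cut_deriv u \<alpha> x\<bar> powr p \<partial>M) \<le> c \<alpha> * energy u)" if "msize \<alpha> \<le> m" for \<alpha>
    unfolding c_def by (rule someI_ex[OF cut_deriv_Lp[OF that]])
  \<comment> \<open>The summand 1 makes the constant strictly positive, so that the final \<delta>
    can be obtained by division.\<close>
  define E where "E = 1 + (\<Sum>\<alpha>\<in>?N. c \<alpha>)"
  have "0 \<le> (\<Sum>\<alpha>\<in>?N. c \<alpha>)" by (rule sum_nonneg) (use c in blast)
  then have E: "E > 0" by (simp add: E_def)
  have "W_norm \<Omega> p m (\<lambda>x. chi_v x * u x) \<le> E powr (1 / p) * Wsv_norm \<Omega> p m s v u" if u: "WS u" for u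
  proof -
    define S where "S = (\<Sum>\<alpha>\<in>?N. \<integral>x. \<bar>1 * Dv \<Omega> (\<lambda>_. 1) \<alpha> (\<lambda>x. chi_v x * u x) x\<bar> powr p \<partial>M)"
    have "S \<le> (\<Sum>\<alpha>\<in>?N. c \<alpha> * energy u)" unfolding S_def
    proof (rule sum_mono)
      fix \<alpha> :: "'d mindex" assume "\<alpha> \<in> ?N"
      then have \<alpha>: "msize \<alpha> \<le> m" by simp
      note ca = c[OF \<alpha>, THEN conjunct2, rule_format, OF u]
      have mD: "Dv \<Omega> (\<lambda>_. 1) \<alpha> (\<lambda>x. chi_v x * u x) \<in> borel_measurable M"
        by (rule borel_measurable_lebesgue_on_AE[OF Omega_lebesgue ca[THEN conjunct1] Dv_cut_AE[OF u \<alpha>]])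
      have "(\<integral>x. \<bar>1 * Dv \<Omega> (\<lambda>_. 1) \<alpha> (\<lambda>x. chi_v x * u x) x\<bar> powr p \<partial>M)
          = (\<integral>x. \<bar>cut_deriv u \<alpha> x\<bar> powr p \<partial>M)"
      proof (rule integral_cong_AE)
        show "AE x in M. \<bar>1 * Dv \<Omega> (\<lambda>_. 1) \<alpha> (\<lambda>x. chi_v x * u x) x\<bar> powr p = \<bar>cut_deriv u \<alpha> x\<bar> powr p"
          using Dv_cut_AE[OF u \<alpha>] by eventually_elim simp
        show "(\<lambda>x. \<bar>1 * Dv \<Omega> (\<lambda>_. 1) \<alpha> (\<lambda>x. chi_v x * u x) x\<bar> powr p) \<in> borel_measurable M"
          using mD by measurable
        show "(\<lambda>x. \<bar>cut_deriv u \<alpha> x\<bar> powr p) \<in> borel_measurable M"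
          using ca[THEN conjunct1] by measurable
      qed
      then show "(\<integral>x. \<bar>1 * Dv \<Omega> (\<lambda>_. 1) \<alpha> (\<lambda>x. chi_v x * u x) x\<bar> powr p \<partial>M) \<le> c \<alpha> * energy u"
        using ca by simp
    qed
    also have "\<dots> = (\<Sum>\<alpha>\<in>?N. c \<alpha>) * energy u" by (rule sum_distrib_right[symmetric])
    also have "\<dots> \<le> E * energy u" using energy_nonneg[of u] by (intro mult_right_mono) (simp_all add: E_def)
    finally have S: "S \<le> E * energy u" .
    have "0 \<le> S" unfolding S_def by (intro sum_nonneg Bochner_Integration.integral_nonneg) simp
    then have "S powr (1 / p) \<le> (E * energy u) powr (1 / p)" using S p by (intro powr_mono2) auto
    also have "\<dots> = E powr (1 / p) * energy u powr (1 / p)" using E energy_nonneg[of u] by (simp add: powr_mult)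
    finally show ?thesis unfolding Wsob_norm_def S_def energy_def by (simp only: mult.commute[of "s_weights s v _ _"])
  qed
  moreover have "E powr (1 / p) > 0" using E by simp
  ultimately show ?thesis by blast
qed

end

theorem theorem6:
  fixes \<Omega> :: "(real^'d::finite) set" and p :: real and m n :: nat
    and v :: "real^'d \<Rightarrow> real" and s :: "'d mindex \<Rightarrow> real" and \<eta> :: "real \<Rightarrow> real"
  assumes "open \<Omega>" and "1 \<le> p"
    and "Ck_star_on m \<Omega> v"
    and "admissible m s"
    and "n \<ge> 1"
    and "cutoff_eta \<eta>"
    and "\<forall>\<alpha>::'d mindex. 0 < msize \<alpha> \<and> msize \<alpha> \<le> m \<longrightarrow>
           (\<exists>C>0. \<forall>x\<in>Mset \<Omega> v n - Mset \<Omega> v (2*n). \<bar>cpartial \<alpha> v x\<bar> \<le> C)"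
  shows "(\<forall>f. Wsv \<Omega> p m s v f \<longrightarrow>
            W \<Omega> p m (\<lambda>x. chi \<eta> v n x * f x) \<and>
            (\<forall>\<alpha>::'d mindex. 0 < msize \<alpha> \<and> msize \<alpha> \<le> m \<longrightarrow>
               is_wderiv \<Omega> \<alpha> (\<lambda>x. chi \<eta> v n x * f x)
                 (\<lambda>x. \<Sum>\<beta>\<in>{\<beta>. \<beta> \<le> \<alpha>}. real (mbinom \<alpha> \<beta>) * Dv \<Omega> v \<beta> f x
                        * cpartial (\<alpha> - \<beta>) (chi \<eta> v n) x)))
       \<and> (\<forall>f. Wsv \<Omega> p m s v f \<longrightarrow> (\<forall>\<epsilon>>0. \<exists>\<delta>>0. \<forall>h. Wsv \<Omega> p m s v h \<longrightarrow>
            Wsv_norm \<Omega> p m s v (\<lambda>x. h x - f x) < \<delta> \<longrightarrow>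
            W_norm \<Omega> p m (\<lambda>x. chi \<eta> v n x * h x - chi \<eta> v n x * f x) < \<epsilon>))"
proof -
  interpret cutoff_setting \<Omega> p m n v s \<eta>
    using assms by unfold_locales
  show ?thesis
  proof (intro conjI allI impI)
    fix f assume f: "Wsv \<Omega> p m s v f"
    show "W \<Omega> p m (\<lambda>x. chi \<eta> v n x * f x)" by (rule cut_W[OF f])
    fix \<alpha> :: "'d mindex" assume "0 < msize \<alpha> \<and> msize \<alpha> \<le> m"
    then have "msize \<alpha> \<le> m" by simp
    from cut_wderiv[OF f this]
    show "is_wderiv \<Omega> \<alpha> (\<lambda>x. chi \<eta> v n x * f x)
                 (\<lambda>x. \<Sum>\<beta>\<in>{\<beta>. \<beta> \<le> \<alpha>}. real (mbinom \<alpha> \<beta>) * Dv \<Omega> v \<beta> f x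
                        * cpartial (\<alpha> - \<beta>) (chi \<eta> v n) x)"
      unfolding cut_deriv_def[abs_def] .
  next
    fix f and \<epsilon> :: real assume f: "Wsv \<Omega> p m s v f" and \<epsilon>: "0 < \<epsilon>"
    obtain C where C: "C > 0" "\<forall>u. Wsv \<Omega> p m s v u \<longrightarrow> W_norm \<Omega> p m (\<lambda>x. chi \<eta> v n x * u x) \<le> C * Wsv_norm \<Omega> p m s v u"
      using cut_norm_bound by blast
    show "\<exists>\<delta>>0. \<forall>h. Wsv \<Omega> p m s v h \<longrightarrow> Wsv_norm \<Omega> p m s v (\<lambda>x. h x - f x) < \<delta> \<longrightarrow>
            W_norm \<Omega> p m (\<lambda>x. chi \<eta> v n x * h x - chi \<eta> v n x * f x) < \<epsilon>"
    proof (intro exI[of _ "\<epsilon> / C"] conjI allI impI)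
      show "0 < \<epsilon> / C" using \<epsilon> C(1) by simp
      fix h assume h: "Wsv \<Omega> p m s v h" and d: "Wsv_norm \<Omega> p m s v (\<lambda>x. h x - f x) < \<epsilon> / C"
      \<comment> \<open>Multiplication by \<chi> is linear, so the norm bound for the single
        function \<open>h - f\<close>, which lies in the space by \<open>Wsv_diff\<close>, yields
        continuity at \<open>f\<close>.\<close>
      have "W_norm \<Omega> p m (\<lambda>x. chi \<eta> v n x * (h x - f x)) \<le> C * Wsv_norm \<Omega> p m s v (\<lambda>x. h x - f x)"
        by (rule C(2)[rule_format, OF Wsv_diff[OF h f]])
      also have "\<dots> < \<epsilon>" using d C(1) by (simp add: field_simps)
      finally show "W_norm \<Omega> p m (\<lambda>x. chi \<eta> v n x * h x - chi \<eta> v n x * f x) < \<epsilon>"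
        by (simp only: right_diff_distrib)
    qed
  qed
qed

end
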